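(* Let $(\mathcal{M},\otimes,\mathbf{1},\sigma)$ be a symmetric monoidal category which has equalizers and coequalizers that are preserved by $\otimes$. Let $i:K\to A$ be a monomorphism in $\mathsf{Hopf}_{\mathrm{coc}}(\mathcal{M})$ which is the equalizer in $\mathcal{M}$ of the pair $q_{A,A}(u_A\otimes\mathrm{Id}_A),\ q_{A,A}(\mathrm{Id}_A\otimes u_A):A\to A\otimes_K A$. The following conditions are equivalent: 1) $i$ is normal; 2) the coequalizer $\pi:A\to Q$ in $\mathcal{M}$ of the pair $m_A(\mathrm{Id}_A\otimes i),\ \mathrm{Id}_A\otimes\varepsilon_K:A\otimes K\to A$ is a morphism in $\mathsf{Hopf}_{\mathrm{coc}}(\mathcal{M})$; 3) $i$ is a kernel in $\mathsf{Hopf}_{\mathrm{coc}}(\mathcal{M})$. The implications $3)\Rightarrow 1)\Rightarrow 2)$ hold for any monomorphism $i:K\to A$ in $\mathsf{Hopf}_{\mathrm{coc}}(\mathcal{M})$, without asking that $i$ is the equalizer in $\mathcal{M}$ of the pair $q_{A,A}(u_A\otimes\mathrm{Id}_A),\ q_{A,A}(\mathrm{Id}_A\otimes u_A):A\to A\otimes_K A$.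
   Context: Associativity and unit constraints are suppressed. "Preserved by $\otimes$" means preserved by $M\otimes(-)$ and $(-)\otimes M$ for every object $M$. $\mathsf{Hopf}_{\mathrm{coc}}(\mathcal{M})$ is the category of Hopf monoids $(A,m_A,u_A,\Delta_A,\varepsilon_A,S_A)$ in $\mathcal{M}$ with $\sigma_{A,A}\Delta_A=\Delta_A$ and Hopf monoid morphisms; it is pointed with zero object $\mathbf{1}$ (the zero morphism $A\to B$ is $u_B\varepsilon_A$), and a kernel of $f:A\to B$ is the equalizer in $\mathsf{Hopf}_{\mathrm{coc}}(\mathcal{M})$ of $f$ and $u_B\varepsilon_A$. $q_{A,A}:A\otimes A\to A\otimes_K A$ is the coequalizer in $\mathcal{M}$ of $m_A(\mathrm{Id}_A\otimes i)\otimes\mathrm{Id}_A$ and $\mathrm{Id}_A\otimes m_A(i\otimes\mathrm{Id}_A)$, $A\otimes K\otimes A\to A\otimes A$. Adjoint morphism: $\mathrm{ad}_A:=m_A(m_A\otimes\mathrm{Id}_A)(\mathrm{Id}_A\otimes\sigma_{A,A})((\mathrm{Id}_A\otimes S_A)\Delta_A\otimes\mathrm{Id}_A):A\otimes A\to A$. A monomorphism $i:K\to A$ in $\mathsf{Hopf}_{\mathrm{coc}}(\mathcal{M})$ is normal if there exists a morphism $\psi:A\otimes K\to K$ in $\mathcal{M}$ with $i\psi=\mathrm{ad}_A(\mathrm{Id}_A\otimes i)$. In 2), $Q$ carries the unique comonoid structure making $\pi$ a comonoid morphism (it is cocommutative); "$\pi$ is a morphism in $\mathsf{Hopf}_{\mathrm{coc}}(\mathcal{M})$"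 means that this comonoid $Q$ carries a structure of cocommutative Hopf monoid for which $\pi$ is a Hopf monoid morphism. *)

theory Defs
  imports Main
begin

section \<open>Categories, equalizers and coequalizers\<close>

text \<open>
  Morphisms are always considered relative to hom-sets. Distinct hom-sets need not be disjoint, so
  that one element may be a morphism between several pairs of objects; hence the notions below take
  source and target objects as explicit arguments. Composition is written in the usual
  (right-to-left) order.
\<close>

record ('o, 'm) category =
  Ob :: "'o set"
  Hom :: "'o \<Rightarrow> 'o \<Rightarrow> 'm set"
  Idt :: "'o \<Rightarrow> 'm" ("\<iota>\<index>")
  Cmp :: "'m \<Rightarrow> 'm \<Rightarrow> 'm" (infixl "\<cdot>\<index>" 65)

locale category =
  fixes C :: "('o, 'm, 'z) category_scheme" (structure)
  assumes Hom_Ob: "f \<in> Hom C A B \<Longrightarrow> A \<in> Ob C \<and> B \<in> Ob C"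
    and Idt_Hom: "A \<in> Ob C \<Longrightarrow> \<iota> A \<in> Hom C A A"
    and Cmp_Hom: "\<lbrakk>f \<in> Hom C A B; g \<in> Hom C B D\<rbrakk> \<Longrightarrow> g \<cdot> f \<in> Hom C A D"
    and Cmp_Idt: "f \<in> Hom C A B \<Longrightarrow> f \<cdot> \<iota> A = f"
    and Idt_Cmp: "f \<in> Hom C A B \<Longrightarrow> \<iota> B \<cdot> f = f"
    and Cmp_assoc: "\<lbrakk>f \<in> Hom C A B; g \<in> Hom C B D; h \<in> Hom C D E\<rbrakk>
      \<Longrightarrow> (h \<cdot> g) \<cdot> f = h \<cdot> (g \<cdot> f)"

context
  fixes C :: "('o, 'm, 'z) category_scheme" (structure)
begin

definition is_inverse :: "'o \<Rightarrow> 'o \<Rightarrow> 'm \<Rightarrow> 'm \<Rightarrow> bool" where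
  "is_inverse A B f g \<longleftrightarrow> f \<in> Hom C A B \<and> g \<in> Hom C B A \<and> g \<cdot> f = \<iota> A \<and> f \<cdot> g = \<iota> B"

definition is_iso :: "'o \<Rightarrow> 'o \<Rightarrow> 'm \<Rightarrow> bool" where
  "is_iso A B f \<longleftrightarrow> (\<exists>g. is_inverse A B f g)"

definition inv_of :: "'o \<Rightarrow> 'o \<Rightarrow> 'm \<Rightarrow> 'm" where
  "inv_of A B f = (THE g. is_inverse A B f g)"

definition is_mono :: "'o \<Rightarrow> 'o \<Rightarrow> 'm \<Rightarrow> bool" where
  "is_mono A B f \<longleftrightarrow> f \<in> Hom C A B \<and>
     (\<forall>T. \<forall>g \<in> Hom C T A. \<forall>h \<in> Hom C T A. f \<cdot> g = f \<cdot> h \<longrightarrow> g = h)"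

definition is_equalizer :: "'o \<Rightarrow> 'o \<Rightarrow> 'm \<Rightarrow> 'm \<Rightarrow> 'o \<Rightarrow> 'm \<Rightarrow> bool" where
  "is_equalizer A B f g E e \<longleftrightarrow>
     f \<in> Hom C A B \<and> g \<in> Hom C A B \<and> e \<in> Hom C E A \<and> f \<cdot> e = g \<cdot> e \<and>
     (\<forall>T. \<forall>t \<in> Hom C T A. f \<cdot> t = g \<cdot> t \<longrightarrow> (\<exists>!s. s \<in> Hom C T E \<and> e \<cdot> s = t))"

definition is_coequalizer :: "'o \<Rightarrow> 'o \<Rightarrow> 'm \<Rightarrow> 'm \<Rightarrow> 'o \<Rightarrow> 'm \<Rightarrow> bool" where
  "is_coequalizer A B f g Q q \<longleftrightarrow>
     f \<in> Hom C A B \<and> g \<in> Hom C A B \<and> q \<in> Hom C B Q \<and> q \<cdot> f = q \<cdot> g \<and>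
     (\<forall>T. \<forall>t \<in> Hom C B T. t \<cdot> f = t \<cdot> g \<longrightarrow> (\<exists>!s. s \<in> Hom C Q T \<and> s \<cdot> q = t))"

definition has_equalizers :: bool where
  "has_equalizers \<longleftrightarrow>
     (\<forall>A B. \<forall>f \<in> Hom C A B. \<forall>g \<in> Hom C A B. \<exists>E e. is_equalizer A B f g E e)"

definition has_coequalizers :: bool where
  "has_coequalizers \<longleftrightarrow>
     (\<forall>A B. \<forall>f \<in> Hom C A B. \<forall>g \<in> Hom C A B. \<exists>Q q. is_coequalizer A B f g Q q)"

end


section \<open>Symmetric monoidal categories\<close>

text \<open>
  The monoidal structure is not assumed to be strict: the associativity and unit constraints are
  part of the data, and they are inserted explicitly wherever the usual notation suppresses them.
  The tensor product is \<open>\<boxtimes>\<close> on objects and \<open>\<otimes>\<close> on morphisms.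
\<close>

record ('o, 'm) sym_monoidal_category = "('o, 'm) category" +
  tensor_ob :: "'o \<Rightarrow> 'o \<Rightarrow> 'o" (infixr "\<boxtimes>\<index>" 75)
  tensor :: "'m \<Rightarrow> 'm \<Rightarrow> 'm" (infixr "\<otimes>\<index>" 75)
  unit_ob :: 'o ("\<one>\<index>")
  assoc :: "'o \<Rightarrow> 'o \<Rightarrow> 'o \<Rightarrow> 'm" ("\<alpha>\<index>")
  lunit :: "'o \<Rightarrow> 'm" ("\<lambda>\<^sub>l\<index>")
  runit :: "'o \<Rightarrow> 'm" ("\<rho>\<index>")
  braid :: "'o \<Rightarrow> 'o \<Rightarrow> 'm" ("\<sigma>\<index>")

locale sym_monoidal_category = category M
  for M :: "('o, 'm, 'z) sym_monoidal_category_scheme" (structure) +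
  assumes unit_Ob: "\<one> \<in> Ob M"
    and tensor_Ob: "\<lbrakk>A \<in> Ob M; B \<in> Ob M\<rbrakk> \<Longrightarrow> A \<boxtimes> B \<in> Ob M"
    and tensor_Hom: "\<lbrakk>f \<in> Hom M A B; g \<in> Hom M D E\<rbrakk> \<Longrightarrow> f \<otimes> g \<in> Hom M (A \<boxtimes> D) (B \<boxtimes> E)"
    and tensor_Idt: "\<lbrakk>A \<in> Ob M; B \<in> Ob M\<rbrakk> \<Longrightarrow> \<iota> A \<otimes> \<iota> B = \<iota> (A \<boxtimes> B)"
    and tensor_Cmp:
      "\<lbrakk>f \<in> Hom M A B; f' \<in> Hom M B D; g \<in> Hom M A' B'; g' \<in> Hom M B' D'\<rbrakk>
       \<Longrightarrow> (f' \<cdot> f) \<otimes> (g' \<cdot> g) = (f' \<otimes> g') \<cdot> (f \<otimes> g)"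
    and assoc_iso: "\<lbrakk>A \<in> Ob M; B \<in> Ob M; D \<in> Ob M\<rbrakk>
       \<Longrightarrow> is_iso M ((A \<boxtimes> B) \<boxtimes> D) (A \<boxtimes> (B \<boxtimes> D)) (\<alpha> A B D)"
    and assoc_natural: "\<lbrakk>f \<in> Hom M A A'; g \<in> Hom M B B'; h \<in> Hom M D D'\<rbrakk>
       \<Longrightarrow> \<alpha> A' B' D' \<cdot> ((f \<otimes> g) \<otimes> h) = (f \<otimes> (g \<otimes> h)) \<cdot> \<alpha> A B D"
    and lunit_iso: "A \<in> Ob M \<Longrightarrow> is_iso M (\<one> \<boxtimes> A) A (\<lambda>\<^sub>l A)"
    and lunit_natural: "f \<in> Hom M A B \<Longrightarrow> \<lambda>\<^sub>l B \<cdot> (\<iota> \<one> \<otimes> f) = f \<cdot> \<lambda>\<^sub>l A"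
    and runit_iso: "A \<in> Ob M \<Longrightarrow> is_iso M (A \<boxtimes> \<one>) A (\<rho> A)"
    and runit_natural: "f \<in> Hom M A B \<Longrightarrow> \<rho> B \<cdot> (f \<otimes> \<iota> \<one>) = f \<cdot> \<rho> A"
    and pentagon: "\<lbrakk>A \<in> Ob M; B \<in> Ob M; D \<in> Ob M; E \<in> Ob M\<rbrakk>
       \<Longrightarrow> \<alpha> A B (D \<boxtimes> E) \<cdot> \<alpha> (A \<boxtimes> B) D E
         = (\<iota> A \<otimes> \<alpha> B D E) \<cdot> \<alpha> A (B \<boxtimes> D) E \<cdot> (\<alpha> A B D \<otimes> \<iota> E)"
    and triangle: "\<lbrakk>A \<in> Ob M; B \<in> Ob M\<rbrakk>
       \<Longrightarrow> (\<iota> A \<otimes> \<lambda>\<^sub>l B) \<cdot> \<alpha> A \<one> B = \<rho> A \<otimes> \<iota> B"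
    and braid_Hom: "\<lbrakk>A \<in> Ob M; B \<in> Ob M\<rbrakk> \<Longrightarrow> \<sigma> A B \<in> Hom M (A \<boxtimes> B) (B \<boxtimes> A)"
    and braid_natural: "\<lbrakk>f \<in> Hom M A A'; g \<in> Hom M B B'\<rbrakk>
       \<Longrightarrow> \<sigma> A' B' \<cdot> (f \<otimes> g) = (g \<otimes> f) \<cdot> \<sigma> A B"
    and braid_symmetric: "\<lbrakk>A \<in> Ob M; B \<in> Ob M\<rbrakk> \<Longrightarrow> \<sigma> B A \<cdot> \<sigma> A B = \<iota> (A \<boxtimes> B)"
    and hexagon: "\<lbrakk>A \<in> Ob M; B \<in> Ob M; D \<in> Ob M\<rbrakk>
       \<Longrightarrow> \<alpha> B D A \<cdot> \<sigma> A (B \<boxtimes> D) \<cdot> \<alpha> A B D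
         = (\<iota> B \<otimes> \<sigma> A D) \<cdot> \<alpha> B A D \<cdot> (\<sigma> A B \<otimes> \<iota> D)"

context
  fixes M :: "('o, 'm, 'z) sym_monoidal_category_scheme" (structure)
begin

definition equalizers_preserved :: bool where
  "equalizers_preserved \<longleftrightarrow>
     (\<forall>A B f g E e. is_equalizer M A B f g E e \<longrightarrow>
        (\<forall>X \<in> Ob M.
           is_equalizer M (X \<boxtimes> A) (X \<boxtimes> B) (\<iota> X \<otimes> f) (\<iota> X \<otimes> g) (X \<boxtimes> E) (\<iota> X \<otimes> e) \<and>
           is_equalizer M (A \<boxtimes> X) (B \<boxtimes> X) (f \<otimes> \<iota> X) (g \<otimes> \<iota> X) (E \<boxtimes> X) (e \<otimes> \<iota> X)))"

definition coequalizers_preserved :: bool where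
  "coequalizers_preserved \<longleftrightarrow>
     (\<forall>A B f g Q q. is_coequalizer M A B f g Q q \<longrightarrow>
        (\<forall>X \<in> Ob M.
           is_coequalizer M (X \<boxtimes> A) (X \<boxtimes> B) (\<iota> X \<otimes> f) (\<iota> X \<otimes> g) (X \<boxtimes> Q) (\<iota> X \<otimes> q) \<and>
           is_coequalizer M (A \<boxtimes> X) (B \<boxtimes> X) (f \<otimes> \<iota> X) (g \<otimes> \<iota> X) (Q \<boxtimes> X) (q \<otimes> \<iota> X)))"

definition assoc_inv :: "'o \<Rightarrow> 'o \<Rightarrow> 'o \<Rightarrow> 'm" where
  "assoc_inv A B D = inv_of M ((A \<boxtimes> B) \<boxtimes> D) (A \<boxtimes> (B \<boxtimes> D)) (\<alpha> A B D)"

definition lunit_inv :: "'o \<Rightarrow> 'm" where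
  "lunit_inv A = inv_of M (\<one> \<boxtimes> A) A (\<lambda>\<^sub>l A)"

definition runit_inv :: "'o \<Rightarrow> 'm" where
  "runit_inv A = inv_of M (A \<boxtimes> \<one>) A (\<rho> A)"

text \<open>The morphism \<open>A \<otimes> \<sigma>\<^bsub>B,D\<^esub> \<otimes> E\<close>, from \<open>(A \<otimes> B) \<otimes> (D \<otimes> E)\<close> to \<open>(A \<otimes> D) \<otimes> (B \<otimes> E)\<close>.\<close>

definition mid_swap :: "'o \<Rightarrow> 'o \<Rightarrow> 'o \<Rightarrow> 'o \<Rightarrow> 'm" where
  "mid_swap A B D E =
     assoc_inv A D (B \<boxtimes> E)
     \<cdot> (\<iota> A \<otimes> (\<alpha> D B E \<cdot> (\<sigma> B D \<otimes> \<iota> E) \<cdot> assoc_inv B D E))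
     \<cdot> \<alpha> A B (D \<boxtimes> E)"

end


section \<open>Cocommutative Hopf monoids\<close>

record ('o, 'm) hopf_data =
  hob :: 'o
  mult :: 'm
  unt :: 'm
  comult :: 'm
  counit :: 'm
  antipode :: 'm

context
  fixes M :: "('o, 'm, 'z) sym_monoidal_category_scheme" (structure)
begin

definition is_monoid :: "'o \<Rightarrow> 'm \<Rightarrow> 'm \<Rightarrow> bool" where
  "is_monoid A m u \<longleftrightarrow>
     A \<in> Ob M \<and> m \<in> Hom M (A \<boxtimes> A) A \<and> u \<in> Hom M \<one> A \<and>
     m \<cdot> (m \<otimes> \<iota> A) = m \<cdot> (\<iota> A \<otimes> m) \<cdot> \<alpha> A A A \<and>
     m \<cdot> (u \<otimes> \<iota> A) = \<lambda>\<^sub>l A \<and>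
     m \<cdot> (\<iota> A \<otimes> u) = \<rho> A"

definition is_comonoid :: "'o \<Rightarrow> 'm \<Rightarrow> 'm \<Rightarrow> bool" where
  "is_comonoid A d e \<longleftrightarrow>
     A \<in> Ob M \<and> d \<in> Hom M A (A \<boxtimes> A) \<and> e \<in> Hom M A \<one> \<and>
     \<alpha> A A A \<cdot> (d \<otimes> \<iota> A) \<cdot> d = (\<iota> A \<otimes> d) \<cdot> d \<and>
     \<lambda>\<^sub>l A \<cdot> (e \<otimes> \<iota> A) \<cdot> d = \<iota> A \<and>
     \<rho> A \<cdot> (\<iota> A \<otimes> e) \<cdot> d = \<iota> A"

text \<open>
  The four compatibility conditions say that comultiplication and counit are monoid morphisms,
  where \<open>A \<otimes> A\<close> and the unit object carry their standard monoid structures.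
\<close>

definition is_bimonoid :: "'o \<Rightarrow> 'm \<Rightarrow> 'm \<Rightarrow> 'm \<Rightarrow> 'm \<Rightarrow> bool" where
  "is_bimonoid A m u d e \<longleftrightarrow>
     is_monoid A m u \<and> is_comonoid A d e \<and>
     d \<cdot> m = (m \<otimes> m) \<cdot> mid_swap M A A A A \<cdot> (d \<otimes> d) \<and>
     d \<cdot> u = (u \<otimes> u) \<cdot> lunit_inv M \<one> \<and>
     e \<cdot> m = \<lambda>\<^sub>l \<one> \<cdot> (e \<otimes> e) \<and>
     e \<cdot> u = \<iota> \<one>"

definition is_hopf_monoid :: "('o, 'm) hopf_data \<Rightarrow> bool" where
  "is_hopf_monoid A \<longleftrightarrow>
     is_bimonoid (hob A) (mult A) (unt A) (comult A) (counit A) \<and>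
     antipode A \<in> Hom M (hob A) (hob A) \<and>
     mult A \<cdot> (antipode A \<otimes> \<iota> (hob A)) \<cdot> comult A = unt A \<cdot> counit A \<and>
     mult A \<cdot> (\<iota> (hob A) \<otimes> antipode A) \<cdot> comult A = unt A \<cdot> counit A"

definition is_cocommutative :: "('o, 'm) hopf_data \<Rightarrow> bool" where
  "is_cocommutative A \<longleftrightarrow> \<sigma> (hob A) (hob A) \<cdot> comult A = comult A"

text \<open>
  Compatibility with the antipodes is included as part of preserving the structure; as usual, it
  follows from the other conditions.
\<close>

definition is_hopf_morphism :: "('o, 'm) hopf_data \<Rightarrow> ('o, 'm) hopf_data \<Rightarrow> 'm \<Rightarrow> bool" where
  "is_hopf_morphism A B f \<longleftrightarrow>
     f \<in> Hom M (hob A) (hob B) \<and>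
     f \<cdot> mult A = mult B \<cdot> (f \<otimes> f) \<and>
     f \<cdot> unt A = unt B \<and>
     comult B \<cdot> f = (f \<otimes> f) \<cdot> comult A \<and>
     counit B \<cdot> f = counit A \<and>
     f \<cdot> antipode A = antipode B \<cdot> f"

definition Hopf_coc :: "(('o, 'm) hopf_data, 'm) category" where
  "Hopf_coc =
     \<lparr>Ob = {A. is_hopf_monoid A \<and> is_cocommutative A},
      Hom = (\<lambda>A B. {f. is_hopf_monoid A \<and> is_cocommutative A \<and>
                       is_hopf_monoid B \<and> is_cocommutative B \<and> is_hopf_morphism A B f}),
      Idt = (\<lambda>A. \<iota> (hob A)),
      Cmp = (\<lambda>g f. g \<cdot> f)\<rparr>"

definition is_kernel :: "('o, 'm) hopf_data \<Rightarrow> ('o, 'm) hopf_data \<Rightarrow> 'm \<Rightarrow> bool" where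
  "is_kernel K A i \<longleftrightarrow>
     (\<exists>B. \<exists>f \<in> Hom Hopf_coc A B. is_equalizer Hopf_coc A B f (unt B \<cdot> counit A) K i)"

definition ad :: "('o, 'm) hopf_data \<Rightarrow> 'm" where
  "ad A =
     (let X = hob A in
        mult A \<cdot> (mult A \<otimes> \<iota> X)
        \<cdot> assoc_inv M X X X \<cdot> (\<iota> X \<otimes> \<sigma> X X) \<cdot> \<alpha> X X X
        \<cdot> (((\<iota> X \<otimes> antipode A) \<cdot> comult A) \<otimes> \<iota> X))"

definition is_normal :: "('o, 'm) hopf_data \<Rightarrow> ('o, 'm) hopf_data \<Rightarrow> 'm \<Rightarrow> bool" where
  "is_normal K A i \<longleftrightarrow>
     is_mono Hopf_coc K A i \<and>
     (\<exists>\<psi> \<in> Hom M (hob A \<boxtimes> hob K) (hob K). i \<cdot> \<psi> = ad A \<cdot> (\<iota> (hob A) \<otimes> i))"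

text \<open>
  \<open>q : A \<otimes> A \<rightarrow> Z\<close> exhibits \<open>Z\<close> as the tensor product \<open>A \<otimes>\<^sub>K A\<close>, where \<open>K\<close> acts on both sides
  of \<open>A\<close> through \<open>i\<close>.
\<close>

definition is_tensor_over ::
  "('o, 'm) hopf_data \<Rightarrow> ('o, 'm) hopf_data \<Rightarrow> 'm \<Rightarrow> 'o \<Rightarrow> 'm \<Rightarrow> bool" where
  "is_tensor_over K A i Z q \<longleftrightarrow>
     is_coequalizer M ((hob A \<boxtimes> hob K) \<boxtimes> hob A) (hob A \<boxtimes> hob A)
       ((mult A \<cdot> (\<iota> (hob A) \<otimes> i)) \<otimes> \<iota> (hob A))
       ((\<iota> (hob A) \<otimes> (mult A \<cdot> (i \<otimes> \<iota> (hob A)))) \<cdot> \<alpha> (hob A) (hob K) (hob A))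
       Z q"

definition is_equalizer_of_tensor_over ::
  "('o, 'm) hopf_data \<Rightarrow> ('o, 'm) hopf_data \<Rightarrow> 'm \<Rightarrow> 'o \<Rightarrow> 'm \<Rightarrow> bool" where
  "is_equalizer_of_tensor_over K A i Z q \<longleftrightarrow>
     is_equalizer M (hob A) Z
       (q \<cdot> (unt A \<otimes> \<iota> (hob A)) \<cdot> lunit_inv M (hob A))
       (q \<cdot> (\<iota> (hob A) \<otimes> unt A) \<cdot> runit_inv M (hob A))
       (hob K) i"

definition is_quotient ::
  "('o, 'm) hopf_data \<Rightarrow> ('o, 'm) hopf_data \<Rightarrow> 'm \<Rightarrow> 'o \<Rightarrow> 'm \<Rightarrow> bool" where
  "is_quotient K A i Q p \<longleftrightarrow>
     is_coequalizer M (hob A \<boxtimes> hob K) (hob A)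
       (mult A \<cdot> (\<iota> (hob A) \<otimes> i))
       (\<rho> (hob A) \<cdot> (\<iota> (hob A) \<otimes> counit K))
       Q p"

text \<open>
  A morphism \<open>p : A \<rightarrow> Q\<close> of the ambient category whose target is a mere object is a morphism of
  cocommutative Hopf monoids if \<open>Q\<close> carries such a structure for which it is one. If \<open>p\<close> is a
  coequalizer as above, then \<open>p\<close> and \<open>p \<otimes> p\<close> are epimorphisms, so the underlying comonoid of
  \<open>H\<close> is necessarily the unique one for which \<open>p\<close> is a comonoid morphism.
\<close>

definition is_Hopf_coc_quotient_map :: "('o, 'm) hopf_data \<Rightarrow> 'o \<Rightarrow> 'm \<Rightarrow> bool" where
  "is_Hopf_coc_quotient_map A Q p \<longleftrightarrow> (\<exists>H. hob H = Q \<and> p \<in> Hom Hopf_coc A H)"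

end

end

theory Submission
  imports Defs
begin

text \<open>
  For a cocommutative comonoid \<open>T\<close>, the comonoid morphisms from \<open>T\<close> to a cocommutative Hopf monoid \<open>A\<close>
  form a group under convolution, and tensor products are products of cocommutative comonoids; so
  identities between morphisms can be checked by computing in groups.

  If \<open>i\<close> is a kernel of \<open>f : A \<rightarrow> B\<close>, the equalizer \<open>E\<close> in \<open>M\<close> of \<open>(A \<otimes> f) \<Delta>\<close> and \<open>(A \<otimes> u\<epsilon>) \<Delta>\<close> is a
  Hopf monoid mapping to \<open>K\<close> over \<open>A\<close>, and \<open>f (a k a\<inverse>) = 1\<close> makes the conjugation of \<open>K\<close> factor
  through \<open>E\<close>, hence through \<open>i\<close>.

  If \<open>i\<close> is normal, then \<open>p (\<phi> k) = p \<phi>\<close> together with \<open>a k b = (a b) (b\<inverse> k b)\<close> and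
  \<open>(a k)\<inverse> = a\<inverse> (a k\<inverse> a\<inverse>)\<close> shows that multiplication and antipode descend to \<open>Q\<close>.

  If \<open>p\<close> is a Hopf monoid morphism, then \<open>Q \<otimes> A \<cong> A \<otimes>\<^sub>K A\<close> via \<open>p(a) \<otimes> c \<mapsto> a\<^sub>1 \<otimes>\<^sub>K S(a\<^sub>2) c\<close>. For \<open>t\<close> with
  \<open>p t\<close> trivial this gives \<open>t \<otimes>\<^sub>K 1 = 1 \<otimes>\<^sub>K t\<close>, so \<open>t\<close> factors through the equalizer \<open>i\<close>.
\<close>

section \<open>Symmetric monoidal categories with disjoint hom-sets\<close>

text \<open>The constraint isomorphisms are explicit. The coherence results serve to show once that
  cocommutative comonoids are closed under tensor products and that these are products; from then on
  a morphism on a tensor product is an expression in the generic elements \<open>prj1\<close> and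
  \<open>prj2\<close>.

  The universal property of a kernel tests Hopf monoid morphisms only, but conjugation is merely a
  comonoid morphism. The equalizer E mediates: conjugation factors through it in M, and being a Hopf
  monoid it is subject to the universal property.

  A monomorphism of \<open>Hopf_coc M\<close> is not known to be one in M. So for a normal
  \<open>i\<close> little can be said about the witness \<open>\<psi>\<close> beyond its composite
  with \<open>i\<close>; its counit is all that the quotient construction asks for. If
  \<open>i\<close> is the equalizer of the tensor pair, it is regular in M, its tensor powers are
  monomorphisms, and a lift found in M is a Hopf monoid morphism.

  Preservation concerns one tensor factor at a time. The comultiplication of E and the
  multiplication of Q are therefore each obtained by two successive factorizations.\<close>

text \<open>
  If morphisms determine their source and target, the typing conditions of the axioms contain no
  intermediate objects and the simplifier discharges them. The general case reduces to this one by
  replacing each morphism by a triple that records its source and target.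
\<close>

locale typed_smc = sym_monoidal_category M
  for M :: "('o, 'm, 'z) sym_monoidal_category_scheme" (structure) +
  fixes src tgt :: "'m \<Rightarrow> 'o"
  assumes Hom_src: "f \<in> Hom M A B \<Longrightarrow> src f = A"
    and Hom_tgt: "f \<in> Hom M A B \<Longrightarrow> tgt f = B"
    and src_cmp [simp]: "src (g \<cdot> f) = src f"
    and tgt_cmp [simp]: "tgt (g \<cdot> f) = tgt g"
    and src_tensor [simp]: "src (f \<otimes> g) = src f \<boxtimes> src g"
    and tgt_tensor [simp]: "tgt (f \<otimes> g) = tgt f \<boxtimes> tgt g"
begin

definition arr :: "'m \<Rightarrow> bool" where
  "arr f \<longleftrightarrow> f \<in> Hom M (src f) (tgt f)"

lemma Hom_iff: "f \<in> Hom M A B \<longleftrightarrow> arr f \<and> src f = A \<and> tgt f = B"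
  using Hom_src Hom_tgt arr_def by metis

lemma src_Ob [simp]: "arr f \<Longrightarrow> src f \<in> Ob M"
  and tgt_Ob [simp]: "arr f \<Longrightarrow> tgt f \<in> Ob M"
  using Hom_Ob arr_def by blast+

lemmas tensor_Ob [simp] unit_Ob [simp]

lemma arr_idt [simp]: "A \<in> Ob M \<Longrightarrow> arr (\<iota> A)"
  and src_idt [simp]: "A \<in> Ob M \<Longrightarrow> src (\<iota> A) = A"
  and tgt_idt [simp]: "A \<in> Ob M \<Longrightarrow> tgt (\<iota> A) = A"
  using Idt_Hom[of A] by (auto simp: Hom_iff)

lemma arr_cmp [simp]: "\<lbrakk>arr f; arr g; tgt f = src g\<rbrakk> \<Longrightarrow> arr (g \<cdot> f)"
  using Cmp_Hom[of f "src f" "tgt f" g "tgt g"] by (auto simp: Hom_iff)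

lemma arr_tensor [simp]: "\<lbrakk>arr f; arr g\<rbrakk> \<Longrightarrow> arr (f \<otimes> g)"
  using tensor_Hom[of f "src f" "tgt f" g "src g" "tgt g"] by (auto simp: Hom_iff)

lemma cmp_idt [simp]: "\<lbrakk>arr f; src f = A\<rbrakk> \<Longrightarrow> f \<cdot> \<iota> A = f"
  using Cmp_Idt by (auto simp: Hom_iff)

lemma idt_cmp [simp]: "\<lbrakk>arr f; tgt f = A\<rbrakk> \<Longrightarrow> \<iota> A \<cdot> f = f"
  using Idt_Cmp by (auto simp: Hom_iff)

lemma cmp_assoc:
  "\<lbrakk>arr f; arr g; arr h; tgt f = src g; tgt g = src h\<rbrakk> \<Longrightarrow> (h \<cdot> g) \<cdot> f = h \<cdot> (g \<cdot> f)"
  using Cmp_assoc by (auto simp: Hom_iff)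

lemma idt_tensor [simp]: "\<lbrakk>A \<in> Ob M; B \<in> Ob M\<rbrakk> \<Longrightarrow> \<iota> A \<otimes> \<iota> B = \<iota> (A \<boxtimes> B)"
  using tensor_Idt .

lemma interchange:
  "\<lbrakk>arr f; arr f'; arr g; arr g'; tgt f = src f'; tgt g = src g'\<rbrakk>
    \<Longrightarrow> (f' \<otimes> g') \<cdot> (f \<otimes> g) = (f' \<cdot> f) \<otimes> (g' \<cdot> g)"
  using tensor_Cmp[of f "src f" "tgt f" f' "tgt f'" g "src g" "tgt g" g' "tgt g'"] by (auto simp: Hom_iff)

text \<open>\<open>cmp_assoc\<close> nests composites to the right, where an equation for
  \<open>g \<cdot> f\<close> no longer matches once \<open>f\<close> is composed further with
  \<open>x\<close>. This form restores the match; the \<open>_ext\<close> variants of rewrite rules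
  serve the same purpose.\<close>

lemma cmp_extend:
  assumes "g \<cdot> f = k" "arr f" "arr g" "tgt f = src g" "arr x" "tgt x = src f"
  shows "g \<cdot> (f \<cdot> x) = k \<cdot> x"
  using assms cmp_assoc[of x f g] by simp

lemma interchange_ext:
  "\<lbrakk>arr f; arr f'; arr g; arr g'; tgt f = src f'; tgt g = src g'; arr x; tgt x = src f \<boxtimes> src g\<rbrakk>
    \<Longrightarrow> (f' \<otimes> g') \<cdot> ((f \<otimes> g) \<cdot> x) = ((f' \<cdot> f) \<otimes> (g' \<cdot> g)) \<cdot> x"
  by (simp add: interchange flip: cmp_assoc)

section \<open>Inverses and cancellation\<close>

definition inverse_arr :: "'m \<Rightarrow> 'm \<Rightarrow> bool" where
  "inverse_arr f g \<longleftrightarrow> arr f \<and> arr g \<and> src g = tgt f \<and> tgt g = src f \<and>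
     g \<cdot> f = \<iota> (src f) \<and> f \<cdot> g = \<iota> (tgt f)"

lemma inverse_arr_iff: "is_inverse M A B f g \<longleftrightarrow> inverse_arr f g \<and> src f = A \<and> tgt f = B"
  unfolding is_inverse_def inverse_arr_def Hom_iff by auto

lemma inverse_arr_unique: "\<lbrakk>inverse_arr f g; inverse_arr f h\<rbrakk> \<Longrightarrow> g = h"
  unfolding inverse_arr_def by (metis cmp_assoc cmp_idt idt_cmp)

lemma inv_of_inverse:
  assumes "is_iso M A B f"
  shows "inverse_arr f (inv_of M A B f)" "src f = A" "tgt f = B"
proof -
  obtain g where g: "is_inverse M A B f g" using assms is_iso_def by metis
  then have "inv_of M A B f = g"
    unfolding inv_of_def inverse_arr_iff by (auto intro: inverse_arr_unique)
  with g show "inverse_arr f (inv_of M A B f)" "src f = A" "tgt f = B" by (auto simp: inverse_arr_iff)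
qed

lemma inverse_tensor: "\<lbrakk>inverse_arr f f'; inverse_arr g g'\<rbrakk> \<Longrightarrow> inverse_arr (f \<otimes> g) (f' \<otimes> g')"
  unfolding inverse_arr_def by (auto simp: interchange)

lemma inverse_cmp:
  "\<lbrakk>inverse_arr f f'; inverse_arr g g'; tgt f = src g\<rbrakk> \<Longrightarrow> inverse_arr (g \<cdot> f) (f' \<cdot> g')"
  unfolding inverse_arr_def
  by (auto simp: cmp_assoc) (metis arr_cmp cmp_assoc idt_cmp src_cmp tgt_cmp)+

lemma inverse_idt: "A \<in> Ob M \<Longrightarrow> inverse_arr (\<iota> A) (\<iota> A)"
  unfolding inverse_arr_def by auto

lemma inverse_cancel_left:
  assumes "inverse_arr f f'" "arr x" "tgt x = src f"
  shows "f' \<cdot> (f \<cdot> x) = x"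
  using assms cmp_assoc[of x f f'] by (auto simp: inverse_arr_def)

lemma inverse_mono:
  assumes "inverse_arr f f'" "f \<cdot> x = f \<cdot> y" "arr x" "arr y" "tgt x = src f" "tgt y = src f"
  shows "x = y"
  using inverse_cancel_left[OF assms(1)] assms by metis

lemma inverse_cancel_right:
  assumes "inverse_arr f f'" "arr x" "src x = tgt f"
  shows "(x \<cdot> f) \<cdot> f' = x"
  using assms cmp_assoc[of f' f x] by (auto simp: inverse_arr_def)

lemma inverse_epi:
  assumes "inverse_arr f f'" "x \<cdot> f = y \<cdot> f" "arr x" "arr y" "src x = tgt f" "src y = tgt f"
  shows "x = y"
  using inverse_cancel_right[OF assms(1)] assms by metis

abbreviation assoc_inverse ("\<alpha>\<^sup>i") where "\<alpha>\<^sup>i A B D \<equiv> assoc_inv M A B D"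
abbreviation lunit_inverse ("\<lambda>\<^sup>i") where "\<lambda>\<^sup>i A \<equiv> lunit_inv M A"
abbreviation runit_inverse ("\<rho>\<^sup>i") where "\<rho>\<^sup>i A \<equiv> runit_inv M A"

section \<open>Typing and naturality of the constraint isomorphisms\<close>

context fixes A B D assumes Obs [simp]: "A \<in> Ob M" "B \<in> Ob M" "D \<in> Ob M" begin

lemma assoc_inverse: "inverse_arr (\<alpha> A B D) (\<alpha>\<^sup>i A B D)"
  unfolding assoc_inv_def by (rule inv_of_inverse assoc_iso Obs)+

lemma src_assoc [simp]: "src (\<alpha> A B D) = (A \<boxtimes> B) \<boxtimes> D"
  and tgt_assoc [simp]: "tgt (\<alpha> A B D) = A \<boxtimes> (B \<boxtimes> D)"
  by (rule inv_of_inverse assoc_iso Obs)+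

lemma arr_assoc [simp]: "arr (\<alpha> A B D)" 
  and arr_associ [simp]: "arr (\<alpha>\<^sup>i A B D)"
  and src_associ [simp]: "src (\<alpha>\<^sup>i A B D) = A \<boxtimes> (B \<boxtimes> D)"
  and tgt_associ [simp]: "tgt (\<alpha>\<^sup>i A B D) = (A \<boxtimes> B) \<boxtimes> D"
  and assoc_associ [simp]: "\<alpha> A B D \<cdot> \<alpha>\<^sup>i A B D = \<iota> (A \<boxtimes> B \<boxtimes> D)"
  and associ_assoc [simp]: "\<alpha>\<^sup>i A B D \<cdot> \<alpha> A B D = \<iota> ((A \<boxtimes> B) \<boxtimes> D)"
  using assoc_inverse unfolding inverse_arr_def by auto

lemma assoc_associ_ext [simp]: "\<lbrakk>arr x; tgt x = A \<boxtimes> B \<boxtimes> D\<rbrakk> \<Longrightarrow> \<alpha> A B D \<cdot> (\<alpha>\<^sup>i A B D \<cdot> x) = x"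
  and associ_assoc_ext [simp]: "\<lbrakk>arr x; tgt x = (A \<boxtimes> B) \<boxtimes> D\<rbrakk> \<Longrightarrow> \<alpha>\<^sup>i A B D \<cdot> (\<alpha> A B D \<cdot> x) = x"
  by (simp_all flip: cmp_assoc)

end

context fixes A assumes Obs [simp]: "A \<in> Ob M" begin

lemma lunit_inverse: "inverse_arr (\<lambda>\<^sub>l A) (\<lambda>\<^sup>i A)"
  unfolding lunit_inv_def by (rule inv_of_inverse lunit_iso Obs)+

lemma src_lunit [simp]: "src (\<lambda>\<^sub>l A) = \<one> \<boxtimes> A"
  and tgt_lunit [simp]: "tgt (\<lambda>\<^sub>l A) = A"
  by (rule inv_of_inverse lunit_iso Obs)+

lemma arr_lunit [simp]: "arr (\<lambda>\<^sub>l A)" 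
  and arr_luniti [simp]: "arr (\<lambda>\<^sup>i A)"
  and src_luniti [simp]: "src (\<lambda>\<^sup>i A) = A"
  and tgt_luniti [simp]: "tgt (\<lambda>\<^sup>i A) = \<one> \<boxtimes> A"
  and lunit_luniti [simp]: "\<lambda>\<^sub>l A \<cdot> \<lambda>\<^sup>i A = \<iota> A"
  and luniti_lunit [simp]: "\<lambda>\<^sup>i A \<cdot> \<lambda>\<^sub>l A = \<iota> (\<one> \<boxtimes> A)"
  using lunit_inverse unfolding inverse_arr_def by auto

lemma lunit_luniti_ext [simp]: "\<lbrakk>arr x; tgt x = A\<rbrakk> \<Longrightarrow> \<lambda>\<^sub>l A \<cdot> (\<lambda>\<^sup>i A \<cdot> x) = x"
  and luniti_lunit_ext [simp]: "\<lbrakk>arr x; tgt x = \<one> \<boxtimes> A\<rbrakk> \<Longrightarrow> \<lambda>\<^sup>i A \<cdot> (\<lambda>\<^sub>l A \<cdot> x) = x"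
  by (simp_all flip: cmp_assoc)

lemma runit_inverse: "inverse_arr (\<rho> A) (\<rho>\<^sup>i A)"
  unfolding runit_inv_def by (rule inv_of_inverse runit_iso Obs)+

lemma src_runit [simp]: "src (\<rho> A) = A \<boxtimes> \<one>"
  and tgt_runit [simp]: "tgt (\<rho> A) = A"
  by (rule inv_of_inverse runit_iso Obs)+

lemma arr_runit [simp]: "arr (\<rho> A)" 
  and arr_runiti [simp]: "arr (\<rho>\<^sup>i A)"
  and src_runiti [simp]: "src (\<rho>\<^sup>i A) = A"
  and tgt_runiti [simp]: "tgt (\<rho>\<^sup>i A) = A \<boxtimes> \<one>"
  and runit_runiti [simp]: "\<rho> A \<cdot> \<rho>\<^sup>i A = \<iota> A"
  and runiti_runit [simp]: "\<rho>\<^sup>i A \<cdot> \<rho> A = \<iota> (A \<boxtimes> \<one>)"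
  using runit_inverse unfolding inverse_arr_def by auto

lemma runit_runiti_ext [simp]: "\<lbrakk>arr x; tgt x = A\<rbrakk> \<Longrightarrow> \<rho> A \<cdot> (\<rho>\<^sup>i A \<cdot> x) = x"
  and runiti_runit_ext [simp]: "\<lbrakk>arr x; tgt x = A \<boxtimes> \<one>\<rbrakk> \<Longrightarrow> \<rho>\<^sup>i A \<cdot> (\<rho> A \<cdot> x) = x"
  by (simp_all flip: cmp_assoc)

end

context fixes A B assumes Obs [simp]: "A \<in> Ob M" "B \<in> Ob M" begin

lemma arr_braid [simp]: "arr (\<sigma> A B)"
  and src_braid [simp]: "src (\<sigma> A B) = A \<boxtimes> B"
  and tgt_braid [simp]: "tgt (\<sigma> A B) = B \<boxtimes> A"
  using braid_Hom[of A B] by (auto simp: Hom_iff)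

lemma braid_braid [simp]: "\<sigma> B A \<cdot> \<sigma> A B = \<iota> (A \<boxtimes> B)"
  using braid_symmetric by simp

lemma braid_braid_ext [simp]: "\<lbrakk>arr x; tgt x = A \<boxtimes> B\<rbrakk> \<Longrightarrow> \<sigma> B A \<cdot> (\<sigma> A B \<cdot> x) = x"
  using braid_Hom[of B A] by (simp add: Hom_iff flip: cmp_assoc)

end

lemma braid_inverse: "\<lbrakk>A \<in> Ob M; B \<in> Ob M\<rbrakk> \<Longrightarrow> inverse_arr (\<sigma> A B) (\<sigma> B A)"
  unfolding inverse_arr_def by simp

lemma assoc_nat:
  "\<lbrakk>arr f; arr g; arr h; tgt f = A; tgt g = B; tgt h = D\<rbrakk>
    \<Longrightarrow> \<alpha> A B D \<cdot> ((f \<otimes> g) \<otimes> h) = (f \<otimes> (g \<otimes> h)) \<cdot> \<alpha> (src f) (src g) (src h)"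
  using assoc_natural by (auto simp: Hom_iff)

lemma associ_nat:
  assumes [simp]: "arr f" "arr g" "arr h" and "tgt f = A" "tgt g = B" "tgt h = D"
  shows "\<alpha>\<^sup>i A B D \<cdot> (f \<otimes> (g \<otimes> h)) = ((f \<otimes> g) \<otimes> h) \<cdot> \<alpha>\<^sup>i (src f) (src g) (src h)"
proof -
  have "(f \<otimes> (g \<otimes> h)) = \<alpha> A B D \<cdot> ((f \<otimes> g) \<otimes> h) \<cdot> \<alpha>\<^sup>i (src f) (src g) (src h)"
    using assms by (simp add: assoc_nat cmp_assoc)
  then show ?thesis using assms(4-) by (auto simp: cmp_assoc)
qed

lemma lunit_nat: "\<lbrakk>arr f; tgt f = A\<rbrakk> \<Longrightarrow> \<lambda>\<^sub>l A \<cdot> (\<iota> \<one> \<otimes> f) = f \<cdot> \<lambda>\<^sub>l (src f)"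
  using lunit_natural by (auto simp: Hom_iff)

lemma runit_nat: "\<lbrakk>arr f; tgt f = A\<rbrakk> \<Longrightarrow> \<rho> A \<cdot> (f \<otimes> \<iota> \<one>) = f \<cdot> \<rho> (src f)"
  using runit_natural by (auto simp: Hom_iff)

lemma braid_nat:
  "\<lbrakk>arr f; arr g; tgt f = A; tgt g = B\<rbrakk> \<Longrightarrow> \<sigma> A B \<cdot> (f \<otimes> g) = (g \<otimes> f) \<cdot> \<sigma> (src f) (src g)"
  using braid_natural by (auto simp: Hom_iff)

lemma assoc_nat_ext:
  "\<lbrakk>arr f; arr g; arr h; tgt f = A; tgt g = B; tgt h = D; arr x; tgt x = (src f \<boxtimes> src g) \<boxtimes> src h\<rbrakk>
    \<Longrightarrow> \<alpha> A B D \<cdot> (((f \<otimes> g) \<otimes> h) \<cdot> x) = (f \<otimes> (g \<otimes> h)) \<cdot> (\<alpha> (src f) (src g) (src h) \<cdot> x)"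
  by (subst cmp_extend[OF assoc_nat]) (auto simp: cmp_assoc)

lemma associ_nat_ext:
  "\<lbrakk>arr f; arr g; arr h; tgt f = A; tgt g = B; tgt h = D; arr x; tgt x = src f \<boxtimes> src g \<boxtimes> src h\<rbrakk>
    \<Longrightarrow> \<alpha>\<^sup>i A B D \<cdot> ((f \<otimes> (g \<otimes> h)) \<cdot> x) = ((f \<otimes> g) \<otimes> h) \<cdot> (\<alpha>\<^sup>i (src f) (src g) (src h) \<cdot> x)"
  by (subst cmp_extend[OF associ_nat]) (auto simp: cmp_assoc)

lemma lunit_nat_ext:
  "\<lbrakk>arr f; tgt f = A; arr x; tgt x = \<one> \<boxtimes> src f\<rbrakk>
    \<Longrightarrow> \<lambda>\<^sub>l A \<cdot> ((\<iota> \<one> \<otimes> f) \<cdot> x) = f \<cdot> (\<lambda>\<^sub>l (src f) \<cdot> x)"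
  by (subst cmp_extend[OF lunit_nat]) (auto simp: cmp_assoc)

lemma runit_nat_ext:
  "\<lbrakk>arr f; tgt f = A; arr x; tgt x = src f \<boxtimes> \<one>\<rbrakk>
    \<Longrightarrow> \<rho> A \<cdot> ((f \<otimes> \<iota> \<one>) \<cdot> x) = f \<cdot> (\<rho> (src f) \<cdot> x)"
  by (subst cmp_extend[OF runit_nat]) (auto simp: cmp_assoc)

lemma braid_nat_ext:
  "\<lbrakk>arr f; arr g; tgt f = A; tgt g = B; arr x; tgt x = src f \<boxtimes> src g\<rbrakk>
    \<Longrightarrow> \<sigma> A B \<cdot> ((f \<otimes> g) \<cdot> x) = (g \<otimes> f) \<cdot> (\<sigma> (src f) (src g) \<cdot> x)"
  by (subst cmp_extend[OF braid_nat]) (auto simp: cmp_assoc)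


section \<open>Coherence\<close>

text \<open>By naturality of the invertible left unitor, tensoring with \<open>\<one>\<close> is
  isomorphic to the identity functor. Laws that the pentagon yields only under an extra factor
  \<open>\<one>\<close> can be freed of it in this way.\<close>

lemma unit_tensor_faithful:
  assumes "\<iota> \<one> \<otimes> f = \<iota> \<one> \<otimes> g" "arr f" "arr g" "src f = src g" "tgt f = tgt g"
  shows "f = g"
proof (rule inverse_epi[OF lunit_inverse])
  show "f \<cdot> \<lambda>\<^sub>l (src f) = g \<cdot> \<lambda>\<^sub>l (src f)"
    using lunit_nat[of f "tgt f"] lunit_nat[of g "tgt g"] assms by metis
qed (use assms in auto)

lemma tensor_unit_faithful:
  assumes "f \<otimes> \<iota> \<one> = g \<otimes> \<iota> \<one>" "arr f" "arr g" "src f = src g" "tgt f = tgt g"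
  shows "f = g"
proof (rule inverse_epi[OF runit_inverse])
  show "f \<cdot> \<rho> (src f) = g \<cdot> \<rho> (src f)"
    using runit_nat[of f "tgt f"] runit_nat[of g "tgt g"] assms by metis
qed (use assms in auto)

lemmas tensor_simps = cmp_assoc interchange interchange_ext

lemma triangle_inv:
  assumes "A \<in> Ob M" "B \<in> Ob M"
  shows "(\<rho> A \<otimes> \<iota> B) \<cdot> \<alpha>\<^sup>i A \<one> B = \<iota> A \<otimes> \<lambda>\<^sub>l B"
  using assms by (simp add: cmp_assoc flip: triangle)

text \<open>Kelly's derivation of a second unit triangle from the pentagon and the given triangle;
  the equation is obtained after tensoring with \<open>\<one>\<close> on the left.\<close>

lemma lunit_assoc:
  assumes [simp]: "A \<in> Ob M" "B \<in> Ob M"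
  shows "\<lambda>\<^sub>l (A \<boxtimes> B) \<cdot> \<alpha> \<one> A B = \<lambda>\<^sub>l A \<otimes> \<iota> B"
proof (rule unit_tensor_faithful)
  \<comment> \<open>The first two arrows on the long side of the pentagon for \<open>\<one>\<close>,
    \<open>\<one>\<close>, A, B. Precomposition with them makes the pentagon applicable, and being
    invertible they cancel at the end.\<close>
  let ?e = "\<alpha> \<one> (\<one> \<boxtimes> A) B \<cdot> (\<alpha> \<one> \<one> A \<otimes> \<iota> B)"
  have e: "inverse_arr ?e ((\<alpha>\<^sup>i \<one> \<one> A \<otimes> \<iota> B) \<cdot> \<alpha>\<^sup>i \<one> (\<one> \<boxtimes> A) B)"
    by (intro inverse_cmp inverse_tensor assoc_inverse inverse_idt) auto
  have "(\<iota> \<one> \<otimes> (\<lambda>\<^sub>l (A \<boxtimes> B) \<cdot> \<alpha> \<one> A B)) \<cdot> ?e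
      = (\<iota> \<one> \<otimes> \<lambda>\<^sub>l (A \<boxtimes> B)) \<cdot> ((\<iota> \<one> \<otimes> \<alpha> \<one> A B) \<cdot> ?e)"
    by (simp add: tensor_simps)
  also have "\<dots> = (\<iota> \<one> \<otimes> \<lambda>\<^sub>l (A \<boxtimes> B)) \<cdot> (\<alpha> \<one> \<one> (A \<boxtimes> B) \<cdot> \<alpha> (\<one> \<boxtimes> \<one>) A B)"
    by (simp add: pentagon cmp_assoc)
  also have "\<dots> = (\<rho> \<one> \<otimes> \<iota> (A \<boxtimes> B)) \<cdot> \<alpha> (\<one> \<boxtimes> \<one>) A B"
    by (simp add: triangle flip: cmp_assoc)
  also have "\<dots> = \<alpha> \<one> A B \<cdot> ((\<rho> \<one> \<otimes> \<iota> A) \<otimes> \<iota> B)"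
    by (simp add: assoc_nat)
  also have "\<dots> = \<alpha> \<one> A B \<cdot> (((\<iota> \<one> \<otimes> \<lambda>\<^sub>l A) \<otimes> \<iota> B) \<cdot> (\<alpha> \<one> \<one> A \<otimes> \<iota> B))"
    by (simp add: triangle interchange)
  also have "\<dots> = (\<iota> \<one> \<otimes> (\<lambda>\<^sub>l A \<otimes> \<iota> B)) \<cdot> ?e"
    by (simp add: assoc_nat_ext)
  finally show "\<iota> \<one> \<otimes> (\<lambda>\<^sub>l (A \<boxtimes> B) \<cdot> \<alpha> \<one> A B) = \<iota> \<one> \<otimes> (\<lambda>\<^sub>l A \<otimes> \<iota> B)"
    by (rule inverse_epi[OF e]) auto
qed auto

text \<open>Naturality of the left unitor at \<open>\<lambda>\<^sub>l \<one>\<close> itself, with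
  that isomorphism cancelled, identifies
  \<open>\<lambda>\<^sub>l (\<one> \<boxtimes> \<one>)\<close> with
  \<open>\<iota> \<one> \<otimes> \<lambda>\<^sub>l \<one>\<close>. The two unit triangles then have
  the same left-hand side.\<close>

lemma lunit_one: "\<lambda>\<^sub>l \<one> = \<rho> \<one>"
proof (rule tensor_unit_faithful)
  have "\<lambda>\<^sub>l (\<one> \<boxtimes> \<one>) = \<iota> \<one> \<otimes> \<lambda>\<^sub>l \<one>"
    by (rule inverse_mono[OF lunit_inverse[of \<one>]]) (simp_all add: lunit_nat)
  then show "\<lambda>\<^sub>l \<one> \<otimes> \<iota> \<one> = \<rho> \<one> \<otimes> \<iota> \<one>"
    using lunit_assoc[of \<one> \<one>] triangle[of \<one> \<one>] by simp
qed auto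

text \<open>Comes from the hexagon for A and two unit objects: A is moved past
  \<open>\<one> \<boxtimes> \<one>\<close> in one step or in two, and one remaining braiding
  cancels.\<close>

lemma lunit_braid:
  assumes [simp]: "A \<in> Ob M"
  shows "\<lambda>\<^sub>l A \<cdot> \<sigma> A \<one> = \<rho> A"
proof (rule tensor_unit_faithful)
  have "\<sigma> A \<one> \<cdot> (\<rho> A \<otimes> \<iota> \<one>) = \<sigma> A \<one> \<cdot> ((\<iota> A \<otimes> \<lambda>\<^sub>l \<one>) \<cdot> \<alpha> A \<one> \<one>)"
    by (simp add: triangle)
  also have "\<dots> = (\<lambda>\<^sub>l \<one> \<otimes> \<iota> A) \<cdot> (\<sigma> A (\<one> \<boxtimes> \<one>) \<cdot> \<alpha> A \<one> \<one>)"
    by (simp add: braid_nat_ext)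
  also have "\<dots> = \<lambda>\<^sub>l (\<one> \<boxtimes> A) \<cdot> (\<alpha> \<one> \<one> A \<cdot> (\<sigma> A (\<one> \<boxtimes> \<one>) \<cdot> \<alpha> A \<one> \<one>))"
    by (simp add: cmp_extend[OF lunit_assoc])
  also have "\<dots> = \<lambda>\<^sub>l (\<one> \<boxtimes> A) \<cdot> ((\<iota> \<one> \<otimes> \<sigma> A \<one>) \<cdot> (\<alpha> \<one> A \<one> \<cdot> (\<sigma> A \<one> \<otimes> \<iota> \<one>)))"
    using hexagon[of A \<one> \<one>] by (simp add: cmp_assoc)
  also have "\<dots> = \<sigma> A \<one> \<cdot> (\<lambda>\<^sub>l (A \<boxtimes> \<one>) \<cdot> (\<alpha> \<one> A \<one> \<cdot> (\<sigma> A \<one> \<otimes> \<iota> \<one>)))"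
    by (simp add: lunit_nat_ext)
  also have "\<dots> = \<sigma> A \<one> \<cdot> ((\<lambda>\<^sub>l A \<cdot> \<sigma> A \<one>) \<otimes> \<iota> \<one>)"
    by (simp add: cmp_extend[OF lunit_assoc] interchange)
  finally have "\<sigma> A \<one> \<cdot> ((\<lambda>\<^sub>l A \<cdot> \<sigma> A \<one>) \<otimes> \<iota> \<one>) = \<sigma> A \<one> \<cdot> (\<rho> A \<otimes> \<iota> \<one>)" by simp
  then show "(\<lambda>\<^sub>l A \<cdot> \<sigma> A \<one>) \<otimes> \<iota> \<one> = \<rho> A \<otimes> \<iota> \<one>"
    by (rule inverse_mono[OF braid_inverse[of A \<one>], rotated 2]) auto
qed auto

lemma runit_braid:
  assumes [simp]: "A \<in> Ob M"
  shows "\<rho> A \<cdot> \<sigma> \<one> A = \<lambda>\<^sub>l A"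
  by (simp add: cmp_assoc flip: lunit_braid)

lemma braid_one: "\<sigma> \<one> \<one> = \<iota> (\<one> \<boxtimes> \<one>)"
  by (rule inverse_mono[OF lunit_inverse[of \<one>]]) (simp_all add: lunit_braid, simp add: lunit_one)

section \<open>Exchange of adjacent factors\<close>

text \<open>Exchanges the first two factors of a right-nested triple. Rearrangements of right-nested
  products are composed of such exchanges and braidings of the last two factors, which keeps
  symmetries apart from regrouping.\<close>

definition swp :: "'o \<Rightarrow> 'o \<Rightarrow> 'o \<Rightarrow> 'm" where
  "swp A B D = \<alpha> B A D \<cdot> ((\<sigma> A B \<otimes> \<iota> D) \<cdot> \<alpha>\<^sup>i A B D)"

context fixes A B D assumes Obs [simp]: "A \<in> Ob M" "B \<in> Ob M" "D \<in> Ob M" begin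

lemma arr_swp [simp]: "arr (swp A B D)"
  and src_swp [simp]: "src (swp A B D) = A \<boxtimes> B \<boxtimes> D"
  and tgt_swp [simp]: "tgt (swp A B D) = B \<boxtimes> A \<boxtimes> D"
  unfolding swp_def by auto

lemma swp_swp [simp]: "swp B A D \<cdot> swp A B D = \<iota> (A \<boxtimes> B \<boxtimes> D)"
  unfolding swp_def by (simp add: tensor_simps)

lemma swp_swp_ext [simp]: "\<lbrakk>arr x; tgt x = A \<boxtimes> B \<boxtimes> D\<rbrakk> \<Longrightarrow> swp B A D \<cdot> (swp A B D \<cdot> x) = x"
  by (subst cmp_extend[OF swp_swp]) (simp_all add: swp_def)

lemma swp_assoc: "swp A B D \<cdot> \<alpha> A B D = \<alpha> B A D \<cdot> (\<sigma> A B \<otimes> \<iota> D)"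
  unfolding swp_def by (simp add: tensor_simps)

end

lemma swp_nat:
  assumes "arr f" "arr g" "arr h" "tgt f = A" "tgt g = B" "tgt h = D"
  shows "swp A B D \<cdot> (f \<otimes> (g \<otimes> h)) = (g \<otimes> (f \<otimes> h)) \<cdot> swp (src f) (src g) (src h)"
proof -
  have "swp A B D \<cdot> (f \<otimes> (g \<otimes> h))
      = \<alpha> B A D \<cdot> ((\<sigma> A B \<cdot> (f \<otimes> g)) \<otimes> (\<iota> D \<cdot> h)) \<cdot> \<alpha>\<^sup>i (src f) (src g) (src h)"
    using assms by (auto simp: swp_def tensor_simps associ_nat)
  also have "\<dots> = \<alpha> B A D \<cdot> (((g \<otimes> f) \<otimes> h) \<cdot> (\<sigma> (src f) (src g) \<otimes> \<iota> (src h))) \<cdot> \<alpha>\<^sup>i (src f) (src g) (src h)"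
    using assms by (simp add: interchange braid_nat)
  also have "\<dots> = (g \<otimes> (f \<otimes> h)) \<cdot> swp (src f) (src g) (src h)"
    using assms by (auto simp: swp_def cmp_assoc assoc_nat_ext)
  finally show ?thesis .
qed

lemma swp_nat_ext:
  "\<lbrakk>arr f; arr g; arr h; tgt f = A; tgt g = B; tgt h = D; arr x; tgt x = src f \<boxtimes> src g \<boxtimes> src h\<rbrakk>
    \<Longrightarrow> swp A B D \<cdot> ((f \<otimes> (g \<otimes> h)) \<cdot> x) = (g \<otimes> (f \<otimes> h)) \<cdot> (swp (src f) (src g) (src h) \<cdot> x)"
  by (subst cmp_extend[OF swp_nat]) (auto simp: cmp_assoc)

lemma lunit_swp:
  assumes [simp]: "A \<in> Ob M" "B \<in> Ob M"
  shows "\<lambda>\<^sub>l (A \<boxtimes> B) \<cdot> swp A \<one> B = \<iota> A \<otimes> \<lambda>\<^sub>l B"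
  unfolding swp_def by (simp add: cmp_extend[OF lunit_assoc] interchange_ext lunit_braid triangle_inv)


lemma pentagon_r:
  "\<lbrakk>A \<in> Ob M; B \<in> Ob M; D \<in> Ob M; E \<in> Ob M\<rbrakk>
    \<Longrightarrow> (\<iota> A \<otimes> \<alpha> B D E) \<cdot> (\<alpha> A (B \<boxtimes> D) E \<cdot> (\<alpha> A B D \<otimes> \<iota> E))
      = \<alpha> A B (D \<boxtimes> E) \<cdot> \<alpha> (A \<boxtimes> B) D E"
  by (simp add: pentagon cmp_assoc)

lemma pentagon_ext:
  assumes "A \<in> Ob M" "B \<in> Ob M" "D \<in> Ob M" "E \<in> Ob M" "arr x" "tgt x = ((A \<boxtimes> B) \<boxtimes> D) \<boxtimes> E"
  shows "(\<iota> A \<otimes> \<alpha> B D E) \<cdot> (\<alpha> A (B \<boxtimes> D) E \<cdot> ((\<alpha> A B D \<otimes> \<iota> E) \<cdot> x))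
      = \<alpha> A B (D \<boxtimes> E) \<cdot> (\<alpha> (A \<boxtimes> B) D E \<cdot> x)"
  using cmp_extend[OF pentagon_r[of A B D E], of x] assms by (simp add: cmp_assoc)

text \<open>The hexagon in the presence of a further factor E: to carry A past
  \<open>B \<boxtimes> D\<close>, carry it past B and then past D. Pentagons move E out of the
  way.\<close>

lemma assoc_swp:
  assumes [simp]: "A \<in> Ob M" "B \<in> Ob M" "D \<in> Ob M" "E \<in> Ob M"
  shows "\<alpha> B D (A \<boxtimes> E) \<cdot> swp A (B \<boxtimes> D) E
    = (\<iota> B \<otimes> swp A D E) \<cdot> (swp A B (D \<boxtimes> E) \<cdot> (\<iota> A \<otimes> \<alpha> B D E))"
proof (rule inverse_epi)
  let ?e = "\<alpha> A (B \<boxtimes> D) E \<cdot> (\<alpha> A B D \<otimes> \<iota> E)"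
  show "inverse_arr ?e ((\<alpha>\<^sup>i A B D \<otimes> \<iota> E) \<cdot> \<alpha>\<^sup>i A (B \<boxtimes> D) E)"
    by (intro inverse_cmp inverse_tensor assoc_inverse inverse_idt) auto
  have "(\<alpha> B D (A \<boxtimes> E) \<cdot> swp A (B \<boxtimes> D) E) \<cdot> ?e
      = \<alpha> B D (A \<boxtimes> E) \<cdot> (\<alpha> (B \<boxtimes> D) A E \<cdot> ((\<sigma> A (B \<boxtimes> D) \<cdot> \<alpha> A B D) \<otimes> \<iota> E))"
    by (simp add: tensor_simps swp_def)
  also have "\<dots> = (\<iota> B \<otimes> \<alpha> D A E) \<cdot> (\<alpha> B (D \<boxtimes> A) E \<cdot>
      ((\<alpha> B D A \<cdot> (\<sigma> A (B \<boxtimes> D) \<cdot> \<alpha> A B D)) \<otimes> \<iota> E))"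
    by (simp add: pentagon_ext[symmetric] interchange)
  also have "\<dots> = (\<iota> B \<otimes> \<alpha> D A E) \<cdot> (\<alpha> B (D \<boxtimes> A) E \<cdot> (((\<iota> B \<otimes> \<sigma> A D) \<otimes> \<iota> E) \<cdot>
      ((\<alpha> B A D \<otimes> \<iota> E) \<cdot> ((\<sigma> A B \<otimes> \<iota> D) \<otimes> \<iota> E))))"
    using hexagon[of A B D] by (simp add: cmp_assoc interchange)
  also have "\<dots> = (\<iota> B \<otimes> (\<alpha> D A E \<cdot> (\<sigma> A D \<otimes> \<iota> E))) \<cdot>
      (\<alpha> B (A \<boxtimes> D) E \<cdot> ((\<alpha> B A D \<otimes> \<iota> E) \<cdot> ((\<sigma> A B \<otimes> \<iota> D) \<otimes> \<iota> E)))"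
    by (subst assoc_nat_ext) (simp_all add: interchange_ext)
  also have "\<dots> = (\<iota> B \<otimes> swp A D E) \<cdot> ((\<iota> B \<otimes> \<alpha> A D E) \<cdot>
      (\<alpha> B (A \<boxtimes> D) E \<cdot> ((\<alpha> B A D \<otimes> \<iota> E) \<cdot> ((\<sigma> A B \<otimes> \<iota> D) \<otimes> \<iota> E))))"
    by (simp add: swp_assoc interchange_ext)
  also have "\<dots> = (\<iota> B \<otimes> swp A D E) \<cdot> (\<alpha> B A (D \<boxtimes> E) \<cdot>
      ((\<sigma> A B \<otimes> \<iota> (D \<boxtimes> E)) \<cdot> \<alpha> (A \<boxtimes> B) D E))"
    by (simp add: pentagon_ext assoc_nat)
  also have "\<dots> = ((\<iota> B \<otimes> swp A D E) \<cdot> (swp A B (D \<boxtimes> E) \<cdot> (\<iota> A \<otimes> \<alpha> B D E))) \<cdot> ?e"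
    by (simp add: cmp_assoc pentagon_r swp_def)
  finally show "(\<alpha> B D (A \<boxtimes> E) \<cdot> swp A (B \<boxtimes> D) E) \<cdot> ?e
    = ((\<iota> B \<otimes> swp A D E) \<cdot> (swp A B (D \<boxtimes> E) \<cdot> (\<iota> A \<otimes> \<alpha> B D E))) \<cdot> ?e" .
qed auto

lemma assoc_swp_ext:
  assumes "A \<in> Ob M" "B \<in> Ob M" "D \<in> Ob M" "E \<in> Ob M" "arr x" "tgt x = A \<boxtimes> (B \<boxtimes> D) \<boxtimes> E"
  shows "\<alpha> B D (A \<boxtimes> E) \<cdot> (swp A (B \<boxtimes> D) E \<cdot> x)
    = (\<iota> B \<otimes> swp A D E) \<cdot> (swp A B (D \<boxtimes> E) \<cdot> ((\<iota> A \<otimes> \<alpha> B D E) \<cdot> x))"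
  using cmp_extend[OF assoc_swp[of A B D E], of x] assms by (simp add: cmp_assoc)

text \<open>The inverse reading of \<open>assoc_swp\<close>, since \<open>swp B A D\<close> inverts
  \<open>swp A B D\<close>.\<close>

lemma swp_tensor_left:
  assumes [simp]: "A \<in> Ob M" "B \<in> Ob M" "D \<in> Ob M" "E \<in> Ob M"
  shows "(\<iota> D \<otimes> \<alpha> A B E) \<cdot> swp (A \<boxtimes> B) D E
    = swp A D (B \<boxtimes> E) \<cdot> ((\<iota> A \<otimes> swp B D E) \<cdot> \<alpha> A B (D \<boxtimes> E))"
proof -
  have "swp A D (B \<boxtimes> E) \<cdot> ((\<iota> A \<otimes> swp B D E) \<cdot> \<alpha> A B (D \<boxtimes> E))
    = swp A D (B \<boxtimes> E) \<cdot> ((\<iota> A \<otimes> swp B D E) \<cdot>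
       ((\<alpha> A B (D \<boxtimes> E) \<cdot> swp D (A \<boxtimes> B) E) \<cdot> swp (A \<boxtimes> B) D E))"
    by (simp add: cmp_assoc)
  also have "\<dots> = (\<iota> D \<otimes> \<alpha> A B E) \<cdot> swp (A \<boxtimes> B) D E"
    by (simp add: assoc_swp tensor_simps)
  finally show ?thesis by simp
qed

text \<open>An exchange is indifferent to the grouping of the factors behind the exchanged pair;
  this is the pentagon together with naturality of the associator.\<close>

lemma swp_tensor_right:
  assumes [simp]: "A \<in> Ob M" "B \<in> Ob M" "D \<in> Ob M" "E \<in> Ob M"
  shows "(\<iota> B \<otimes> \<alpha> A D E) \<cdot> (\<alpha> B (A \<boxtimes> D) E \<cdot> (swp A B D \<otimes> \<iota> E))
    = swp A B (D \<boxtimes> E) \<cdot> ((\<iota> A \<otimes> \<alpha> B D E) \<cdot> \<alpha> A (B \<boxtimes> D) E)"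
proof (rule inverse_epi)
  let ?e = "\<alpha> A B D \<otimes> \<iota> E"
  show "inverse_arr ?e (\<alpha>\<^sup>i A B D \<otimes> \<iota> E)"
    by (intro inverse_cmp inverse_tensor assoc_inverse inverse_idt) auto
  have "((\<iota> B \<otimes> \<alpha> A D E) \<cdot> (\<alpha> B (A \<boxtimes> D) E \<cdot> (swp A B D \<otimes> \<iota> E))) \<cdot> ?e
      = (\<iota> B \<otimes> \<alpha> A D E) \<cdot> (\<alpha> B (A \<boxtimes> D) E \<cdot> ((\<alpha> B A D \<otimes> \<iota> E) \<cdot> ((\<sigma> A B \<otimes> \<iota> D) \<otimes> \<iota> E)))"
    by (simp add: tensor_simps swp_def)
  also have "\<dots> = \<alpha> B A (D \<boxtimes> E) \<cdot> ((\<sigma> A B \<otimes> \<iota> (D \<boxtimes> E)) \<cdot> \<alpha> (A \<boxtimes> B) D E)"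
    by (simp add: pentagon_ext assoc_nat)
  also have "\<dots> = (swp A B (D \<boxtimes> E) \<cdot> ((\<iota> A \<otimes> \<alpha> B D E) \<cdot> \<alpha> A (B \<boxtimes> D) E)) \<cdot> ?e"
    by (simp add: cmp_assoc pentagon_r swp_def)
  finally show "((\<iota> B \<otimes> \<alpha> A D E) \<cdot> (\<alpha> B (A \<boxtimes> D) E \<cdot> (swp A B D \<otimes> \<iota> E))) \<cdot> ?e
    = (swp A B (D \<boxtimes> E) \<cdot> ((\<iota> A \<otimes> \<alpha> B D E) \<cdot> \<alpha> A (B \<boxtimes> D) E)) \<cdot> ?e" .
qed auto

section \<open>The middle interchange\<close>

abbreviation mid :: "'o \<Rightarrow> 'o \<Rightarrow> 'o \<Rightarrow> 'o \<Rightarrow> 'm" where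
  "mid A B D E \<equiv> mid_swap M A B D E"

context fixes A B D E assumes Obs [simp]: "A \<in> Ob M" "B \<in> Ob M" "D \<in> Ob M" "E \<in> Ob M" begin

lemma mid_def: "mid A B D E = \<alpha>\<^sup>i A D (B \<boxtimes> E) \<cdot> ((\<iota> A \<otimes> swp B D E) \<cdot> \<alpha> A B (D \<boxtimes> E))"
  unfolding mid_swap_def swp_def by (simp add: cmp_assoc)

lemma arr_mid [simp]: "arr (mid A B D E)"
  and src_mid [simp]: "src (mid A B D E) = (A \<boxtimes> B) \<boxtimes> (D \<boxtimes> E)"
  and tgt_mid [simp]: "tgt (mid A B D E) = (A \<boxtimes> D) \<boxtimes> (B \<boxtimes> E)"
  unfolding mid_def by auto

end

lemma mid_mid [simp]:
  "\<lbrakk>A \<in> Ob M; B \<in> Ob M; D \<in> Ob M; E \<in> Ob M\<rbrakk>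
    \<Longrightarrow> mid A D B E \<cdot> mid A B D E = \<iota> ((A \<boxtimes> B) \<boxtimes> (D \<boxtimes> E))"
  by (simp add: mid_def tensor_simps)

lemma mid_mid_ext [simp]:
  "\<lbrakk>A \<in> Ob M; B \<in> Ob M; D \<in> Ob M; E \<in> Ob M; arr x; tgt x = (A \<boxtimes> B) \<boxtimes> (D \<boxtimes> E)\<rbrakk>
    \<Longrightarrow> mid A D B E \<cdot> (mid A B D E \<cdot> x) = x"
  by (subst cmp_extend[OF mid_mid]) simp_all

lemma mid_inverse:
  "\<lbrakk>A \<in> Ob M; B \<in> Ob M; D \<in> Ob M; E \<in> Ob M\<rbrakk> \<Longrightarrow> inverse_arr (mid A B D E) (mid A D B E)"
  unfolding inverse_arr_def by simp

lemma mid_nat: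
  assumes "arr f" "arr g" "arr h" "arr k" "tgt f = A" "tgt g = B" "tgt h = D" "tgt k = E"
  shows "mid A B D E \<cdot> ((f \<otimes> g) \<otimes> (h \<otimes> k)) = ((f \<otimes> h) \<otimes> (g \<otimes> k)) \<cdot> mid (src f) (src g) (src h) (src k)"
proof -
  have "mid A B D E \<cdot> ((f \<otimes> g) \<otimes> (h \<otimes> k))
    = \<alpha>\<^sup>i A D (B \<boxtimes> E) \<cdot> ((f \<otimes> (swp B D E \<cdot> (g \<otimes> (h \<otimes> k)))) \<cdot> \<alpha> (src f) (src g) (src h \<boxtimes> src k))"
    using assms by (auto simp: mid_def tensor_simps assoc_nat)
  also have "\<dots> = \<alpha>\<^sup>i A D (B \<boxtimes> E) \<cdot> ((f \<otimes> (h \<otimes> (g \<otimes> k))) \<cdot>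
      ((\<iota> (src f) \<otimes> swp (src g) (src h) (src k)) \<cdot> \<alpha> (src f) (src g) (src h \<boxtimes> src k)))"
    using assms by (auto simp: swp_nat tensor_simps)
  also have "\<dots> = ((f \<otimes> h) \<otimes> (g \<otimes> k)) \<cdot> mid (src f) (src g) (src h) (src k)"
    using assms by (auto simp: mid_def associ_nat_ext)
  finally show ?thesis .
qed

lemma mid_nat_ext:
  "\<lbrakk>arr f; arr g; arr h; arr k; tgt f = A; tgt g = B; tgt h = D; tgt k = E; arr x;
     tgt x = (src f \<boxtimes> src g) \<boxtimes> (src h \<boxtimes> src k)\<rbrakk>
   \<Longrightarrow> mid A B D E \<cdot> (((f \<otimes> g) \<otimes> (h \<otimes> k)) \<cdot> x)
     = ((f \<otimes> h) \<otimes> (g \<otimes> k)) \<cdot> (mid (src f) (src g) (src h) (src k) \<cdot> x)"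
  by (subst cmp_extend[OF mid_nat]) (auto simp: cmp_assoc)

text \<open>Unit compatibility of \<open>mid\<close>, as the structure that makes the tensor product
  a monoidal functor. It becomes the counit law for tensor products of comonoids.\<close>

lemma lunit_mid:
  assumes [simp]: "A \<in> Ob M" "B \<in> Ob M"
  shows "\<lambda>\<^sub>l (A \<boxtimes> B) \<cdot> ((\<lambda>\<^sub>l \<one> \<otimes> \<iota> (A \<boxtimes> B)) \<cdot> mid \<one> A \<one> B) = \<lambda>\<^sub>l A \<otimes> \<lambda>\<^sub>l B"
proof -
  have "(\<lambda>\<^sub>l \<one> \<otimes> \<iota> (A \<boxtimes> B)) \<cdot> mid \<one> A \<one> B
      = (\<iota> \<one> \<otimes> (\<lambda>\<^sub>l (A \<boxtimes> B) \<cdot> swp A \<one> B)) \<cdot> \<alpha> \<one> A (\<one> \<boxtimes> B)"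
    by (simp add: mid_def lunit_one cmp_extend[OF triangle_inv] interchange_ext)
  also have "\<dots> = \<alpha> \<one> A B \<cdot> (\<iota> (\<one> \<boxtimes> A) \<otimes> \<lambda>\<^sub>l B)"
    using assoc_nat[of "\<iota> \<one>" "\<iota> A" "\<lambda>\<^sub>l B" \<one> A B] by (simp add: lunit_swp)
  finally show ?thesis by (simp add: cmp_extend[OF lunit_assoc] interchange)
qed

lemma runit_lunit_mid:
  assumes [simp]: "A \<in> Ob M" "B \<in> Ob M"
  shows "mid A \<one> \<one> B = \<iota> ((A \<boxtimes> \<one>) \<boxtimes> (\<one> \<boxtimes> B))"
  by (simp add: mid_def swp_def braid_one)

lemma braid_tensor_left:
  assumes [simp]: "A \<in> Ob M" "B \<in> Ob M" "D \<in> Ob M"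
  shows "\<sigma> (A \<boxtimes> B) D = swp A D B \<cdot> ((\<iota> A \<otimes> \<sigma> B D) \<cdot> \<alpha> A B D)"
proof (rule inverse_epi[OF braid_inverse])
  have *: "\<alpha> A B D \<cdot> \<sigma> D (A \<boxtimes> B) = (\<iota> A \<otimes> \<sigma> D B) \<cdot> swp D A B"
    by (rule inverse_epi[OF assoc_inverse[of D A B]])
      (simp_all add: cmp_assoc swp_assoc, use hexagon[of D A B] in \<open>simp add: cmp_assoc\<close>)
  show "\<sigma> (A \<boxtimes> B) D \<cdot> \<sigma> D (A \<boxtimes> B) = (swp A D B \<cdot> ((\<iota> A \<otimes> \<sigma> B D) \<cdot> \<alpha> A B D)) \<cdot> \<sigma> D (A \<boxtimes> B)"
    by (simp add: cmp_assoc * interchange_ext)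
qed auto

lemma braid_tensor_right:
  assumes [simp]: "A \<in> Ob M" "B \<in> Ob M" "D \<in> Ob M"
  shows "\<sigma> D (A \<boxtimes> B) = \<alpha>\<^sup>i A B D \<cdot> ((\<iota> A \<otimes> \<sigma> D B) \<cdot> swp D A B)"
proof (rule inverse_epi[OF assoc_inverse[of D A B]])
  have "\<alpha>\<^sup>i A B D \<cdot> (\<alpha> A B D \<cdot> (\<sigma> D (A \<boxtimes> B) \<cdot> \<alpha> D A B))
    = \<alpha>\<^sup>i A B D \<cdot> ((\<iota> A \<otimes> \<sigma> D B) \<cdot> (\<alpha> A D B \<cdot> (\<sigma> D A \<otimes> \<iota> B)))"
    using hexagon[of D A B] by (simp add: cmp_assoc)
  then show "\<sigma> D (A \<boxtimes> B) \<cdot> \<alpha> D A B = (\<alpha>\<^sup>i A B D \<cdot> ((\<iota> A \<otimes> \<sigma> D B) \<cdot> swp D A B)) \<cdot> \<alpha> D A B"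
    by (simp add: cmp_assoc swp_assoc)
qed auto

text \<open>Splitting the block braiding into exchanges of single factors produces an exchange of B
  and A' that cancels the one inside \<open>mid\<close>. Cocommutativity of tensor products of
  comonoids rests on this identity.\<close>

lemma braid_mid:
  assumes [simp]: "A \<in> Ob M" "A' \<in> Ob M" "B \<in> Ob M" "B' \<in> Ob M"
  shows "\<sigma> (A \<boxtimes> B) (A' \<boxtimes> B') \<cdot> mid A A' B B' = mid A' A B' B \<cdot> (\<sigma> A A' \<otimes> \<sigma> B B')"
proof -
  have "\<sigma> (A \<boxtimes> B) (A' \<boxtimes> B') \<cdot> mid A A' B B'
    = swp A (A' \<boxtimes> B') B \<cdot> ((\<iota> A \<otimes> \<alpha>\<^sup>i A' B' B) \<cdot> ((\<iota> A \<otimes> (\<iota> A' \<otimes> \<sigma> B B')) \<cdot> \<alpha> A A' (B \<boxtimes> B')))"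
    by (simp add: braid_tensor_left[of A B "A' \<boxtimes> B'"] braid_tensor_right[of A' B' B] mid_def tensor_simps)
  also have "\<dots> = \<alpha>\<^sup>i A' B' (A \<boxtimes> B) \<cdot> (\<alpha> A' B' (A \<boxtimes> B) \<cdot> (swp A (A' \<boxtimes> B') B \<cdot>
     ((\<iota> A \<otimes> \<alpha>\<^sup>i A' B' B) \<cdot> ((\<iota> A \<otimes> (\<iota> A' \<otimes> \<sigma> B B')) \<cdot> \<alpha> A A' (B \<boxtimes> B')))))"
    by simp
  also have "\<dots> = \<alpha>\<^sup>i A' B' (A \<boxtimes> B) \<cdot> ((\<iota> A' \<otimes> swp A B' B) \<cdot> (swp A A' (B' \<boxtimes> B) \<cdot>
     ((\<iota> A \<otimes> (\<iota> A' \<otimes> \<sigma> B B')) \<cdot> \<alpha> A A' (B \<boxtimes> B'))))"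
    by (simp add: assoc_swp_ext interchange_ext)
  also have "\<dots> = \<alpha>\<^sup>i A' B' (A \<boxtimes> B) \<cdot> ((\<iota> A' \<otimes> swp A B' B) \<cdot>
     ((\<iota> A' \<otimes> (\<iota> A \<otimes> \<sigma> B B')) \<cdot> (\<alpha> A' A (B \<boxtimes> B') \<cdot> (\<sigma> A A' \<otimes> \<iota> (B \<boxtimes> B')))))"
    by (simp add: swp_nat_ext swp_assoc)
  also have "(\<iota> A' \<otimes> (\<iota> A \<otimes> \<sigma> B B')) \<cdot> (\<alpha> A' A (B \<boxtimes> B') \<cdot> (\<sigma> A A' \<otimes> \<iota> (B \<boxtimes> B')))
     = \<alpha> A' A (B' \<boxtimes> B) \<cdot> (\<sigma> A A' \<otimes> \<sigma> B B')"
    using assoc_nat_ext[of "\<iota> A'" "\<iota> A" "\<sigma> B B'" A' A "B' \<boxtimes> B" "\<sigma> A A' \<otimes> \<iota> (B \<boxtimes> B')"]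
    by (simp add: interchange)
  finally show ?thesis by (simp add: mid_def cmp_assoc)
qed

text \<open>Associativity of the interchange, which becomes coassociativity of tensor products of
  comonoids.\<close>

lemma assoc_mid:
  assumes [simp]: "A \<in> Ob M" "B \<in> Ob M" "D \<in> Ob M" "X \<in> Ob M" "Y \<in> Ob M" "Z \<in> Ob M"
  shows "\<alpha> (A \<boxtimes> X) (B \<boxtimes> Y) (D \<boxtimes> Z) \<cdot>
      ((mid A B X Y \<otimes> \<iota> (D \<boxtimes> Z)) \<cdot> mid (A \<boxtimes> B) D (X \<boxtimes> Y) Z)
    = (\<iota> (A \<boxtimes> X) \<otimes> mid B D Y Z) \<cdot> (mid A (B \<boxtimes> D) X (Y \<boxtimes> Z) \<cdot> (\<alpha> A B D \<otimes> \<alpha> X Y Z))"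
    (is "?L = ?R")
proof -
  \<comment> \<open>Regroups the common target into the fully right-nested product of A, X, B, Y, D,
    Z. There both sides are composites of \<open>swp\<close> and differ only in the order of two
    independent exchanges, of B with X and of D with Y.\<close>
  let ?F = "(\<iota> A \<otimes> (\<iota> X \<otimes> \<alpha> B Y (D \<boxtimes> Z))) \<cdot> \<alpha> A X ((B \<boxtimes> Y) \<boxtimes> (D \<boxtimes> Z))"
  have F: "inverse_arr ?F (\<alpha>\<^sup>i A X ((B \<boxtimes> Y) \<boxtimes> (D \<boxtimes> Z)) \<cdot> (\<iota> A \<otimes> (\<iota> X \<otimes> \<alpha>\<^sup>i B Y (D \<boxtimes> Z))))"
    by (intro inverse_cmp inverse_tensor assoc_inverse inverse_idt) auto
  have FL: "?F \<cdot> (\<alpha> (A \<boxtimes> X) (B \<boxtimes> Y) (D \<boxtimes> Z) \<cdot> (mid A B X Y \<otimes> \<iota> (D \<boxtimes> Z)))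
    = (\<iota> A \<otimes> (swp B X (Y \<boxtimes> D \<boxtimes> Z) \<cdot> (\<iota> B \<otimes> \<alpha> X Y (D \<boxtimes> Z)))) \<cdot>
      (\<alpha> A B ((X \<boxtimes> Y) \<boxtimes> D \<boxtimes> Z) \<cdot> \<alpha> (A \<boxtimes> B) (X \<boxtimes> Y) (D \<boxtimes> Z))"
  proof -
    have "?F \<cdot> (\<alpha> (A \<boxtimes> X) (B \<boxtimes> Y) (D \<boxtimes> Z) \<cdot> (mid A B X Y \<otimes> \<iota> (D \<boxtimes> Z)))
      = (\<iota> A \<otimes> (\<iota> X \<otimes> \<alpha> B Y (D \<boxtimes> Z))) \<cdot> ((\<iota> A \<otimes> \<alpha> X (B \<boxtimes> Y) (D \<boxtimes> Z)) \<cdot>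
        (\<alpha> A (X \<boxtimes> B \<boxtimes> Y) (D \<boxtimes> Z) \<cdot> ((\<alpha> A X (B \<boxtimes> Y) \<otimes> \<iota> (D \<boxtimes> Z)) \<cdot> (mid A B X Y \<otimes> \<iota> (D \<boxtimes> Z)))))"
      by (simp add: pentagon_ext cmp_assoc)
    also have "\<dots> = (\<iota> A \<otimes> ((\<iota> X \<otimes> \<alpha> B Y (D \<boxtimes> Z)) \<cdot> \<alpha> X (B \<boxtimes> Y) (D \<boxtimes> Z))) \<cdot>
        (\<alpha> A (X \<boxtimes> B \<boxtimes> Y) (D \<boxtimes> Z) \<cdot> (((\<iota> A \<otimes> swp B X Y) \<otimes> \<iota> (D \<boxtimes> Z)) \<cdot> (\<alpha> A B (X \<boxtimes> Y) \<otimes> \<iota> (D \<boxtimes> Z))))"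
      by (simp add: mid_def tensor_simps)
    also have "\<dots> = (\<iota> A \<otimes> ((\<iota> X \<otimes> \<alpha> B Y (D \<boxtimes> Z)) \<cdot> (\<alpha> X (B \<boxtimes> Y) (D \<boxtimes> Z) \<cdot> (swp B X Y \<otimes> \<iota> (D \<boxtimes> Z))))) \<cdot>
        (\<alpha> A (B \<boxtimes> X \<boxtimes> Y) (D \<boxtimes> Z) \<cdot> (\<alpha> A B (X \<boxtimes> Y) \<otimes> \<iota> (D \<boxtimes> Z)))"
      by (subst assoc_nat_ext) (simp_all add: tensor_simps)
    also have "\<dots> = (\<iota> A \<otimes> (swp B X (Y \<boxtimes> D \<boxtimes> Z) \<cdot> (\<iota> B \<otimes> \<alpha> X Y (D \<boxtimes> Z)))) \<cdot>
        ((\<iota> A \<otimes> \<alpha> B (X \<boxtimes> Y) (D \<boxtimes> Z)) \<cdot>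
        (\<alpha> A (B \<boxtimes> X \<boxtimes> Y) (D \<boxtimes> Z) \<cdot> (\<alpha> A B (X \<boxtimes> Y) \<otimes> \<iota> (D \<boxtimes> Z))))"
      by (simp add: swp_tensor_right tensor_simps)
    finally show ?thesis by (simp add: pentagon_r)
  qed
  have "?F \<cdot> ?L = (\<iota> A \<otimes> (swp B X (Y \<boxtimes> D \<boxtimes> Z) \<cdot> (\<iota> B \<otimes> \<alpha> X Y (D \<boxtimes> Z)))) \<cdot>
      (\<alpha> A B ((X \<boxtimes> Y) \<boxtimes> D \<boxtimes> Z) \<cdot> (\<alpha> (A \<boxtimes> B) (X \<boxtimes> Y) (D \<boxtimes> Z) \<cdot> mid (A \<boxtimes> B) D (X \<boxtimes> Y) Z))"
    using cmp_extend[OF FL, of "mid (A \<boxtimes> B) D (X \<boxtimes> Y) Z"] by (simp add: cmp_assoc)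
  also have "\<dots> = (\<iota> A \<otimes> (swp B X (Y \<boxtimes> D \<boxtimes> Z) \<cdot> (\<iota> B \<otimes> \<alpha> X Y (D \<boxtimes> Z)))) \<cdot>
      (\<alpha> A B ((X \<boxtimes> Y) \<boxtimes> D \<boxtimes> Z) \<cdot> (((\<iota> A \<otimes> \<iota> B) \<otimes> swp D (X \<boxtimes> Y) Z) \<cdot> \<alpha> (A \<boxtimes> B) D ((X \<boxtimes> Y) \<boxtimes> Z)))"
    by (simp add: mid_def)
  also have "\<dots> = (\<iota> A \<otimes> (swp B X (Y \<boxtimes> D \<boxtimes> Z) \<cdot> (\<iota> B \<otimes> (\<alpha> X Y (D \<boxtimes> Z) \<cdot> swp D (X \<boxtimes> Y) Z)))) \<cdot>
      (\<alpha> A B (D \<boxtimes> (X \<boxtimes> Y) \<boxtimes> Z) \<cdot> \<alpha> (A \<boxtimes> B) D ((X \<boxtimes> Y) \<boxtimes> Z))"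
    by (subst assoc_nat_ext) (simp_all add: tensor_simps)
  also have "\<dots> = (\<iota> A \<otimes> (swp B X (Y \<boxtimes> D \<boxtimes> Z) \<cdot> (\<iota> B \<otimes> ((\<iota> X \<otimes> swp D Y Z) \<cdot> swp D X (Y \<boxtimes> Z))))) \<cdot>
      ((\<iota> A \<otimes> (\<iota> B \<otimes> (\<iota> D \<otimes> \<alpha> X Y Z))) \<cdot>
      (\<alpha> A B (D \<boxtimes> (X \<boxtimes> Y) \<boxtimes> Z) \<cdot> \<alpha> (A \<boxtimes> B) D ((X \<boxtimes> Y) \<boxtimes> Z)))"
    by (simp add: assoc_swp tensor_simps)
  also have "(\<iota> A \<otimes> (\<iota> B \<otimes> (\<iota> D \<otimes> \<alpha> X Y Z))) \<cdot> (\<alpha> A B (D \<boxtimes> (X \<boxtimes> Y) \<boxtimes> Z) \<cdot> \<alpha> (A \<boxtimes> B) D ((X \<boxtimes> Y) \<boxtimes> Z))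
      = \<alpha> A B (D \<boxtimes> X \<boxtimes> Y \<boxtimes> Z) \<cdot> (\<alpha> (A \<boxtimes> B) D (X \<boxtimes> Y \<boxtimes> Z) \<cdot> (\<iota> ((A \<boxtimes> B) \<boxtimes> D) \<otimes> \<alpha> X Y Z))"
    using assoc_nat_ext[of "\<iota> A" "\<iota> B" "\<iota> D \<otimes> \<alpha> X Y Z" A B "D \<boxtimes> X \<boxtimes> Y \<boxtimes> Z" "\<alpha> (A \<boxtimes> B) D ((X \<boxtimes> Y) \<boxtimes> Z)"]
      assoc_nat[of "\<iota> (A \<boxtimes> B)" "\<iota> D" "\<alpha> X Y Z" "A \<boxtimes> B" D "X \<boxtimes> Y \<boxtimes> Z"] by simp
  also have "\<dots> = (\<iota> A \<otimes> \<alpha> B D (X \<boxtimes> Y \<boxtimes> Z)) \<cdot> (\<alpha> A (B \<boxtimes> D) (X \<boxtimes> Y \<boxtimes> Z) \<cdot> (\<alpha> A B D \<otimes> \<alpha> X Y Z))"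
    using pentagon_ext[of A B D "X \<boxtimes> Y \<boxtimes> Z" "\<iota> ((A \<boxtimes> B) \<boxtimes> D) \<otimes> \<alpha> X Y Z"] by (simp add: interchange)
  finally have L: "?F \<cdot> ?L = (\<iota> A \<otimes> (swp B X (Y \<boxtimes> D \<boxtimes> Z) \<cdot> (\<iota> B \<otimes> ((\<iota> X \<otimes> swp D Y Z) \<cdot> swp D X (Y \<boxtimes> Z))))) \<cdot>
    ((\<iota> A \<otimes> \<alpha> B D (X \<boxtimes> Y \<boxtimes> Z)) \<cdot> (\<alpha> A (B \<boxtimes> D) (X \<boxtimes> Y \<boxtimes> Z) \<cdot> (\<alpha> A B D \<otimes> \<alpha> X Y Z)))" .
  have "?F \<cdot> ?R = (\<iota> A \<otimes> (\<iota> X \<otimes> \<alpha> B Y (D \<boxtimes> Z))) \<cdot> (\<alpha> A X ((B \<boxtimes> Y) \<boxtimes> (D \<boxtimes> Z)) \<cdot>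
      (((\<iota> A \<otimes> \<iota> X) \<otimes> mid B D Y Z) \<cdot> (mid A (B \<boxtimes> D) X (Y \<boxtimes> Z) \<cdot> (\<alpha> A B D \<otimes> \<alpha> X Y Z))))"
    by (simp add: cmp_assoc)
  also have "\<dots> = (\<iota> A \<otimes> (\<iota> X \<otimes> (\<alpha> B Y (D \<boxtimes> Z) \<cdot> mid B D Y Z))) \<cdot> (\<alpha> A X ((B \<boxtimes> D) \<boxtimes> (Y \<boxtimes> Z)) \<cdot>
      (mid A (B \<boxtimes> D) X (Y \<boxtimes> Z) \<cdot> (\<alpha> A B D \<otimes> \<alpha> X Y Z)))"
    by (subst assoc_nat_ext) (simp_all add: interchange_ext interchange)
  also have "\<dots> = (\<iota> A \<otimes> ((\<iota> X \<otimes> (\<iota> B \<otimes> swp D Y Z)) \<cdot> ((\<iota> X \<otimes> \<alpha> B D (Y \<boxtimes> Z)) \<cdot> swp (B \<boxtimes> D) X (Y \<boxtimes> Z)))) \<cdot>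
      (\<alpha> A (B \<boxtimes> D) (X \<boxtimes> Y \<boxtimes> Z) \<cdot> (\<alpha> A B D \<otimes> \<alpha> X Y Z))"
    by (simp add: mid_def tensor_simps)
  also have "(\<iota> X \<otimes> (\<iota> B \<otimes> swp D Y Z)) \<cdot> ((\<iota> X \<otimes> \<alpha> B D (Y \<boxtimes> Z)) \<cdot> swp (B \<boxtimes> D) X (Y \<boxtimes> Z))
    = (\<iota> X \<otimes> (\<iota> B \<otimes> swp D Y Z)) \<cdot> (swp B X (D \<boxtimes> Y \<boxtimes> Z) \<cdot>
       ((\<iota> B \<otimes> swp D X (Y \<boxtimes> Z)) \<cdot> \<alpha> B D (X \<boxtimes> Y \<boxtimes> Z)))"
    by (simp add: swp_tensor_left)
  also have "\<dots> = swp B X (Y \<boxtimes> D \<boxtimes> Z) \<cdot> ((\<iota> B \<otimes> ((\<iota> X \<otimes> swp D Y Z) \<cdot> swp D X (Y \<boxtimes> Z))) \<cdot> \<alpha> B D (X \<boxtimes> Y \<boxtimes> Z))"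
    using swp_nat_ext[of "\<iota> B" "\<iota> X" "swp D Y Z" B X "Y \<boxtimes> D \<boxtimes> Z"
        "(\<iota> B \<otimes> swp D X (Y \<boxtimes> Z)) \<cdot> \<alpha> B D (X \<boxtimes> Y \<boxtimes> Z)", symmetric]
    by (simp add: interchange_ext)
  finally have R: "?F \<cdot> ?R = ?F \<cdot> ?L"
    unfolding L by (simp add: tensor_simps)
  show ?thesis by (rule inverse_mono[OF F R[symmetric]]) simp_all
qed

text \<open>\<open>assoc_mid\<close> with all interchanges inverted. This orientation fits monoids,
  where \<open>mid\<close> acts before the multiplications.\<close>

lemma mid_assoc:
  assumes [simp]: "A \<in> Ob M" "B \<in> Ob M" "D \<in> Ob M" "X \<in> Ob M" "Y \<in> Ob M" "Z \<in> Ob M"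
  shows "mid (A \<boxtimes> B) (X \<boxtimes> Y) D Z \<cdot> (mid A X B Y \<otimes> \<iota> (D \<boxtimes> Z))
    = (\<alpha>\<^sup>i A B D \<otimes> \<alpha>\<^sup>i X Y Z) \<cdot> (mid A X (B \<boxtimes> D) (Y \<boxtimes> Z) \<cdot>
       ((\<iota> (A \<boxtimes> X) \<otimes> mid B Y D Z) \<cdot> \<alpha> (A \<boxtimes> X) (B \<boxtimes> Y) (D \<boxtimes> Z)))" (is "?L = ?R")
proof (rule inverse_epi)
  let ?e = "(mid A B X Y \<otimes> \<iota> (D \<boxtimes> Z)) \<cdot> mid (A \<boxtimes> B) D (X \<boxtimes> Y) Z"
  show "inverse_arr ?e (mid (A \<boxtimes> B) (X \<boxtimes> Y) D Z \<cdot> (mid A X B Y \<otimes> \<iota> (D \<boxtimes> Z)))"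
    by (intro inverse_cmp inverse_tensor mid_inverse inverse_idt) auto
  have "?L \<cdot> ?e = \<iota> (((A \<boxtimes> B) \<boxtimes> D) \<boxtimes> ((X \<boxtimes> Y) \<boxtimes> Z))"
    by (simp add: tensor_simps)
  also have "\<dots> = ?R \<cdot> ?e"
    by (simp add: cmp_assoc assoc_mid) (simp add: interchange_ext interchange)
  finally show "?L \<cdot> ?e = ?R \<cdot> ?e" .
qed auto

end

section \<open>Cocommutative comonoids\<close>

text \<open>Generalized elements have as domains tensor products of Hopf monoids, or a subobject
  whose multiplication is still to be constructed; what counts there is the comonoid structure
  alone.\<close>

record ('o, 'm) comonoid_data =
  cob :: 'o
  cd :: 'm
  ce :: 'm

context typed_smc begin

lemma mid_nat_rev:
  assumes "arr f" "arr g" "arr h" "arr k" "arr x" "tgt x = (src f \<boxtimes> src g) \<boxtimes> (src h \<boxtimes> src k)"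
  shows "((f \<otimes> h) \<otimes> (g \<otimes> k)) \<cdot> (mid (src f) (src g) (src h) (src k) \<cdot> x)
    = mid (tgt f) (tgt g) (tgt h) (tgt k) \<cdot> (((f \<otimes> g) \<otimes> (h \<otimes> k)) \<cdot> x)"
  using assms by (simp add: mid_nat_ext)

definition coc :: "('o, 'm) comonoid_data \<Rightarrow> bool" where
  "coc X \<longleftrightarrow> is_comonoid M (cob X) (cd X) (ce X) \<and> \<sigma> (cob X) (cob X) \<cdot> cd X = cd X"

text \<open>
  In terms of generalized elements, \<open>pr X f g\<close> is \<open>x \<mapsto> f x\<^sub>1 \<otimes> g x\<^sub>2\<close>. On morphisms of this shape the
  associators, unitors and braidings only rearrange arguments, so no coherence arguments are needed.
\<close>

definition pr :: "('o, 'm) comonoid_data \<Rightarrow> 'm \<Rightarrow> 'm \<Rightarrow> 'm" where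
  "pr X f g = (f \<otimes> g) \<cdot> cd X"

lemma src_pr [simp]: "src (pr X f g) = src (cd X)"
  and tgt_pr [simp]: "tgt (pr X f g) = tgt f \<boxtimes> tgt g"
  by (simp_all add: pr_def)

context fixes X assumes X: "coc X" begin

lemma cob_Ob [simp]: "cob X \<in> Ob M"
  and arr_cd [simp]: "arr (cd X)"
  and src_cd [simp]: "src (cd X) = cob X"
  and tgt_cd [simp]: "tgt (cd X) = cob X \<boxtimes> cob X"
  and arr_ce [simp]: "arr (ce X)"
  and src_ce [simp]: "src (ce X) = cob X"
  and tgt_ce [simp]: "tgt (ce X) = \<one>"
  and braid_cd: "\<sigma> (cob X) (cob X) \<cdot> cd X = cd X"
  using X unfolding coc_def is_comonoid_def by (auto simp: Hom_iff)

lemma assoc_cd: "\<alpha> (cob X) (cob X) (cob X) \<cdot> ((cd X \<otimes> \<iota> (cob X)) \<cdot> cd X) = (\<iota> (cob X) \<otimes> cd X) \<cdot> cd X"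
  using X unfolding coc_def is_comonoid_def by (auto simp: cmp_assoc)

lemma lunit_cd: "\<lambda>\<^sub>l (cob X) \<cdot> ((ce X \<otimes> \<iota> (cob X)) \<cdot> cd X) = \<iota> (cob X)"
  using X unfolding coc_def is_comonoid_def by (auto simp: cmp_assoc)

lemma runit_cd: "\<rho> (cob X) \<cdot> ((\<iota> (cob X) \<otimes> ce X) \<cdot> cd X) = \<iota> (cob X)"
  using X unfolding coc_def is_comonoid_def by (auto simp: cmp_assoc)

lemma arr_pr [simp]: "\<lbrakk>arr f; arr g; src f = cob X; src g = cob X\<rbrakk> \<Longrightarrow> arr (pr X f g)"
  by (simp add: pr_def)

lemma pr_idt [simp]: "pr X (\<iota> (cob X)) (\<iota> (cob X)) = cd X"
  by (simp add: pr_def)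

lemma tensor_pr:
  "\<lbrakk>arr f; arr g; src f = cob X; src g = cob X; arr h; arr k; tgt f = src h; tgt g = src k\<rbrakk>
    \<Longrightarrow> (h \<otimes> k) \<cdot> pr X f g = pr X (h \<cdot> f) (k \<cdot> g)"
  by (simp add: pr_def interchange_ext)

lemma assoc_pr:
  assumes [simp]: "arr f" "arr g" "arr h" "src f = cob X" "src g = cob X" "src h = cob X"
    and "tgt f = A" "tgt g = B" "tgt h = D"
  shows "\<alpha> A B D \<cdot> pr X (pr X f g) h = pr X f (pr X g h)"
proof -
  have "\<alpha> A B D \<cdot> pr X (pr X f g) h = \<alpha> A B D \<cdot> (((f \<otimes> g) \<otimes> h) \<cdot> ((cd X \<otimes> \<iota> (cob X)) \<cdot> cd X))"
    by (simp add: pr_def interchange_ext)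
  also have "\<dots> = (f \<otimes> (g \<otimes> h)) \<cdot> (\<alpha> (cob X) (cob X) (cob X) \<cdot> ((cd X \<otimes> \<iota> (cob X)) \<cdot> cd X))"
    using assms(7-) by (simp add: assoc_nat_ext)
  finally show ?thesis by (simp add: assoc_cd interchange_ext pr_def)
qed

lemma associ_pr:
  assumes [simp]: "arr f" "arr g" "arr h" "src f = cob X" "src g = cob X" "src h = cob X"
    and [symmetric, simp]: "tgt f = A" "tgt g = B" "tgt h = D"
  shows "\<alpha>\<^sup>i A B D \<cdot> pr X f (pr X g h) = pr X (pr X f g) h"
proof -
  have "\<alpha>\<^sup>i A B D \<cdot> (\<alpha> A B D \<cdot> pr X (pr X f g) h) = pr X (pr X f g) h"
    by (rule associ_assoc_ext) simp_all
  then show ?thesis by (simp add: assoc_pr)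
qed

lemma braid_pr:
  assumes [simp]: "arr f" "arr g" "src f = cob X" "src g = cob X"
    and [symmetric, simp]: "tgt f = A" "tgt g = B"
  shows "\<sigma> A B \<cdot> pr X f g = pr X g f"
  by (simp add: pr_def braid_nat_ext braid_cd)

lemma lunit_pr:
  assumes [simp]: "arr f" "src f = cob X" and [symmetric, simp]: "tgt f = A"
  shows "\<lambda>\<^sub>l A \<cdot> pr X (ce X) f = f"
proof -
  have "pr X (ce X) f = (\<iota> \<one> \<otimes> f) \<cdot> ((ce X \<otimes> \<iota> (cob X)) \<cdot> cd X)"
    by (simp add: pr_def interchange_ext)
  then show ?thesis by (simp add: lunit_nat_ext lunit_cd)
qed

lemma runit_pr:
  assumes [simp]: "arr f" "src f = cob X" and [symmetric, simp]: "tgt f = A"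
  shows "\<rho> A \<cdot> pr X f (ce X) = f"
proof -
  have "pr X f (ce X) = (f \<otimes> \<iota> \<one>) \<cdot> ((\<iota> (cob X) \<otimes> ce X) \<cdot> cd X)"
    by (simp add: pr_def interchange_ext)
  then show ?thesis by (simp add: runit_nat_ext runit_cd)
qed

lemma swp_pr:
  assumes [simp]: "arr f" "arr g" "arr h" "src f = cob X" "src g = cob X" "src h = cob X"
    and [symmetric, simp]: "tgt f = A" "tgt g = B" "tgt h = D"
  shows "swp A B D \<cdot> pr X f (pr X g h) = pr X g (pr X f h)"
  by (simp add: swp_def cmp_assoc associ_pr tensor_pr braid_pr assoc_pr)

lemma mid_pr:
  assumes [simp]: "arr f" "arr g" "arr h" "arr k" "src f = cob X" "src g = cob X" "src h = cob X" "src k = cob X"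
    and [symmetric, simp]: "tgt f = A" "tgt g = B" "tgt h = D" "tgt k = E"
  shows "mid A B D E \<cdot> pr X (pr X f g) (pr X h k) = pr X (pr X f h) (pr X g k)"
  by (simp add: mid_def cmp_assoc associ_pr tensor_pr swp_pr assoc_pr)

end

text \<open>Includes cocommutativity of both comonoids, so that a single fact about a generalized
  element supplies all side conditions of the \<open>pr\<close> calculus.\<close>

definition cmor :: "('o, 'm) comonoid_data \<Rightarrow> ('o, 'm) comonoid_data \<Rightarrow> 'm \<Rightarrow> bool" where
  "cmor X Y f \<longleftrightarrow> coc X \<and> coc Y \<and> arr f \<and> src f = cob X \<and> tgt f = cob Y \<and>
     cd Y \<cdot> f = (f \<otimes> f) \<cdot> cd X \<and> ce Y \<cdot> f = ce X"

lemma cmorD: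
  assumes "cmor X Y f"
  shows "coc X" "coc Y" "arr f" "src f = cob X" "tgt f = cob Y"
    "cd Y \<cdot> f = pr X f f" "ce Y \<cdot> f = ce X"
  using assms by (auto simp: cmor_def pr_def)

lemma cmor_idt: "coc X \<Longrightarrow> cmor X X (\<iota> (cob X))"
  by (simp add: cmor_def)

lemma cmor_cmp: 
  assumes f: "cmor X Y f" and g: "cmor Y Z g"
  shows "cmor X Z (g \<cdot> f)"
proof -
  note [simp] = cmorD[OF f] cmorD[OF g]
  have "cd Z \<cdot> (g \<cdot> f) = ((g \<otimes> g) \<cdot> cd Y) \<cdot> f"
    using g by (simp add: cmor_def flip: cmp_assoc)
  then show ?thesis unfolding cmor_def
    by (simp add: cmp_assoc tensor_pr cmp_extend[OF cmorD(7)[OF g]]) (simp add: pr_def)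
qed

text \<open>Substitution into a Sweedler expression: comultiplicativity of \<open>f\<close> means
  that its value is copied into both arguments.\<close>

lemma pr_cmor:
  assumes f: "cmor X Y f" and [simp]: "arr a" "arr b" "src a = cob Y" "src b = cob Y"
  shows "pr Y a b \<cdot> f = pr X (a \<cdot> f) (b \<cdot> f)"
proof -
  note [simp] = cmorD[OF f]
  show ?thesis by (simp add: pr_def[of Y] cmp_assoc tensor_pr)
qed

lemma ce_ce: "coc X \<Longrightarrow> pr X (ce X) (ce X) = \<lambda>\<^sup>i \<one> \<cdot> ce X"
  by (rule inverse_mono[OF lunit_inverse[of \<one>]]) (simp_all add: lunit_pr)

section \<open>Tensor products of cocommutative comonoids as products\<close>

definition ctens :: "('o, 'm) comonoid_data \<Rightarrow> ('o, 'm) comonoid_data \<Rightarrow> ('o, 'm) comonoid_data" where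
  "ctens X Y = \<lparr>cob = cob X \<boxtimes> cob Y,
     cd = mid (cob X) (cob X) (cob Y) (cob Y) \<cdot> (cd X \<otimes> cd Y),
     ce = \<lambda>\<^sub>l \<one> \<cdot> (ce X \<otimes> ce Y)\<rparr>"

lemma cob_ctens [simp]: "cob (ctens X Y) = cob X \<boxtimes> cob Y"
  by (simp add: ctens_def)

lemma runit_from_lunit:
  assumes [simp]: "A \<in> Ob M" "arr d" "src d = A" "tgt d = A \<boxtimes> A" "arr e" "src e = A" "tgt e = \<one>"
   and d: "\<sigma> A A \<cdot> d = d" and e: "\<lambda>\<^sub>l A \<cdot> ((e \<otimes> \<iota> A) \<cdot> d) = \<iota> A"
  shows "\<rho> A \<cdot> ((\<iota> A \<otimes> e) \<cdot> d) = \<iota> A"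
proof -
  have "\<rho> A \<cdot> ((\<iota> A \<otimes> e) \<cdot> d) = \<rho> A \<cdot> ((\<iota> A \<otimes> e) \<cdot> (\<sigma> A A \<cdot> d))" by (simp only: d)
  also have "\<dots> = \<rho> A \<cdot> (\<sigma> \<one> A \<cdot> ((e \<otimes> \<iota> A) \<cdot> d))"
    by (simp add: braid_nat_ext)
  also have "\<dots> = \<iota> A" by (simp add: cmp_extend[OF runit_braid] e)
  finally show ?thesis .
qed

text \<open>Naturality of \<open>mid\<close> collects the interchanges on one side. The laws then
  split into those of X and Y by \<open>assoc_mid\<close>, \<open>braid_mid\<close> and
  \<open>lunit_mid\<close>; the right counit law follows from the left one by symmetry.\<close>

lemma coc_ctens [simp]:
  assumes [simp]: "coc X" "coc Y" shows "coc (ctens X Y)"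
proof -
  let ?A = "cob X" and ?B = "cob Y"
  let ?d = "mid ?A ?A ?B ?B \<cdot> (cd X \<otimes> cd Y)" and ?e = "\<lambda>\<^sub>l \<one> \<cdot> (ce X \<otimes> ce Y)"
  have "(?d \<otimes> \<iota> (?A \<boxtimes> ?B)) \<cdot> ?d = (mid ?A ?A ?B ?B \<otimes> \<iota> (?A \<boxtimes> ?B)) \<cdot>
     (((cd X \<otimes> cd Y) \<otimes> (\<iota> ?A \<otimes> \<iota> ?B)) \<cdot> ?d)"
    by (simp add: interchange_ext)
  also have "\<dots> = (mid ?A ?A ?B ?B \<otimes> \<iota> (?A \<boxtimes> ?B)) \<cdot> (mid (?A \<boxtimes> ?A) ?A (?B \<boxtimes> ?B) ?B \<cdot>
     (((cd X \<otimes> \<iota> ?A) \<cdot> cd X) \<otimes> ((cd Y \<otimes> \<iota> ?B) \<cdot> cd Y)))"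
    using mid_nat_rev[of "cd X" "\<iota> ?A" "cd Y" "\<iota> ?B" "cd X \<otimes> cd Y"] by (simp add: interchange)
  finally have "\<alpha> (?A \<boxtimes> ?B) (?A \<boxtimes> ?B) (?A \<boxtimes> ?B) \<cdot> ((?d \<otimes> \<iota> (?A \<boxtimes> ?B)) \<cdot> ?d)
    = (\<alpha> (?A \<boxtimes> ?B) (?A \<boxtimes> ?B) (?A \<boxtimes> ?B) \<cdot> ((mid ?A ?A ?B ?B \<otimes> \<iota> (?A \<boxtimes> ?B)) \<cdot> mid (?A \<boxtimes> ?A) ?A (?B \<boxtimes> ?B) ?B)) \<cdot>
     (((cd X \<otimes> \<iota> ?A) \<cdot> cd X) \<otimes> ((cd Y \<otimes> \<iota> ?B) \<cdot> cd Y))"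
    by (simp add: cmp_assoc)
  also have "\<dots> = (\<iota> (?A \<boxtimes> ?B) \<otimes> mid ?A ?A ?B ?B) \<cdot> (mid ?A (?A \<boxtimes> ?A) ?B (?B \<boxtimes> ?B) \<cdot>
     (((\<iota> ?A \<otimes> cd X) \<cdot> cd X) \<otimes> ((\<iota> ?B \<otimes> cd Y) \<cdot> cd Y)))"
    by (simp add: assoc_mid cmp_assoc interchange assoc_cd)
  also have "\<dots> = (\<iota> (?A \<boxtimes> ?B) \<otimes> mid ?A ?A ?B ?B) \<cdot> (((\<iota> ?A \<otimes> \<iota> ?B) \<otimes> (cd X \<otimes> cd Y)) \<cdot> ?d)"
    using mid_nat_rev[of "\<iota> ?A" "cd X" "\<iota> ?B" "cd Y" "cd X \<otimes> cd Y"] by (simp add: interchange)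
  also have "\<dots> = (\<iota> (?A \<boxtimes> ?B) \<otimes> ?d) \<cdot> ?d"
    by (simp add: interchange_ext)
  finally have 1: "\<alpha> (?A \<boxtimes> ?B) (?A \<boxtimes> ?B) (?A \<boxtimes> ?B) \<cdot> ((?d \<otimes> \<iota> (?A \<boxtimes> ?B)) \<cdot> ?d)
      = (\<iota> (?A \<boxtimes> ?B) \<otimes> ?d) \<cdot> ?d" .
  have "\<sigma> (?A \<boxtimes> ?B) (?A \<boxtimes> ?B) \<cdot> ?d = mid ?A ?A ?B ?B \<cdot> ((\<sigma> ?A ?A \<otimes> \<sigma> ?B ?B) \<cdot> (cd X \<otimes> cd Y))"
    by (simp add: cmp_extend[OF braid_mid] cmp_assoc)
  then have 2: "\<sigma> (?A \<boxtimes> ?B) (?A \<boxtimes> ?B) \<cdot> ?d = ?d"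
    by (simp add: interchange braid_cd)
  have "(?e \<otimes> \<iota> (?A \<boxtimes> ?B)) \<cdot> ?d = (\<lambda>\<^sub>l \<one> \<otimes> \<iota> (?A \<boxtimes> ?B)) \<cdot>
     (((ce X \<otimes> ce Y) \<otimes> (\<iota> ?A \<otimes> \<iota> ?B)) \<cdot> ?d)"
    by (simp add: interchange_ext)
  also have "\<dots> = (\<lambda>\<^sub>l \<one> \<otimes> \<iota> (?A \<boxtimes> ?B)) \<cdot> (mid \<one> ?A \<one> ?B \<cdot>
     (((ce X \<otimes> \<iota> ?A) \<cdot> cd X) \<otimes> ((ce Y \<otimes> \<iota> ?B) \<cdot> cd Y)))"
    using mid_nat_rev[of "ce X" "\<iota> ?A" "ce Y" "\<iota> ?B" "cd X \<otimes> cd Y"] by (simp add: interchange)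
  finally have "\<lambda>\<^sub>l (?A \<boxtimes> ?B) \<cdot> ((?e \<otimes> \<iota> (?A \<boxtimes> ?B)) \<cdot> ?d)
    = (\<lambda>\<^sub>l (?A \<boxtimes> ?B) \<cdot> ((\<lambda>\<^sub>l \<one> \<otimes> \<iota> (?A \<boxtimes> ?B)) \<cdot> mid \<one> ?A \<one> ?B)) \<cdot>
     (((ce X \<otimes> \<iota> ?A) \<cdot> cd X) \<otimes> ((ce Y \<otimes> \<iota> ?B) \<cdot> cd Y))"
    by (simp add: cmp_assoc)
  also have "\<dots> = \<iota> (?A \<boxtimes> ?B)"
    by (simp add: lunit_mid interchange lunit_cd)
  finally have 3: "\<lambda>\<^sub>l (?A \<boxtimes> ?B) \<cdot> ((?e \<otimes> \<iota> (?A \<boxtimes> ?B)) \<cdot> ?d) = \<iota> (?A \<boxtimes> ?B)" .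
  have 4: "\<rho> (?A \<boxtimes> ?B) \<cdot> ((\<iota> (?A \<boxtimes> ?B) \<otimes> ?e) \<cdot> ?d) = \<iota> (?A \<boxtimes> ?B)"
    by (rule runit_from_lunit[OF _ _ _ _ _ _ _ 2 3]) simp_all
  show ?thesis
    unfolding coc_def is_comonoid_def Hom_iff
    using 1 2 3 4 by (simp add: ctens_def cmp_assoc)
qed

definition prj1 :: "('o, 'm) comonoid_data \<Rightarrow> ('o, 'm) comonoid_data \<Rightarrow> 'm" where
  "prj1 X Y = \<rho> (cob X) \<cdot> (\<iota> (cob X) \<otimes> ce Y)"

definition prj2 :: "('o, 'm) comonoid_data \<Rightarrow> ('o, 'm) comonoid_data \<Rightarrow> 'm" where
  "prj2 X Y = \<lambda>\<^sub>l (cob Y) \<cdot> (ce X \<otimes> \<iota> (cob Y))"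

lemma cmor_prj2:
  assumes [simp]: "coc X" "coc Y"
  shows "cmor (ctens X Y) Y (prj2 X Y)"
proof -
  let ?A = "cob X" and ?B = "cob Y"
  have l: "\<lambda>\<^sub>l (?B \<boxtimes> ?B) \<cdot> (\<lambda>\<^sub>l \<one> \<otimes> \<iota> (?B \<boxtimes> ?B)) = (\<lambda>\<^sub>l ?B \<otimes> \<lambda>\<^sub>l ?B) \<cdot> mid \<one> \<one> ?B ?B"
    by (simp add: cmp_assoc flip: lunit_mid)
  have "(prj2 X Y \<otimes> prj2 X Y) \<cdot> cd (ctens X Y) = (\<lambda>\<^sub>l ?B \<otimes> \<lambda>\<^sub>l ?B) \<cdot>
      (((ce X \<otimes> \<iota> ?B) \<otimes> (ce X \<otimes> \<iota> ?B)) \<cdot> (mid ?A ?A ?B ?B \<cdot> (cd X \<otimes> cd Y)))"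
    by (simp add: prj2_def ctens_def interchange_ext)
  also have "\<dots> = (\<lambda>\<^sub>l ?B \<otimes> \<lambda>\<^sub>l ?B) \<cdot> (mid \<one> \<one> ?B ?B \<cdot> (pr X (ce X) (ce X) \<otimes> cd Y))"
    using mid_nat_rev[of "ce X" "ce X" "\<iota> ?B" "\<iota> ?B" "cd X \<otimes> cd Y"] by (simp add: interchange pr_def)
  also have "\<dots> = \<lambda>\<^sub>l (?B \<boxtimes> ?B) \<cdot> ((\<lambda>\<^sub>l \<one> \<otimes> \<iota> (?B \<boxtimes> ?B)) \<cdot> (pr X (ce X) (ce X) \<otimes> cd Y))"
    by (simp add: cmp_extend[OF l] cmp_assoc)
  also have "\<dots> = \<lambda>\<^sub>l (?B \<boxtimes> ?B) \<cdot> ((\<iota> \<one> \<otimes> cd Y) \<cdot> (ce X \<otimes> \<iota> ?B))"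
    by (simp add: ce_ce interchange)
  also have "\<dots> = cd Y \<cdot> prj2 X Y"
    unfolding prj2_def by (subst lunit_nat_ext) simp_all
  finally have 1: "cd Y \<cdot> prj2 X Y = (prj2 X Y \<otimes> prj2 X Y) \<cdot> cd (ctens X Y)" by simp
  have 2: "ce Y \<cdot> prj2 X Y = ce (ctens X Y)"
    using lunit_nat_ext[of "ce Y" \<one> "ce X \<otimes> \<iota> ?B"]
    by (simp add: prj2_def ctens_def interchange)
  show ?thesis using 1 2 unfolding cmor_def by (simp add: prj2_def)
qed

text \<open>Carries the result on \<open>prj2\<close> over to \<open>prj1\<close>, which is a
  \<open>prj2\<close> after the braiding.\<close>

lemma cmor_braid:
  assumes [simp]: "coc X" "coc Y"
  shows "cmor (ctens X Y) (ctens Y X) (\<sigma> (cob X) (cob Y))"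
proof -
  let ?A = "cob X" and ?B = "cob Y"
  have b: "mid ?B ?B ?A ?A \<cdot> \<sigma> (?A \<boxtimes> ?A) (?B \<boxtimes> ?B) = (\<sigma> ?A ?B \<otimes> \<sigma> ?A ?B) \<cdot> mid ?A ?A ?B ?B"
  proof (rule inverse_mono[OF mid_inverse])
    show "mid ?B ?A ?B ?A \<cdot> (mid ?B ?B ?A ?A \<cdot> \<sigma> (?A \<boxtimes> ?A) (?B \<boxtimes> ?B))
      = mid ?B ?A ?B ?A \<cdot> ((\<sigma> ?A ?B \<otimes> \<sigma> ?A ?B) \<cdot> mid ?A ?A ?B ?B)"
      by (subst cmp_extend[OF braid_mid[symmetric]]) (simp_all add: cmp_assoc)
  qed simp_all
  have "cd (ctens Y X) \<cdot> \<sigma> ?A ?B = mid ?B ?B ?A ?A \<cdot> (\<sigma> (?A \<boxtimes> ?A) (?B \<boxtimes> ?B) \<cdot> (cd X \<otimes> cd Y))"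
    using braid_nat[of "cd X" "cd Y"] by (simp add: ctens_def cmp_assoc)
  also have "\<dots> = (\<sigma> ?A ?B \<otimes> \<sigma> ?A ?B) \<cdot> cd (ctens X Y)"
    by (simp add: cmp_extend[OF b] ctens_def cmp_assoc)
  finally have 1: "cd (ctens Y X) \<cdot> \<sigma> ?A ?B = (\<sigma> ?A ?B \<otimes> \<sigma> ?A ?B) \<cdot> cd (ctens X Y)" .
  have 2: "ce (ctens Y X) \<cdot> \<sigma> ?A ?B = ce (ctens X Y)"
    using braid_nat[of "ce X" "ce Y"] by (simp add: ctens_def cmp_assoc braid_one)
  show ?thesis using 1 2 unfolding cmor_def by simp
qed

lemma cmor_prj1:
  assumes [simp]: "coc X" "coc Y"
  shows "cmor (ctens X Y) X (prj1 X Y)"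
proof -
  have "prj1 X Y = prj2 Y X \<cdot> \<sigma> (cob X) (cob Y)"
    using braid_nat[of "\<iota> (cob X)" "ce Y"]
    by (simp add: prj1_def prj2_def cmp_assoc flip: lunit_braid)
  then show ?thesis by (simp add: cmor_cmp[OF cmor_braid cmor_prj2])
qed

lemmas prj_simps [simp] = cmorD(3-5,7)[OF cmor_prj1] cmorD(3-5,7)[OF cmor_prj2]

lemma pr_prj:
  assumes [simp]: "coc X" "coc Y"
  shows "pr (ctens X Y) (prj1 X Y) (prj2 X Y) = \<iota> (cob X \<boxtimes> cob Y)"
proof -
  let ?A = "cob X" and ?B = "cob Y"
  have "pr (ctens X Y) (prj1 X Y) (prj2 X Y) = (\<rho> ?A \<otimes> \<lambda>\<^sub>l ?B) \<cdot>
      (((\<iota> ?A \<otimes> ce Y) \<otimes> (ce X \<otimes> \<iota> ?B)) \<cdot> (mid ?A ?A ?B ?B \<cdot> (cd X \<otimes> cd Y)))"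
    by (simp add: pr_def prj2_def prj1_def ctens_def interchange_ext)
  also have "\<dots> = (\<rho> ?A \<otimes> \<lambda>\<^sub>l ?B) \<cdot> (mid ?A \<one> \<one> ?B \<cdot>
      (((\<iota> ?A \<otimes> ce X) \<cdot> cd X) \<otimes> ((ce Y \<otimes> \<iota> ?B) \<cdot> cd Y)))"
    using mid_nat_rev[of "\<iota> ?A" "ce X" "ce Y" "\<iota> ?B" "cd X \<otimes> cd Y"] by (simp add: interchange)
  finally show ?thesis by (simp add: runit_lunit_mid interchange lunit_cd runit_cd)
qed

text \<open>By \<open>pr_prj\<close> the projections are the generic elements of X and Y. Any tensor
  product of morphisms thereby becomes a Sweedler expression in these elements.\<close>

lemma tensor_eq_pr:
  assumes [simp]: "coc X" "coc Y" "arr f" "arr g" "src f = cob X" "src g = cob Y"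
  shows "f \<otimes> g = pr (ctens X Y) (f \<cdot> prj1 X Y) (g \<cdot> prj2 X Y)"
  using tensor_pr[of "ctens X Y" "prj1 X Y" "prj2 X Y" f g] by (simp add: pr_prj)

lemma prj1_pr:
  assumes [simp]: "coc T" "coc X" "coc Y" "arr f" "arr g" "src f = cob T" "src g = cob T" "tgt f = cob X" "tgt g = cob Y"
   and "ce Y \<cdot> g = ce T"
  shows "prj1 X Y \<cdot> pr T f g = f"
  using assms(10) by (simp add: prj1_def cmp_assoc tensor_pr runit_pr)

lemma prj2_pr:
  assumes [simp]: "coc T" "coc X" "coc Y" "arr f" "arr g" "src f = cob T" "src g = cob T" "tgt f = cob X" "tgt g = cob Y"
   and "ce X \<cdot> f = ce T"
  shows "prj2 X Y \<cdot> pr T f g = g"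
  using assms(10) by (simp add: prj2_def cmp_assoc tensor_pr lunit_pr)

text \<open>Cocommutativity of T enters here: the comultiplications of X and Y produce the arguments
  in the order f, f, g, g, and \<open>mid_pr\<close> rearranges them to f, g, f, g.\<close>

lemma cmor_pr:
  assumes f: "cmor T X f" and g: "cmor T Y g"
  shows "cmor T (ctens X Y) (pr T f g)"
proof -
  note [simp] = cmorD[OF f] cmorD[OF g]
  have "cd (ctens X Y) \<cdot> pr T f g = pr T (pr T f g) (pr T f g)"
    by (simp add: ctens_def cmp_assoc tensor_pr mid_pr)
  moreover have "ce (ctens X Y) \<cdot> pr T f g = ce T"
    by (simp add: ctens_def cmp_assoc tensor_pr lunit_pr)
  ultimately show ?thesis by (simp add: cmor_def) (simp add: pr_def)
qed


section \<open>Hopf monoids\<close>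

text \<open>Typing without axioms, so that a candidate structure on a subobject or a quotient can be
  handled before it is known to be a Hopf monoid.\<close>

definition hdata :: "('o, 'm) hopf_data \<Rightarrow> bool" where
  "hdata A \<longleftrightarrow> hob A \<in> Ob M \<and>
     mult A \<in> Hom M (hob A \<boxtimes> hob A) (hob A) \<and> unt A \<in> Hom M \<one> (hob A) \<and>
     comult A \<in> Hom M (hob A) (hob A \<boxtimes> hob A) \<and> counit A \<in> Hom M (hob A) \<one> \<and>
     antipode A \<in> Hom M (hob A) (hob A)"

definition hopf :: "('o, 'm) hopf_data \<Rightarrow> bool" where
  "hopf A \<longleftrightarrow> is_hopf_monoid M A \<and> is_cocommutative M A"

context fixes A assumes A: "hdata A" begin

lemma hob_Ob [simp]: "hob A \<in> Ob M"
  and arr_mult [simp]: "arr (mult A)"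
  and src_mult [simp]: "src (mult A) = hob A \<boxtimes> hob A"
  and tgt_mult [simp]: "tgt (mult A) = hob A"
  and arr_unt [simp]: "arr (unt A)"
  and src_unt [simp]: "src (unt A) = \<one>"
  and tgt_unt [simp]: "tgt (unt A) = hob A"
  and arr_comult [simp]: "arr (comult A)"
  and src_comult [simp]: "src (comult A) = hob A"
  and tgt_comult [simp]: "tgt (comult A) = hob A \<boxtimes> hob A"
  and arr_counit [simp]: "arr (counit A)"
  and src_counit [simp]: "src (counit A) = hob A"
  and tgt_counit [simp]: "tgt (counit A) = \<one>"
  and arr_antipode [simp]: "arr (antipode A)"
  and src_antipode [simp]: "src (antipode A) = hob A"
  and tgt_antipode [simp]: "tgt (antipode A) = hob A"
  using A unfolding hdata_def by (auto simp: Hom_iff)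

lemma hopf_iff: "hopf A \<longleftrightarrow>
     mult A \<cdot> (mult A \<otimes> \<iota> (hob A)) = mult A \<cdot> ((\<iota> (hob A) \<otimes> mult A) \<cdot> \<alpha> (hob A) (hob A) (hob A)) \<and>
     mult A \<cdot> (unt A \<otimes> \<iota> (hob A)) = \<lambda>\<^sub>l (hob A) \<and>
     mult A \<cdot> (\<iota> (hob A) \<otimes> unt A) = \<rho> (hob A) \<and>
     \<alpha> (hob A) (hob A) (hob A) \<cdot> ((comult A \<otimes> \<iota> (hob A)) \<cdot> comult A) = (\<iota> (hob A) \<otimes> comult A) \<cdot> comult A \<and>
     \<lambda>\<^sub>l (hob A) \<cdot> ((counit A \<otimes> \<iota> (hob A)) \<cdot> comult A) = \<iota> (hob A) \<and>
     \<rho> (hob A) \<cdot> ((\<iota> (hob A) \<otimes> counit A) \<cdot> comult A) = \<iota> (hob A) \<and>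
     comult A \<cdot> mult A = (mult A \<otimes> mult A) \<cdot> (mid (hob A) (hob A) (hob A) (hob A) \<cdot> (comult A \<otimes> comult A)) \<and>
     comult A \<cdot> unt A = (unt A \<otimes> unt A) \<cdot> \<lambda>\<^sup>i \<one> \<and>
     counit A \<cdot> mult A = \<lambda>\<^sub>l \<one> \<cdot> (counit A \<otimes> counit A) \<and>
     counit A \<cdot> unt A = \<iota> \<one> \<and>
     mult A \<cdot> ((antipode A \<otimes> \<iota> (hob A)) \<cdot> comult A) = unt A \<cdot> counit A \<and>
     mult A \<cdot> ((\<iota> (hob A) \<otimes> antipode A) \<cdot> comult A) = unt A \<cdot> counit A \<and>
     \<sigma> (hob A) (hob A) \<cdot> comult A = comult A"
  using A unfolding hopf_def is_hopf_monoid_def is_bimonoid_def is_monoid_def is_comonoid_def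
    is_cocommutative_def hdata_def Hom_iff
  by (auto simp: cmp_assoc)

end

lemma hopf_hdata [simp]: "hopf A \<Longrightarrow> hdata A"
  unfolding hopf_def is_hopf_monoid_def is_bimonoid_def is_monoid_def is_comonoid_def hdata_def by auto

text \<open>Does not presuppose the Hopf monoid axioms for A and B, so it can be used to carry them
  from one to the other.\<close>

definition hmor :: "('o, 'm) hopf_data \<Rightarrow> ('o, 'm) hopf_data \<Rightarrow> 'm \<Rightarrow> bool" where
  "hmor A B f \<longleftrightarrow> arr f \<and> src f = hob A \<and> tgt f = hob B \<and>
     f \<cdot> mult A = mult B \<cdot> (f \<otimes> f) \<and> f \<cdot> unt A = unt B \<and>
     comult B \<cdot> f = (f \<otimes> f) \<cdot> comult A \<and> counit B \<cdot> f = counit A \<and>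
     f \<cdot> antipode A = antipode B \<cdot> f"

lemma Hom_Hopf_coc: "f \<in> Hom (Hopf_coc M) A B \<longleftrightarrow> hopf A \<and> hopf B \<and> hmor A B f"
  unfolding Hopf_coc_def hopf_def hmor_def is_hopf_morphism_def Hom_iff by auto

context
  fixes A B f
  assumes A [simp]: "hdata A" and B [simp]: "hdata B" and f: "hmor A B f"
begin

lemma hmor_simps: "arr f" "src f = hob A" "tgt f = hob B"
  and hmor_counit: "counit B \<cdot> f = counit A"
  and hmor_unt: "f \<cdot> unt A = unt B"
  and hmor_mult: "f \<cdot> mult A = mult B \<cdot> (f \<otimes> f)"
  and hmor_comult: "comult B \<cdot> f = (f \<otimes> f) \<cdot> comult A"
  and hmor_antipode: "f \<cdot> antipode A = antipode B \<cdot> f"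
  using f unfolding hmor_def by auto

private lemmas f_simps = hmor_simps hmor_counit hmor_unt hmor_mult cmp_extend[OF hmor_mult] hmor_comult cmp_extend[OF hmor_comult]
  hmor_antipode cmp_extend[OF hmor_antipode] cmp_extend[OF hmor_counit] cmp_extend[OF hmor_unt] tensor_simps

text \<open>
  Both sides of every Hopf monoid axiom commute with \<open>f\<close>. So the axioms ascend from \<open>B\<close> to \<open>A\<close> if the
  tensor powers of \<open>f\<close> are monomorphisms, and descend from \<open>A\<close> to \<open>B\<close> if they are epimorphisms.
\<close>

lemma hmor_assoc_left: "f \<cdot> (mult A \<cdot> (mult A \<otimes> \<iota> (hob A))) = (mult B \<cdot> (mult B \<otimes> \<iota> (hob B))) \<cdot> ((f \<otimes> f) \<otimes> f)"
  by (simp add: f_simps)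

lemma hmor_assoc_right: "f \<cdot> (mult A \<cdot> ((\<iota> (hob A) \<otimes> mult A) \<cdot> \<alpha> (hob A) (hob A) (hob A)))
    = (mult B \<cdot> ((\<iota> (hob B) \<otimes> mult B) \<cdot> \<alpha> (hob B) (hob B) (hob B))) \<cdot> ((f \<otimes> f) \<otimes> f)"
  by (simp add: f_simps assoc_nat)

lemma hmor_unit_left: "f \<cdot> (mult A \<cdot> (unt A \<otimes> \<iota> (hob A))) = (mult B \<cdot> (unt B \<otimes> \<iota> (hob B))) \<cdot> (\<iota> \<one> \<otimes> f)"
  by (simp add: f_simps)

lemma hmor_unit_right: "f \<cdot> (mult A \<cdot> (\<iota> (hob A) \<otimes> unt A)) = (mult B \<cdot> (\<iota> (hob B) \<otimes> unt B)) \<cdot> (f \<otimes> \<iota> \<one>)"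
  by (simp add: f_simps)

lemma hmor_coassoc_right: "(f \<otimes> (f \<otimes> f)) \<cdot> ((\<iota> (hob A) \<otimes> comult A) \<cdot> comult A) = ((\<iota> (hob B) \<otimes> comult B) \<cdot> comult B) \<cdot> f"
  by (simp add: f_simps)

lemma hmor_counit_left: "f \<cdot> (\<lambda>\<^sub>l (hob A) \<cdot> ((counit A \<otimes> \<iota> (hob A)) \<cdot> comult A)) = (\<lambda>\<^sub>l (hob B) \<cdot> ((counit B \<otimes> \<iota> (hob B)) \<cdot> comult B)) \<cdot> f"
  using lunit_nat_ext[of f "hob B" "(counit A \<otimes> \<iota> (hob A)) \<cdot> comult A", symmetric]
  by (simp add: f_simps)

lemma hmor_counit_right: "f \<cdot> (\<rho> (hob A) \<cdot> ((\<iota> (hob A) \<otimes> counit A) \<cdot> comult A)) = (\<rho> (hob B) \<cdot> ((\<iota> (hob B) \<otimes> counit B) \<cdot> comult B)) \<cdot> f"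
  using runit_nat_ext[of f "hob B" "(\<iota> (hob A) \<otimes> counit A) \<cdot> comult A", symmetric]
  by (simp add: f_simps)

lemma hmor_comult_comult: "(f \<otimes> f) \<cdot> ((mult A \<otimes> mult A) \<cdot> (mid (hob A) (hob A) (hob A) (hob A) \<cdot> (comult A \<otimes> comult A)))
    = ((mult B \<otimes> mult B) \<cdot> (mid (hob B) (hob B) (hob B) (hob B) \<cdot> (comult B \<otimes> comult B))) \<cdot> (f \<otimes> f)"
proof -
  note [simp] = hmor_simps
  have "(f \<otimes> f) \<cdot> ((mult A \<otimes> mult A) \<cdot> (mid (hob A) (hob A) (hob A) (hob A) \<cdot> (comult A \<otimes> comult A)))
    = (mult B \<otimes> mult B) \<cdot> (((f \<otimes> f) \<otimes> (f \<otimes> f)) \<cdot> (mid (hob A) (hob A) (hob A) (hob A) \<cdot> (comult A \<otimes> comult A)))"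
    by (simp add: f_simps)
  also have "\<dots> = (mult B \<otimes> mult B) \<cdot> (mid (hob B) (hob B) (hob B) (hob B) \<cdot> (((f \<otimes> f) \<otimes> (f \<otimes> f)) \<cdot> (comult A \<otimes> comult A)))"
    using mid_nat_rev[of f f f f "comult A \<otimes> comult A"] by simp
  finally show ?thesis by (simp add: f_simps)
qed

lemma hmor_unt_unt: "(f \<otimes> f) \<cdot> ((unt A \<otimes> unt A) \<cdot> \<lambda>\<^sup>i \<one>) = (unt B \<otimes> unt B) \<cdot> \<lambda>\<^sup>i \<one>"
  by (simp add: f_simps)

lemma hmor_counit_counit: "\<lambda>\<^sub>l \<one> \<cdot> (counit A \<otimes> counit A) = (\<lambda>\<^sub>l \<one> \<cdot> (counit B \<otimes> counit B)) \<cdot> (f \<otimes> f)"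
  by (simp add: f_simps)

lemma hmor_antipode_left: "f \<cdot> (mult A \<cdot> ((antipode A \<otimes> \<iota> (hob A)) \<cdot> comult A)) = (mult B \<cdot> ((antipode B \<otimes> \<iota> (hob B)) \<cdot> comult B)) \<cdot> f"
  by (simp add: f_simps)

lemma hmor_antipode_right: "f \<cdot> (mult A \<cdot> ((\<iota> (hob A) \<otimes> antipode A) \<cdot> comult A)) = (mult B \<cdot> ((\<iota> (hob B) \<otimes> antipode B) \<cdot> comult B)) \<cdot> f"
  by (simp add: f_simps)

lemma hmor_unt_counit: "f \<cdot> (unt A \<cdot> counit A) = (unt B \<cdot> counit B) \<cdot> f"
  by (simp add: f_simps)

lemma hmor_braid_comult: "(f \<otimes> f) \<cdot> (\<sigma> (hob A) (hob A) \<cdot> comult A) = (\<sigma> (hob B) (hob B) \<cdot> comult B) \<cdot> f"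
  by (simp add: f_simps braid_nat_ext)

lemmas hmor_intertwines = hmor_assoc_left hmor_assoc_right hmor_unit_left hmor_unit_right hmor_coassoc_right hmor_counit_left hmor_counit_right hmor_comult_comult hmor_unt_unt hmor_counit_counit hmor_antipode_left hmor_antipode_right hmor_unt_counit hmor_braid_comult

lemma hmor_intertwines':
  "(f \<otimes> (f \<otimes> f)) \<cdot> (\<alpha> (hob A) (hob A) (hob A) \<cdot> ((comult A \<otimes> \<iota> (hob A)) \<cdot> comult A))
    = (\<alpha> (hob B) (hob B) (hob B) \<cdot> ((comult B \<otimes> \<iota> (hob B)) \<cdot> comult B)) \<cdot> f"
  "(f \<otimes> f) \<cdot> (comult A \<cdot> mult A) = (comult B \<cdot> mult B) \<cdot> (f \<otimes> f)"
  "(f \<otimes> f) \<cdot> (comult A \<cdot> unt A) = comult B \<cdot> unt B"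
  "counit A \<cdot> mult A = (counit B \<cdot> mult B) \<cdot> (f \<otimes> f)"
  "counit A \<cdot> unt A = counit B \<cdot> unt B"
proof -
  note [simp] = hmor_simps hmor_counit hmor_unt
  show "(f \<otimes> (f \<otimes> f)) \<cdot> (\<alpha> (hob A) (hob A) (hob A) \<cdot> ((comult A \<otimes> \<iota> (hob A)) \<cdot> comult A))
    = (\<alpha> (hob B) (hob B) (hob B) \<cdot> ((comult B \<otimes> \<iota> (hob B)) \<cdot> comult B)) \<cdot> f"
    using assoc_nat_ext[of f f f "hob B" "hob B" "hob B" "(comult A \<otimes> \<iota> (hob A)) \<cdot> comult A", symmetric]
    by (simp add: f_simps)
  have "(f \<otimes> f) \<cdot> (comult A \<cdot> mult A) = comult B \<cdot> (f \<cdot> mult A)"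
    by (simp add: cmp_extend[OF hmor_comult] cmp_assoc)
  then show "(f \<otimes> f) \<cdot> (comult A \<cdot> mult A) = (comult B \<cdot> mult B) \<cdot> (f \<otimes> f)"
    by (simp add: hmor_mult cmp_assoc)
  have "(f \<otimes> f) \<cdot> (comult A \<cdot> unt A) = comult B \<cdot> (f \<cdot> unt A)"
    by (simp only: cmp_extend[OF hmor_comult] A B arr_unt cmp_assoc hmor_simps tgt_unt arr_comult src_comult
       tgt_comult arr_tensor src_tensor)
  then show "(f \<otimes> f) \<cdot> (comult A \<cdot> unt A) = comult B \<cdot> unt B" by simp
  have "(counit B \<cdot> f) \<cdot> mult A = (counit B \<cdot> mult B) \<cdot> (f \<otimes> f)"
    by (simp only: cmp_assoc A B arr_mult arr_counit hmor_simps src_counit tgt_mult hmor_mult src_mult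
        arr_tensor tgt_tensor)
  then show "counit A \<cdot> mult A = (counit B \<cdot> mult B) \<cdot> (f \<otimes> f)" by simp
  have "(counit B \<cdot> f) \<cdot> unt A = counit B \<cdot> unt B"
    by (simp only: cmp_assoc A B arr_unt arr_counit hmor_simps src_counit tgt_unt hmor_unt)
  then show "counit A \<cdot> unt A = counit B \<cdot> unt B" by simp
qed

end

section \<open>Transfer of the Hopf monoid axioms\<close>

definition mon :: "'m \<Rightarrow> bool" where
  "mon f \<longleftrightarrow> arr f \<and> (\<forall>x y. arr x \<longrightarrow> arr y \<longrightarrow> tgt x = src f \<longrightarrow> tgt y = src f \<longrightarrow> src x = src y \<longrightarrow>
     f \<cdot> x = f \<cdot> y \<longrightarrow> x = y)"

definition epi :: "'m \<Rightarrow> bool" where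
  "epi f \<longleftrightarrow> arr f \<and> (\<forall>x y. arr x \<longrightarrow> arr y \<longrightarrow> src x = tgt f \<longrightarrow> src y = tgt f \<longrightarrow> tgt x = tgt y \<longrightarrow>
     x \<cdot> f = y \<cdot> f \<longrightarrow> x = y)"

lemma monD: "\<lbrakk>mon f; f \<cdot> x = f \<cdot> y; arr x; arr y; tgt x = src f; tgt y = src f; src x = src y\<rbrakk> \<Longrightarrow> x = y"
  unfolding mon_def by blast

lemma epiD: "\<lbrakk>epi f; x \<cdot> f = y \<cdot> f; arr x; arr y; src x = tgt f; src y = tgt f; tgt x = tgt y\<rbrakk> \<Longrightarrow> x = y"
  unfolding epi_def by blast

lemma mon_cmp: assumes "mon f" "mon g" "tgt f = src g" shows "mon (g \<cdot> f)"
proof -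
  have a: "arr f" "arr g" using assms unfolding mon_def by auto
  show ?thesis unfolding mon_def
  proof (intro conjI allI impI)
    fix x y assume *: "arr x" "arr y" "tgt x = src (g \<cdot> f)" "tgt y = src (g \<cdot> f)" "src x = src y"
      "(g \<cdot> f) \<cdot> x = (g \<cdot> f) \<cdot> y"
    then have "g \<cdot> (f \<cdot> x) = g \<cdot> (f \<cdot> y)" using a assms(3) by (simp add: cmp_assoc)
    then have "f \<cdot> x = f \<cdot> y" using * a assms(3) by - (rule monD[OF assms(2)], simp_all)
    then show "x = y" using * by - (rule monD[OF assms(1)], simp_all)
  qed (use a assms in simp)
qed

lemma epi_cmp: assumes "epi f" "epi g" "tgt f = src g" shows "epi (g \<cdot> f)"
proof -
  have a: "arr f" "arr g" using assms unfolding epi_def by auto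
  show ?thesis unfolding epi_def
  proof (intro conjI allI impI)
    fix x y assume *: "arr x" "arr y" "src x = tgt (g \<cdot> f)" "src y = tgt (g \<cdot> f)" "tgt x = tgt y"
      "x \<cdot> (g \<cdot> f) = y \<cdot> (g \<cdot> f)"
    then have "(x \<cdot> g) \<cdot> f = (y \<cdot> g) \<cdot> f" using a assms(3) by (simp add: cmp_assoc)
    then have "x \<cdot> g = y \<cdot> g" using * a assms(3) by - (rule epiD[OF assms(1)], simp_all)
    then show "x = y" using * by - (rule epiD[OF assms(2)], simp_all)
  qed (use a assms in simp)
qed

lemma hopf_ascend:
  assumes A [simp]: "hdata A" and B [simp]: "hopf B" and f: "hmor A B f"
    and m1: "mon f" and m2: "mon (f \<otimes> f)" and m3: "mon (f \<otimes> (f \<otimes> f))"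
  shows "hopf A"
proof -
  have B' [simp]: "hdata B" by simp
  note I = hmor_intertwines[OF A B' f] hmor_intertwines'[OF A B' f]
  note [simp] = hmor_simps[OF A B' f]
  note ax = hopf_iff[OF B', THEN iffD1, OF B]
  show ?thesis unfolding hopf_iff[OF A]
    apply (intro conjI)
    subgoal by (rule monD[OF m1]) (simp only: I ax, simp_all)
    subgoal by (rule monD[OF m1]) (simp only: I ax, simp_all add: lunit_nat)
    subgoal by (rule monD[OF m1]) (simp only: I ax, simp_all add: runit_nat)
    subgoal by (rule monD[OF m3]) (simp only: I ax, simp_all)
    subgoal by (rule monD[OF m1]) (simp only: I ax, simp_all)
    subgoal by (rule monD[OF m1]) (simp only: I ax, simp_all)
    subgoal by (rule monD[OF m2]) (simp only: I ax, simp_all)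
    subgoal by (rule monD[OF m2]) (simp only: I ax, simp_all)
    \<comment> \<open>This axiom and the next take values in the unit object, so the intertwining
      identities give them without cancelling a power of \<open>f\<close>.\<close>
    subgoal by (simp only: I ax)
    subgoal by (simp only: I ax)
    subgoal by (rule monD[OF m1]) (simp only: I ax, simp_all)
    subgoal by (rule monD[OF m1]) (simp only: I ax, simp_all)
    subgoal by (rule monD[OF m2]) (simp only: I ax, simp_all add: hmor_comult[OF A B' f])
    done
qed

lemma hopf_descend:
  assumes A [simp]: "hopf A" and B [simp]: "hdata B" and f: "hmor A B f"
    and e1: "epi f" and e2: "epi (f \<otimes> f)" and e3: "epi ((f \<otimes> f) \<otimes> f)"
    and e4: "epi (\<iota> \<one> \<otimes> f)" "epi (f \<otimes> \<iota> \<one>)"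
  shows "hopf B"
proof -
  have A' [simp]: "hdata A" by simp
  note I = hmor_intertwines[OF A' B f, symmetric] hmor_intertwines'[OF A' B f, symmetric]
  note [simp] = hmor_simps[OF A' B f]
  note ax = hopf_iff[OF A', THEN iffD1, OF A]
  show ?thesis unfolding hopf_iff[OF B]
    apply (intro conjI)
    subgoal by (rule epiD[OF e3]) (simp only: I ax, simp_all)
    subgoal by (rule epiD[OF e4(1)]) (simp only: I ax, simp_all add: lunit_nat)
    subgoal by (rule epiD[OF e4(2)]) (simp only: I ax, simp_all add: runit_nat)
    subgoal by (rule epiD[OF e1]) (simp only: I ax, simp_all)
    subgoal by (rule epiD[OF e1]) (simp only: I ax, simp_all)
    subgoal by (rule epiD[OF e1]) (simp only: I ax, simp_all)
    subgoal by (rule epiD[OF e2]) (simp only: I ax, simp_all)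
    \<comment> \<open>Dually, the axiom concerns a morphism out of the unit object, and nothing has
      to be cancelled.\<close>
    subgoal by (simp only: I ax)
    subgoal by (rule epiD[OF e2]) (simp only: I ax, simp_all)
    subgoal by (simp only: I ax)
    subgoal by (rule epiD[OF e1]) (simp only: I ax, simp_all)
    subgoal by (rule epiD[OF e1]) (simp only: I ax, simp_all)
    subgoal by (rule epiD[OF e1]) (simp only: I ax, simp_all add: hmor_comult[OF A' B f])
    done
qed


section \<open>Convolution groups\<close>

definition com :: "('o, 'm) hopf_data \<Rightarrow> ('o, 'm) comonoid_data" where
  "com A = \<lparr>cob = hob A, cd = comult A, ce = counit A\<rparr>"

lemma com_simps [simp]: "cob (com A) = hob A" "cd (com A) = comult A" "ce (com A) = counit A"
  by (simp_all add: com_def)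

lemma coc_com [simp]: "hopf A \<Longrightarrow> coc (com A)"
  unfolding hopf_def is_hopf_monoid_def is_bimonoid_def is_cocommutative_def coc_def com_simps by blast

text \<open>Stated for any associative \<open>m\<close> because it is applied to the multiplication
  of the tensor square of a Hopf monoid as well as to \<open>mult A\<close>.\<close>

lemma mult_pr_assoc:
  assumes "coc X" "arr m" "src m = A \<boxtimes> A" "tgt m = A" "A \<in> Ob M"
    and m: "m \<cdot> (m \<otimes> \<iota> A) = m \<cdot> ((\<iota> A \<otimes> m) \<cdot> \<alpha> A A A)"
    and "arr f" "arr g" "arr h" "src f = cob X" "src g = cob X" "src h = cob X"
    and "tgt f = A" "tgt g = A" "tgt h = A"
  shows "m \<cdot> pr X (m \<cdot> pr X f g) h = m \<cdot> pr X f (m \<cdot> pr X g h)"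
proof -
  note [simp] = assms(1-5) assms(7-)
  have "m \<cdot> pr X (m \<cdot> pr X f g) h = (m \<cdot> (m \<otimes> \<iota> A)) \<cdot> pr X (pr X f g) h"
    by (simp add: cmp_assoc tensor_pr)
  then show ?thesis
    by (simp add: m cmp_assoc assoc_pr tensor_pr)
qed

definition conv :: "('o, 'm) comonoid_data \<Rightarrow> ('o, 'm) hopf_data \<Rightarrow> 'm \<Rightarrow> 'm \<Rightarrow> 'm" where
  "conv X A f g = mult A \<cdot> pr X f g"

definition un :: "('o, 'm) comonoid_data \<Rightarrow> ('o, 'm) hopf_data \<Rightarrow> 'm" where
  "un X A = unt A \<cdot> ce X"

context fixes X A assumes X [simp]: "coc X" and A [simp]: "hopf A" begin

private lemmas ax = hopf_iff[OF hopf_hdata[OF A], THEN iffD1, OF A]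

lemma conv_simps [simp]:
  "\<lbrakk>arr f; arr g; src f = cob X; src g = cob X; tgt f = hob A; tgt g = hob A\<rbrakk> \<Longrightarrow> arr (conv X A f g)"
  "src (conv X A f g) = cob X"
  "tgt (conv X A f g) = hob A"
  "arr (un X A)" "src (un X A) = cob X" "tgt (un X A) = hob A"
  by (simp_all add: conv_def un_def)

lemma conv_assoc:
  "\<lbrakk>arr f; arr g; arr h; src f = cob X; src g = cob X; src h = cob X;
    tgt f = hob A; tgt g = hob A; tgt h = hob A\<rbrakk>
   \<Longrightarrow> conv X A (conv X A f g) h = conv X A f (conv X A g h)"
  unfolding conv_def by (rule mult_pr_assoc[where A = "hob A"]) (simp_all add: ax)

lemma conv_un_left [simp]: "\<lbrakk>arr f; src f = cob X; tgt f = hob A\<rbrakk> \<Longrightarrow> conv X A (un X A) f = f"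
proof -
  assume f [simp]: "arr f" "src f = cob X" "tgt f = hob A"
  have "conv X A (un X A) f = (mult A \<cdot> (unt A \<otimes> \<iota> (hob A))) \<cdot> pr X (ce X) f"
    by (simp add: conv_def un_def cmp_assoc tensor_pr)
  then show ?thesis by (simp add: ax lunit_pr)
qed

lemma conv_un_right [simp]: "\<lbrakk>arr f; src f = cob X; tgt f = hob A\<rbrakk> \<Longrightarrow> conv X A f (un X A) = f"
proof -
  assume f [simp]: "arr f" "src f = cob X" "tgt f = hob A"
  have "conv X A f (un X A) = (mult A \<cdot> (\<iota> (hob A) \<otimes> unt A)) \<cdot> pr X f (ce X)"
    by (simp add: conv_def un_def cmp_assoc tensor_pr)
  then show ?thesis by (simp add: ax runit_pr)
qed

lemma un_un: "pr X (un X A) (un X A) = (unt A \<otimes> unt A) \<cdot> (\<lambda>\<^sup>i \<one> \<cdot> ce X)"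
  unfolding un_def by (simp add: ce_ce[symmetric] tensor_pr)

lemma cmor_un [simp]: "cmor X (com A) (un X A)"
proof -
  have "comult A \<cdot> un X A = (comult A \<cdot> unt A) \<cdot> ce X" by (simp add: un_def cmp_assoc)
  also have "\<dots> = pr X (un X A) (un X A)" unfolding un_un by (simp add: ax cmp_assoc)
  finally have 1: "comult A \<cdot> un X A = pr X (un X A) (un X A)" .
  have 2: "counit A \<cdot> un X A = ce X"
    by (simp add: un_def ax flip: cmp_assoc)
  show ?thesis using 1 2 by (simp add: cmor_def pr_def)
qed

end

lemma un_cmor: "\<lbrakk>hopf A; cmor X Y f\<rbrakk> \<Longrightarrow> un Y A \<cdot> f = un X A"
  using cmorD[of X Y f] by (simp add: un_def cmp_assoc)

lemma conv_cmor:
  assumes "hopf A" "cmor X Y t" "arr f" "arr g" "src f = cob Y" "src g = cob Y" "tgt f = hob A" "tgt g = hob A"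
  shows "conv Y A f g \<cdot> t = conv X A (f \<cdot> t) (g \<cdot> t)"
  using assms cmorD[OF assms(2)] by (simp add: conv_def cmp_assoc pr_cmor[OF assms(2)])

lemma cmor_mult:
  assumes A [simp]: "hopf A"
  shows "cmor (ctens (com A) (com A)) (com A) (mult A)"
  using hopf_iff[OF hopf_hdata[OF A], THEN iffD1, OF A]
  by (simp add: cmor_def) (simp add: ctens_def)

lemma cmor_conv [simp]:
  assumes [simp]: "hopf A" and f: "cmor X (com A) f" and g: "cmor X (com A) g"
  shows "cmor X (com A) (conv X A f g)"
  unfolding conv_def by (rule cmor_cmp[OF cmor_pr[OF f g] cmor_mult]) simp

lemma conv_antipode_left:
  assumes A [simp]: "hopf A" and f: "cmor X (com A) f"
  shows "conv X A (antipode A \<cdot> f) f = un X A"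
proof -
  note [simp] = cmorD[OF f]
  have "conv X A (antipode A \<cdot> f) f = mult A \<cdot> ((antipode A \<otimes> \<iota> (hob A)) \<cdot> pr X f f)"
    by (simp add: conv_def tensor_pr)
  also have "\<dots> = (mult A \<cdot> ((antipode A \<otimes> \<iota> (hob A)) \<cdot> comult A)) \<cdot> f"
    using cmorD(6)[OF f] by (simp add: cmp_assoc)
  also have "\<dots> = unt A \<cdot> (counit A \<cdot> f)"
    using hopf_iff[OF hopf_hdata[OF A], THEN iffD1, OF A] by (simp add: cmp_assoc)
  finally show ?thesis using cmorD(7)[OF f] by (simp add: un_def)
qed

lemma conv_antipode_right:
  assumes A [simp]: "hopf A" and f: "cmor X (com A) f"
  shows "conv X A f (antipode A \<cdot> f) = un X A"
proof -
  note [simp] = cmorD[OF f]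
  have "conv X A f (antipode A \<cdot> f) = mult A \<cdot> ((\<iota> (hob A) \<otimes> antipode A) \<cdot> pr X f f)"
    by (simp add: conv_def tensor_pr)
  also have "\<dots> = (mult A \<cdot> ((\<iota> (hob A) \<otimes> antipode A) \<cdot> comult A)) \<cdot> f"
    using cmorD(6)[OF f] by (simp add: cmp_assoc)
  also have "\<dots> = unt A \<cdot> (counit A \<cdot> f)"
    using hopf_iff[OF hopf_hdata[OF A], THEN iffD1, OF A] by (simp add: cmp_assoc)
  finally show ?thesis using cmorD(7)[OF f] by (simp add: un_def)
qed

text \<open>\<open>n\<close> is the multiplication of the tensor square. Its associativity allows
  convolution inverses to be compared in Hom(A, A (x) A).\<close>

lemma mult_tensor_assoc:
  assumes A [simp]: "hopf A"
  defines "B \<equiv> hob A" and "n \<equiv> (mult A \<otimes> mult A) \<cdot> mid (hob A) (hob A) (hob A) (hob A)"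
  shows "n \<cdot> (n \<otimes> \<iota> (B \<boxtimes> B)) = n \<cdot> ((\<iota> (B \<boxtimes> B) \<otimes> n) \<cdot> \<alpha> (B \<boxtimes> B) (B \<boxtimes> B) (B \<boxtimes> B))"
proof -
  note ax = hopf_iff[OF hopf_hdata[OF A], THEN iffD1, OF A]
  have B [simp]: "B \<in> Ob M" "hob A = B" by (simp_all add: B_def)
  have m: "(mult A \<cdot> (mult A \<otimes> \<iota> B)) \<cdot> \<alpha>\<^sup>i B B B = mult A \<cdot> (\<iota> B \<otimes> mult A)"
    using ax by (simp add: cmp_assoc)
  have "n \<cdot> (n \<otimes> \<iota> (B \<boxtimes> B)) = (mult A \<otimes> mult A) \<cdot> (mid B B B B \<cdot>
     (((mult A \<otimes> mult A) \<otimes> (\<iota> B \<otimes> \<iota> B)) \<cdot> (mid B B B B \<otimes> \<iota> (B \<boxtimes> B))))"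
    by (simp add: n_def tensor_simps)
  also have "\<dots> = ((mult A \<cdot> (mult A \<otimes> \<iota> B)) \<otimes> (mult A \<cdot> (mult A \<otimes> \<iota> B))) \<cdot>
      (mid (B \<boxtimes> B) (B \<boxtimes> B) B B \<cdot> (mid B B B B \<otimes> \<iota> (B \<boxtimes> B)))"
    using mid_nat_ext[of "mult A" "mult A" "\<iota> B" "\<iota> B" B B B B "mid B B B B \<otimes> \<iota> (B \<boxtimes> B)"]
    by (simp add: interchange_ext)
  also have "\<dots> = ((mult A \<cdot> (\<iota> B \<otimes> mult A)) \<otimes> (mult A \<cdot> (\<iota> B \<otimes> mult A))) \<cdot>
      (mid B B (B \<boxtimes> B) (B \<boxtimes> B) \<cdot> ((\<iota> (B \<boxtimes> B) \<otimes> mid B B B B) \<cdot> \<alpha> (B \<boxtimes> B) (B \<boxtimes> B) (B \<boxtimes> B)))"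
    by (simp add: mid_assoc interchange_ext m)
  also have "\<dots> = (mult A \<otimes> mult A) \<cdot> (mid B B B B \<cdot>
     (((\<iota> B \<otimes> \<iota> B) \<otimes> (mult A \<otimes> mult A)) \<cdot> ((\<iota> (B \<boxtimes> B) \<otimes> mid B B B B) \<cdot> \<alpha> (B \<boxtimes> B) (B \<boxtimes> B) (B \<boxtimes> B))))"
    using mid_nat_ext[of "\<iota> B" "\<iota> B" "mult A" "mult A" B B B B
        "(\<iota> (B \<boxtimes> B) \<otimes> mid B B B B) \<cdot> \<alpha> (B \<boxtimes> B) (B \<boxtimes> B) (B \<boxtimes> B)"]
    by (simp add: interchange_ext)
  also have "\<dots> = n \<cdot> ((\<iota> (B \<boxtimes> B) \<otimes> n) \<cdot> \<alpha> (B \<boxtimes> B) (B \<boxtimes> B) (B \<boxtimes> B))"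
    by (simp add: n_def tensor_simps)
  finally show ?thesis .
qed

text \<open>
  Both \<open>\<Delta> S\<close> and \<open>(S \<otimes> S) \<Delta>\<close> are convolution inverse to \<open>\<Delta>\<close> in \<open>Hom(A, A \<otimes> A)\<close>.
\<close>

lemma cmor_antipode:
  assumes A [simp]: "hopf A"
  shows "cmor (com A) (com A) (antipode A)"
proof -
  note ax = hopf_iff[OF hopf_hdata[OF A], THEN iffD1, OF A]
  define B where "B = hob A"
  have [simp]: "B \<in> Ob M" by (simp add: B_def)
  have [simp]: "hob A = B" by (simp add: B_def)
  define n where "n = (mult A \<otimes> mult A) \<cdot> mid B B B B"
  let ?X = "com A"
  let ?S = "antipode A" and ?x = "comult A \<cdot> antipode A" and ?u = "un (com A) A"
  have [simp]: "arr n" "src n = (B \<boxtimes> B) \<boxtimes> (B \<boxtimes> B)" "tgt n = B \<boxtimes> B" by (simp_all add: n_def)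
  have idt: "cmor ?X ?X (\<iota> B)" using cmor_idt[of ?X] by simp
  have Sl: "mult A \<cdot> pr ?X ?S (\<iota> B) = ?u" and Sr: "mult A \<cdot> pr ?X (\<iota> B) ?S = ?u"
    using conv_antipode_left[OF A idt] conv_antipode_right[OF A idt] by (simp_all add: conv_def)
  have cm: "comult A = pr ?X (\<iota> B) (\<iota> B)" using pr_idt[of ?X] by simp
  have 1: "n \<cdot> pr ?X (pr ?X ?S ?S) (comult A) = pr ?X ?u ?u"
    unfolding cm by (simp add: n_def cmp_assoc mid_pr tensor_pr Sl del: pr_idt)
  have nd: "n \<cdot> (comult A \<otimes> comult A) = comult A \<cdot> mult A"
    using ax by (simp add: n_def cmp_assoc)
  have "n \<cdot> pr ?X (comult A) ?x = (n \<cdot> (comult A \<otimes> comult A)) \<cdot> pr ?X (\<iota> B) ?S"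
    by (simp add: cmp_assoc tensor_pr)
  also have "\<dots> = comult A \<cdot> (mult A \<cdot> pr ?X (\<iota> B) ?S)"
    by (simp add: nd cmp_assoc)
  also have "\<dots> = pr ?X ?u ?u"
    using cmorD(6)[OF cmor_un[of ?X A]] by (simp add: Sr)
  finally have 2: "n \<cdot> pr ?X (comult A) ?x = pr ?X ?u ?u" .
  \<comment> \<open>Left unit law of \<open>n\<close>: the units are pulled through
    \<open>mid\<close>, the unit laws of A leave two unitors, and \<open>lunit_mid\<close> combines
    these into the unitor of the tensor square.\<close>
  have "n \<cdot> pr ?X (pr ?X ?u ?u) ?x = (mult A \<otimes> mult A) \<cdot> (mid B B B B \<cdot>
      (((unt A \<otimes> unt A) \<otimes> (\<iota> B \<otimes> \<iota> B)) \<cdot> ((\<lambda>\<^sup>i \<one> \<otimes> \<iota> (B \<boxtimes> B)) \<cdot> pr ?X (counit A) ?x)))"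
    by (simp add: un_un n_def cmp_assoc tensor_pr)
  also have "\<dots> = ((mult A \<cdot> (unt A \<otimes> \<iota> B)) \<otimes> (mult A \<cdot> (unt A \<otimes> \<iota> B))) \<cdot> (mid \<one> \<one> B B \<cdot>
      ((\<lambda>\<^sup>i \<one> \<otimes> \<iota> (B \<boxtimes> B)) \<cdot> pr ?X (counit A) ?x))"
    using mid_nat_ext[of "unt A" "unt A" "\<iota> B" "\<iota> B" B B B B "(\<lambda>\<^sup>i \<one> \<otimes> \<iota> (B \<boxtimes> B)) \<cdot> pr ?X (counit A) ?x"]
    by (simp add: interchange_ext)
  also have "\<dots> = (\<lambda>\<^sub>l B \<otimes> \<lambda>\<^sub>l B) \<cdot> (mid \<one> \<one> B B \<cdot> ((\<lambda>\<^sup>i \<one> \<otimes> \<iota> (B \<boxtimes> B)) \<cdot> pr ?X (counit A) ?x))"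
    using ax by simp
  also have "\<dots> = \<lambda>\<^sub>l (B \<boxtimes> B) \<cdot> ((\<lambda>\<^sub>l \<one> \<otimes> \<iota> (B \<boxtimes> B)) \<cdot> ((\<lambda>\<^sup>i \<one> \<otimes> \<iota> (B \<boxtimes> B)) \<cdot> pr ?X (counit A) ?x))"
    by (subst lunit_mid[symmetric]) (simp_all add: cmp_assoc)
  also have "\<dots> = ?x"
    using lunit_pr[of ?X ?x "B \<boxtimes> B"] by (simp add: interchange_ext)
  finally have 3: "n \<cdot> pr ?X (pr ?X ?u ?u) ?x = ?x" .
  have 4: "n \<cdot> pr ?X (pr ?X ?S ?S) (pr ?X ?u ?u) = pr ?X ?S ?S"
    using conv_un_right[of ?X A ?S] by (simp add: n_def cmp_assoc mid_pr tensor_pr conv_def)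
  have "n \<cdot> pr ?X (n \<cdot> pr ?X (pr ?X ?S ?S) (comult A)) ?x = n \<cdot> pr ?X (pr ?X ?S ?S) (n \<cdot> pr ?X (comult A) ?x)"
    using mult_tensor_assoc[OF A] by (intro mult_pr_assoc[where A="B \<boxtimes> B"]) (simp_all add: n_def)
  then have S: "?x = pr ?X ?S ?S" by (simp add: 1 2 3 4)
  \<comment> \<open>With eps the counit: eps(S x) = eps(S x_1) eps(x_2) = eps(S(x_1) x_2) =
    eps(x).\<close>
  have "counit A \<cdot> ?S = \<rho> \<one> \<cdot> pr ?X (counit A \<cdot> ?S) (counit A)"
    using runit_pr[of ?X "counit A \<cdot> ?S" \<one>] by simp
  also have "\<dots> = \<lambda>\<^sub>l \<one> \<cdot> ((counit A \<otimes> counit A) \<cdot> pr ?X ?S (\<iota> B))"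
    by (simp add: tensor_pr lunit_one)
  also have "\<dots> = (counit A \<cdot> mult A) \<cdot> pr ?X ?S (\<iota> B)"
    using ax by (simp add: cmp_assoc)
  also have "\<dots> = counit A"
    using cmorD(7)[OF cmor_un[of ?X A]] by (simp add: cmp_assoc Sl)
  finally show ?thesis using S by (simp add: cmor_def) (simp add: pr_def)
qed

lemma cmor_antipode_cmp [simp]: "\<lbrakk>hopf A; cmor X (com A) f\<rbrakk> \<Longrightarrow> cmor X (com A) (antipode A \<cdot> f)"
  by (rule cmor_cmp[OF _ cmor_antipode])

lemma conv_inverse_unique:
  assumes "hopf A" "coc X" and f: "arr f" "src f = cob X" "tgt f = hob A"
    and g: "arr g" "src g = cob X" "tgt g = hob A" and h: "arr h" "src h = cob X" "tgt h = hob A"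
    and "conv X A f g = un X A" "conv X A g h = un X A"
  shows "f = h"
proof -
  have "f = conv X A f (conv X A g h)" using assms by simp
  also have "\<dots> = conv X A (conv X A f g) h" using assms(1-11) by (simp add: conv_assoc)
  also have "\<dots> = h" using assms by simp
  finally show ?thesis .
qed

text \<open>Both sides are convolution inverses of \<open>antipode A \<cdot> f\<close>. For the left
  side this requires the latter to be a comonoid morphism, which is where cocommutativity
  enters.\<close>

lemma antipode_antipode:
  assumes [simp]: "hopf A" and f: "cmor X (com A) f"
  shows "antipode A \<cdot> (antipode A \<cdot> f) = f"
proof -
  note [simp] = cmorD(1-5)[OF f] f
  show ?thesis
    by (rule conv_inverse_unique[of A X "antipode A \<cdot> (antipode A \<cdot> f)" "antipode A \<cdot> f" f])
      (simp_all add: conv_antipode_left)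
qed

lemma antipode_conv:
  assumes [simp]: "hopf A" and f: "cmor X (com A) f" and g: "cmor X (com A) g"
  shows "antipode A \<cdot> conv X A f g = conv X A (antipode A \<cdot> g) (antipode A \<cdot> f)"
proof -
  note [simp] = cmorD(1-5)[OF f] cmorD(3-5)[OF g] f g
  have "conv X A (antipode A \<cdot> f) (conv X A f g) = g"
    using conv_assoc[of X A "antipode A \<cdot> f" f g] by (simp add: conv_antipode_left)
  then have l: "conv X A (conv X A (antipode A \<cdot> g) (antipode A \<cdot> f)) (conv X A f g) = un X A"
    by (simp add: conv_assoc conv_antipode_left)
  show ?thesis
    by (rule conv_inverse_unique[of A X _ "conv X A f g", symmetric])
      (simp_all add: l conv_antipode_right)
qed

lemma antipode_un:
  assumes [simp]: "hopf A" "coc X"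
  shows "antipode A \<cdot> un X A = un X A"
proof -
  have "un X A = conv X A (un X A) (antipode A \<cdot> un X A)"
    by (rule conv_antipode_right[symmetric]) simp_all
  then show ?thesis by simp
qed

lemma hmor_cmor:
  assumes "hopf A" "hopf B" "hmor A B f"
  shows "cmor (com A) (com B) f"
  using assms coc_com unfolding cmor_def hmor_def com_simps by blast

lemma hmor_conv:
  assumes [simp]: "hopf A" "hopf B" "coc X" and f: "hmor A B f"
    and [simp]: "arr g" "arr h" "src g = cob X" "src h = cob X" "tgt g = hob A" "tgt h = hob A"
  shows "f \<cdot> conv X A g h = conv X B (f \<cdot> g) (f \<cdot> h)"
proof -
  note [simp] = hmor_simps[OF _ _ f]
  show ?thesis
    using cmp_extend[OF hmor_mult[OF _ _ f], of "pr X g h"] by (simp add: conv_def cmp_assoc tensor_pr)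
qed

lemma hmor_un:
  assumes [simp]: "hopf A" "hopf B" "coc X" and f: "hmor A B f"
  shows "f \<cdot> un X A = un X B"
  using cmp_extend[OF hmor_unt[OF _ _ f], of "ce X"] hmor_simps[OF _ _ f] by (simp add: un_def)

lemma hmor_antipode_ext:
  assumes [simp]: "hopf A" "hopf B" and f: "hmor A B f" and [simp]: "arr g" "tgt g = hob A"
  shows "f \<cdot> (antipode A \<cdot> g) = antipode B \<cdot> (f \<cdot> g)"
proof -
  note [simp] = hmor_simps[OF _ _ f]
  show ?thesis
    using cmp_extend[OF hmor_antipode[OF _ _ f], of g] by (simp add: cmp_assoc)
qed


section \<open>Normal monomorphisms, quotients and kernels\<close>

lemma equalizerD:
  assumes "is_equalizer M A B f g E e"
  shows "arr e" "src e = E" "tgt e = A" "f \<cdot> e = g \<cdot> e" "mon e"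
    "\<And>t. \<lbrakk>arr t; tgt t = A; f \<cdot> t = g \<cdot> t\<rbrakk> \<Longrightarrow> \<exists>s. arr s \<and> src s = src t \<and> tgt s = E \<and> e \<cdot> s = t"
proof -
  have e: "arr f" "arr g" "src f = A" "src g = A" "tgt f = B" "tgt g = B"
    and e' [simp]: "arr e" "src e = E" "tgt e = A" and eq: "f \<cdot> e = g \<cdot> e"
    and u: "\<And>T t. \<lbrakk>arr t; src t = T; tgt t = A; f \<cdot> t = g \<cdot> t\<rbrakk> \<Longrightarrow> \<exists>!s. s \<in> Hom M T E \<and> e \<cdot> s = t"
    using assms unfolding is_equalizer_def by (auto simp: Hom_iff)
  show "arr e" "src e = E" "tgt e = A" "f \<cdot> e = g \<cdot> e" by (fact e' eq)+
  show "\<exists>s. arr s \<and> src s = src t \<and> tgt s = E \<and> e \<cdot> s = t"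
    if "arr t" "tgt t = A" "f \<cdot> t = g \<cdot> t" for t
    using u[OF that(1) refl that(2,3)] unfolding Hom_iff by auto
  show "mon e" unfolding mon_def
  proof (intro conjI allI impI)
    fix x y assume *: "arr x" "arr y" "tgt x = src e" "tgt y = src e" "src x = src y" "e \<cdot> x = e \<cdot> y"
    have "f \<cdot> (e \<cdot> x) = g \<cdot> (e \<cdot> x)"
      using cmp_extend[OF eq, of x] * e by (simp add: cmp_assoc)
    then have "\<exists>!s. s \<in> Hom M (src x) E \<and> e \<cdot> s = e \<cdot> x"
      using * by (intro u) simp_all
    then show "x = y" using * unfolding Hom_iff by auto
  qed simp
qed

lemma coequalizerD:
  assumes "is_coequalizer M A B f g Q q"
  shows "arr q" "src q = B" "tgt q = Q" "q \<cdot> f = q \<cdot> g" "epi q"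
    "\<And>t. \<lbrakk>arr t; src t = B; t \<cdot> f = t \<cdot> g\<rbrakk> \<Longrightarrow> \<exists>s. arr s \<and> src s = Q \<and> tgt s = tgt t \<and> s \<cdot> q = t"
proof -
  have e: "arr f" "arr g" "src f = A" "src g = A" "tgt f = B" "tgt g = B"
    and e' [simp]: "arr q" "src q = B" "tgt q = Q" and eq: "q \<cdot> f = q \<cdot> g"
    and u: "\<And>T t. \<lbrakk>arr t; src t = B; tgt t = T; t \<cdot> f = t \<cdot> g\<rbrakk> \<Longrightarrow> \<exists>!s. s \<in> Hom M Q T \<and> s \<cdot> q = t"
    using assms unfolding is_coequalizer_def by (auto simp: Hom_iff)
  show "arr q" "src q = B" "tgt q = Q" "q \<cdot> f = q \<cdot> g" by (fact e' eq)+
  show "\<exists>s. arr s \<and> src s = Q \<and> tgt s = tgt t \<and> s \<cdot> q = t"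
    if "arr t" "src t = B" "t \<cdot> f = t \<cdot> g" for t
    using u[OF that(1,2) refl that(3)] unfolding Hom_iff by auto
  show "epi q" unfolding epi_def
  proof (intro conjI allI impI)
    fix x y assume *: "arr x" "arr y" "src x = tgt q" "src y = tgt q" "tgt x = tgt y" "x \<cdot> q = y \<cdot> q"
    have "(x \<cdot> q) \<cdot> f = (x \<cdot> q) \<cdot> g"
      using * e eq by (simp add: cmp_assoc)
    then have "\<exists>!s. s \<in> Hom M Q (tgt x) \<and> s \<cdot> q = x \<cdot> q"
      using * by (intro u) simp_all
    then show "x = y" using * unfolding Hom_iff by auto
  qed simp
qed

text \<open>The tensor product is assumed to preserve equalizer diagrams, while a bare monomorphism
  might not stay one; regularity is the property that survives tensoring.\<close>

definition reg_mono :: "'m \<Rightarrow> bool" where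
  "reg_mono e \<longleftrightarrow> (\<exists>A B f g E. is_equalizer M A B f g E e)"

definition reg_epi :: "'m \<Rightarrow> bool" where
  "reg_epi q \<longleftrightarrow> (\<exists>A B f g Q. is_coequalizer M A B f g Q q)"

lemma reg_mono_mon: "reg_mono e \<Longrightarrow> mon e"
  unfolding reg_mono_def using equalizerD(5) by blast

lemma reg_epi_epi: "reg_epi q \<Longrightarrow> epi q"
  unfolding reg_epi_def using coequalizerD(5) by blast

lemma reg_mono_tensor:
  assumes "equalizers_preserved M" "reg_mono e" "X \<in> Ob M"
  shows "reg_mono (\<iota> X \<otimes> e)" "reg_mono (e \<otimes> \<iota> X)"
  using assms unfolding reg_mono_def equalizers_preserved_def by blast+

lemma reg_epi_tensor:
  assumes "coequalizers_preserved M" "reg_epi q" "X \<in> Ob M"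
  shows "reg_epi (\<iota> X \<otimes> q)" "reg_epi (q \<otimes> \<iota> X)"
  using assms unfolding reg_epi_def coequalizers_preserved_def by blast+

text \<open>A tensor power of \<open>e\<close> is a composite of arrows that apply \<open>e\<close>
  in one factor. Each of these is a regular monomorphism, and monomorphisms compose.\<close>

lemma reg_mono_powers:
  assumes p: "equalizers_preserved M" and e: "reg_mono e"
  shows "mon e" "mon (e \<otimes> e)" "mon (e \<otimes> (e \<otimes> e))"
proof -
  show m: "mon e" by (rule reg_mono_mon[OF e])
  then have [simp]: "arr e" by (simp add: mon_def)
  note T = reg_mono_tensor[OF p]
  have "mon ((\<iota> (tgt e) \<otimes> e) \<cdot> (e \<otimes> \<iota> (src e)))"
    by (rule mon_cmp) (simp_all add: T e reg_mono_mon)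
  then show "mon (e \<otimes> e)" by (simp add: interchange)
  have "mon ((\<iota> (tgt e) \<otimes> (\<iota> (tgt e) \<otimes> e)) \<cdot> ((\<iota> (tgt e) \<otimes> (e \<otimes> \<iota> (src e))) \<cdot> (e \<otimes> \<iota> (src e \<boxtimes> src e))))"
    by (intro mon_cmp) (simp_all add: T e reg_mono_mon del: idt_tensor)
  then show "mon (e \<otimes> (e \<otimes> e))" by (simp add: interchange)
qed

lemma reg_epi_powers:
  assumes p: "coequalizers_preserved M" and e: "reg_epi e"
  shows "epi e" "epi (e \<otimes> e)" "epi ((e \<otimes> e) \<otimes> e)"
proof -
  show m: "epi e" by (rule reg_epi_epi[OF e])
  then have [simp]: "arr e" by (simp add: epi_def)
  note T = reg_epi_tensor[OF p]
  have "epi ((\<iota> (tgt e) \<otimes> e) \<cdot> (e \<otimes> \<iota> (src e)))"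
    by (rule epi_cmp) (simp_all add: T e reg_epi_epi)
  then show "epi (e \<otimes> e)" by (simp add: interchange)
  have "epi (((e \<otimes> \<iota> (tgt e)) \<otimes> \<iota> (tgt e)) \<cdot> (((\<iota> (src e) \<otimes> e) \<otimes> \<iota> (tgt e)) \<cdot> (\<iota> (src e \<boxtimes> src e) \<otimes> e)))"
    by (intro epi_cmp) (simp_all add: T e reg_epi_epi del: idt_tensor)
  then show "epi ((e \<otimes> e) \<otimes> e)" by (simp add: interchange)
qed

text \<open>Provides the comonoid structure of a subobject ahead of its Hopf structure: its
  multiplication will be found by means of generic elements, whose domain has to be a cocommutative
  comonoid.\<close>

lemma coc_ascend:
  assumes X [simp]: "coc X" and [simp]: "arr e" "tgt e = cob X" "src e = E" "arr d" "src d = E" "tgt d = E \<boxtimes> E"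
    and d: "(e \<otimes> e) \<cdot> d = cd X \<cdot> e" and m: "mon e" "mon (e \<otimes> e)" "mon (e \<otimes> (e \<otimes> e))"
  shows "coc \<lparr>cob = E, cd = d, ce = ce X \<cdot> e\<rparr>"
proof -
  have [simp]: "E \<in> Ob M" using src_Ob[of e] by simp
  have dl: "(((e \<otimes> e) \<cdot> d) \<otimes> e) \<cdot> d = (cd X \<otimes> \<iota> (cob X)) \<cdot> (cd X \<cdot> e)"
    by (simp add: interchange_ext flip: d)
  have dr: "(e \<otimes> ((e \<otimes> e) \<cdot> d)) \<cdot> d = (\<iota> (cob X) \<otimes> cd X) \<cdot> (cd X \<cdot> e)"
    by (simp add: interchange_ext flip: d)
  have "(e \<otimes> (e \<otimes> e)) \<cdot> (\<alpha> E E E \<cdot> ((d \<otimes> \<iota> E) \<cdot> d))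
    = \<alpha> (cob X) (cob X) (cob X) \<cdot> (((e \<otimes> e) \<otimes> e) \<cdot> ((d \<otimes> \<iota> E) \<cdot> d))"
    using assoc_nat_ext[of e e e "cob X" "cob X" "cob X" "(d \<otimes> \<iota> E) \<cdot> d"] by simp
  also have "\<dots> = \<alpha> (cob X) (cob X) (cob X) \<cdot> ((((e \<otimes> e) \<cdot> d) \<otimes> e) \<cdot> d)"
    by (simp add: interchange_ext)
  also have "\<dots> = (e \<otimes> ((e \<otimes> e) \<cdot> d)) \<cdot> d"
    unfolding dl dr using cmp_extend[OF assoc_cd[OF X], of e] by (simp add: cmp_assoc)
  also have "\<dots> = (e \<otimes> (e \<otimes> e)) \<cdot> ((\<iota> E \<otimes> d) \<cdot> d)"
    by (simp add: interchange_ext)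
  finally have 1: "\<alpha> E E E \<cdot> ((d \<otimes> \<iota> E) \<cdot> d) = (\<iota> E \<otimes> d) \<cdot> d"
    by (rule monD[OF m(3)]) simp_all
  have "(e \<otimes> e) \<cdot> (\<sigma> E E \<cdot> d) = \<sigma> (cob X) (cob X) \<cdot> ((e \<otimes> e) \<cdot> d)"
    using braid_nat_ext[of e e "cob X" "cob X" d] by simp
  also have "\<dots> = (e \<otimes> e) \<cdot> d"
    unfolding d using cmp_extend[OF braid_cd[OF X], of e] by simp
  finally have 2: "\<sigma> E E \<cdot> d = d"
    by (rule monD[OF m(2)]) simp_all
  have "e \<cdot> (\<lambda>\<^sub>l E \<cdot> (((ce X \<cdot> e) \<otimes> \<iota> E) \<cdot> d)) = \<lambda>\<^sub>l (cob X) \<cdot> ((ce X \<otimes> \<iota> (cob X)) \<cdot> ((e \<otimes> e) \<cdot> d))"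
    using lunit_nat_ext[of e "cob X" "((ce X \<cdot> e) \<otimes> \<iota> E) \<cdot> d"] by (simp add: interchange_ext)
  also have "\<dots> = e \<cdot> \<iota> E"
    unfolding d using cmp_extend[OF lunit_cd[OF X], of e] by (simp add: cmp_assoc)
  finally have 3: "\<lambda>\<^sub>l E \<cdot> (((ce X \<cdot> e) \<otimes> \<iota> E) \<cdot> d) = \<iota> E"
    by (rule monD[OF m(1)]) simp_all
  have 4: "\<rho> E \<cdot> ((\<iota> E \<otimes> (ce X \<cdot> e)) \<cdot> d) = \<iota> E"
    by (rule runit_from_lunit[OF _ _ _ _ _ _ _ 2 3]) simp_all
  show ?thesis
    unfolding coc_def is_comonoid_def Hom_iff using 1 2 3 4 by (simp add: cmp_assoc)
qed

text \<open>On elements \<open>ad\<close> is conjugation: the comultiplication copies x, and the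
  braiding carries the inverted copy past y.\<close>

lemma ad_pr:
  assumes [simp]: "hopf A" "coc T" and x: "cmor T (com A) x" and [simp]: "arr y" "src y = cob T" "tgt y = hob A"
  shows "ad M A \<cdot> pr T x y = conv T A (conv T A x y) (antipode A \<cdot> x)"
proof -
  note [simp] = cmorD(1-5)[OF x]
  have [simp]: "comult A \<cdot> x = pr T x x" using cmorD(6)[OF x] by simp
  show ?thesis
    by (simp add: ad_def Let_def cmp_assoc tensor_pr assoc_pr associ_pr braid_pr conv_def)
qed

text \<open>Compatibility with the structure maps is inherited from \<open>i \<cdot> s\<close> by
  cancelling \<open>i\<close>, or \<open>i \<otimes> i\<close> in the case of the
  comultiplication.\<close>

lemma hmor_lift:
  assumes [simp]: "hopf T" "hopf K" "hopf A" and i: "hmor K A i" and t: "hmor T A (i \<cdot> s)"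
    and [simp]: "arr s" "src s = hob T" "tgt s = hob K" and m: "mon i" "mon (i \<otimes> i)"
  shows "hmor T K s"
proof -
  note [simp] = hmor_simps[OF _ _ i]
  have "i \<cdot> (s \<cdot> mult T) = (i \<cdot> s) \<cdot> mult T" by (simp add: cmp_assoc)
  also have "\<dots> = mult A \<cdot> ((i \<otimes> i) \<cdot> (s \<otimes> s))" by (simp add: hmor_mult[OF _ _ t] interchange)
  also have "\<dots> = i \<cdot> (mult K \<cdot> (s \<otimes> s))"
    by (simp add: cmp_extend[OF hmor_mult[OF _ _ i]] cmp_assoc)
  finally have 1: "s \<cdot> mult T = mult K \<cdot> (s \<otimes> s)" by (rule monD[OF m(1)]) simp_all
  have "i \<cdot> (s \<cdot> unt T) = (i \<cdot> s) \<cdot> unt T" by (simp add: cmp_assoc)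
  also have "\<dots> = i \<cdot> unt K" by (simp only: hmor_unt[OF hopf_hdata hopf_hdata t] hmor_unt[OF hopf_hdata hopf_hdata i] assms(1-3))
  finally have 2: "s \<cdot> unt T = unt K" by (rule monD[OF m(1)]) simp_all
  have "(i \<otimes> i) \<cdot> (comult K \<cdot> s) = ((i \<otimes> i) \<cdot> comult K) \<cdot> s" by (simp add: cmp_assoc)
  also have "\<dots> = comult A \<cdot> (i \<cdot> s)" by (simp add: hmor_comult[OF _ _ i, symmetric] cmp_assoc)
  also have "\<dots> = (i \<otimes> i) \<cdot> ((s \<otimes> s) \<cdot> comult T)" by (simp add: hmor_comult[OF _ _ t] interchange_ext)
  finally have 3: "comult K \<cdot> s = (s \<otimes> s) \<cdot> comult T" by (rule monD[OF m(2)]) simp_all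
  have "counit K \<cdot> s = counit A \<cdot> (i \<cdot> s)"
    by (rule cmp_extend[OF hmor_counit[OF _ _ i], symmetric]) simp_all
  also have "\<dots> = counit T" by (rule hmor_counit[OF _ _ t]) simp_all
  finally have 4: "counit K \<cdot> s = counit T" .
  have "i \<cdot> (s \<cdot> antipode T) = (i \<cdot> s) \<cdot> antipode T" by (simp add: cmp_assoc)
  also have "\<dots> = (antipode A \<cdot> i) \<cdot> s" 
    using hmor_antipode[OF _ _ t] by (simp add: cmp_assoc)
  also have "\<dots> = i \<cdot> (antipode K \<cdot> s)" by (simp add: hmor_antipode[OF _ _ i, symmetric] cmp_assoc)
  finally have 5: "s \<cdot> antipode T = antipode K \<cdot> s" by (rule monD[OF m(1)]) simp_all
  show ?thesis using 1 2 3 4 5 by (simp add: hmor_def)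
qed

lemma Cmp_Hopf_coc: "Cmp (Hopf_coc M) g f = g \<cdot> f"
  by (simp add: Hopf_coc_def)

section \<open>Kernels are normal\<close>

lemma kernel_conjugation:
  assumes ex: "has_equalizers M" and pres: "equalizers_preserved M"
    and k: "is_kernel M K A i"
  shows "\<exists>\<psi> \<in> Hom M (hob A \<boxtimes> hob K) (hob K). i \<cdot> \<psi> = ad M A \<cdot> (\<iota> (hob A) \<otimes> i)"
proof -
  obtain B f where f0: "f \<in> Hom (Hopf_coc M) A B"
    and eq: "is_equalizer (Hopf_coc M) A B f (unt B \<cdot> counit A) K i"
    using k unfolding is_kernel_def by blast
  have A [simp]: "hopf A" and B [simp]: "hopf B" and f: "hmor A B f"
    using f0 unfolding Hom_Hopf_coc by blast+
  have K [simp]: "hopf K" and i: "hmor K A i" and fi: "f \<cdot> i = (unt B \<cdot> counit A) \<cdot> i"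
    and univ: "\<And>T t. \<lbrakk>hopf T; hmor T A t; f \<cdot> t = (unt B \<cdot> counit A) \<cdot> t\<rbrakk> \<Longrightarrow> \<exists>s. hmor T K s \<and> i \<cdot> s = t"
    using eq A unfolding is_equalizer_def Ball_def Hom_Hopf_coc Cmp_Hopf_coc by blast+
  note [simp] = hmor_simps[OF _ _ f] hmor_simps[OF _ _ i]
  let ?X = "com A"
  let ?z = "un ?X B"
  \<comment> \<open>The maps a -> a_1 (x) f(a_2) and a -> a_1 (x) 1, whose equalizer is the usual
    Hopf kernel. Keeping the component a_1 is what lets the comultiplication restrict to the
    equalizer.\<close>
  let ?F = "pr ?X (\<iota> (hob A)) f" and ?G = "pr ?X (\<iota> (hob A)) ?z"
  have z: "?z = unt B \<cdot> counit A" by (simp add: un_def)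
  have "?F \<in> Hom M (hob A) (hob A \<boxtimes> hob B)" "?G \<in> Hom M (hob A) (hob A \<boxtimes> hob B)"
    by (simp_all add: Hom_iff)
  then obtain E e where E: "is_equalizer M (hob A) (hob A \<boxtimes> hob B) ?F ?G E e"
    using ex unfolding has_equalizers_def by blast
  note [simp] = equalizerD(1-3)[OF E]
  have re: "reg_mono e" unfolding reg_mono_def using E by blast
  note me = reg_mono_powers[OF pres re]
  have [simp]: "E \<in> Ob M" using src_Ob[of e] by simp
  \<comment> \<open>After a comonoid morphism \<open>t\<close> the two maps read t(x_1) (x)
    f(t(x_2)) and t(x_1) (x) 1, so triviality of \<open>f \<cdot> t\<close> is enough for a
    factorization through \<open>e\<close>.\<close>
  have factor: "\<exists>s. arr s \<and> src s = cob T \<and> tgt s = E \<and> e \<cdot> s = t"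
    if t: "cmor T ?X t" "f \<cdot> t = un T B" for T t
  proof -
    note [simp] = cmorD(1-5)[OF t(1)]
    have "?F \<cdot> t = ?G \<cdot> t"
      using t by (simp add: pr_cmor[OF t(1)] un_cmor[OF B t(1)])
    then show ?thesis using equalizerD(6)[OF E, of t] by simp
  qed
  \<comment> \<open>By coassociativity, a_1 (x) a_2 (x) h(a_3) is a_1 (x) h(a_2) with its first
    component copied. Hence the equation that defines E also holds for the second component of the
    comultiplication.\<close>
  have shift: "pr ?X (\<iota> (hob A)) (pr ?X (\<iota> (hob A)) h) \<cdot> e = \<alpha> (hob A) (hob A) (hob B) \<cdot>
      ((pr ?X (\<iota> (hob A)) (\<iota> (hob A)) \<otimes> \<iota> (hob B)) \<cdot> (pr ?X (\<iota> (hob A)) h \<cdot> e))"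
    if [simp]: "arr h" "src h = hob A" "tgt h = hob B" for h
    by (simp add: cmp_extend[OF tensor_pr] cmp_extend[OF assoc_pr])
  have Fe: "?F \<cdot> e = ?G \<cdot> e" by (rule equalizerD(4)[OF E])
  have pFe: "pr ?X (\<iota> (hob A)) ?F \<cdot> e = pr ?X (\<iota> (hob A)) ?G \<cdot> e"
    by (simp add: shift Fe)
  \<comment> \<open>Lifts the second component of the comultiplication to E, since
    \<open>\<iota> (hob A) \<otimes> e\<close> is still an equalizer.\<close>
  obtain x where x [simp]: "arr x" "src x = E" "tgt x = hob A \<boxtimes> E" and ex: "(\<iota> (hob A) \<otimes> e) \<cdot> x = comult A \<cdot> e"
  proof -
    have "is_equalizer M (hob A \<boxtimes> hob A) (hob A \<boxtimes> hob A \<boxtimes> hob B) (\<iota> (hob A) \<otimes> ?F) (\<iota> (hob A) \<otimes> ?G)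
        (hob A \<boxtimes> E) (\<iota> (hob A) \<otimes> e)"
      using E pres unfolding equalizers_preserved_def by (metis A hob_Ob hopf_hdata)
    from equalizerD(6)[OF this, of "comult A \<cdot> e"] show ?thesis
      using pFe that by (auto simp: pr_def cmp_assoc)
  qed
  \<comment> \<open>The first component is lifted next. Cocommutativity (\<open>swap\<close>)
    reduces its equation to \<open>pFe\<close>, after composing with a tensor multiple of
    \<open>e\<close> that is a monomorphism.\<close>
  obtain d where d [simp]: "arr d" "src d = E" "tgt d = E \<boxtimes> E" and ed': "(e \<otimes> \<iota> E) \<cdot> d = x"
  proof -
    have eq: "is_equalizer M (hob A \<boxtimes> E) ((hob A \<boxtimes> hob B) \<boxtimes> E) (?F \<otimes> \<iota> E) (?G \<otimes> \<iota> E) (E \<boxtimes> E) (e \<otimes> \<iota> E)"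
      using E pres \<open>E \<in> Ob M\<close> unfolding equalizers_preserved_def by metis
    have swap: "(h \<otimes> \<iota> (hob A)) \<cdot> (comult A \<cdot> e) = \<sigma> (hob A) (hob A \<boxtimes> hob B) \<cdot> (pr ?X (\<iota> (hob A)) h \<cdot> e)"
      if [simp]: "arr h" "src h = hob A" "tgt h = hob A \<boxtimes> hob B" for h
      by (simp add: cmp_extend[OF braid_pr]) (simp add: pr_def cmp_assoc)
    have "(\<iota> (hob A \<boxtimes> hob B) \<otimes> e) \<cdot> ((?F \<otimes> \<iota> E) \<cdot> x) = (?F \<otimes> \<iota> (hob A)) \<cdot> ((\<iota> (hob A) \<otimes> e) \<cdot> x)"
      by (simp add: interchange_ext)
    also have "\<dots> = (?G \<otimes> \<iota> (hob A)) \<cdot> ((\<iota> (hob A) \<otimes> e) \<cdot> x)"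
      unfolding ex by (simp add: swap pFe)
    also have "\<dots> = (\<iota> (hob A \<boxtimes> hob B) \<otimes> e) \<cdot> ((?G \<otimes> \<iota> E) \<cdot> x)"
      by (simp add: interchange_ext)
    finally have "(?F \<otimes> \<iota> E) \<cdot> x = (?G \<otimes> \<iota> E) \<cdot> x"
      by (rule monD[OF reg_mono_mon[OF reg_mono_tensor(1)[OF pres re]], rotated]) simp_all
    from equalizerD(6)[OF eq _ _ this] show ?thesis using that by auto
  qed
  have ed: "(e \<otimes> e) \<cdot> d = comult A \<cdot> e"
  proof -
    have "(e \<otimes> e) \<cdot> d = (\<iota> (hob A) \<otimes> e) \<cdot> ((e \<otimes> \<iota> E) \<cdot> d)" by (simp add: interchange_ext)
    then show ?thesis by (simp add: ed' ex)
  qed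
  define Y where "Y = \<lparr>cob = E, cd = d, ce = counit A \<cdot> e\<rparr>"
  have Y [simp]: "cob Y = E" "cd Y = d" "ce Y = counit A \<cdot> e" by (simp_all add: Y_def)
  have cY [simp]: "coc Y"
    using coc_ascend[of ?X e E d] ed me by (simp add: Y_def)
  have ce: "cmor Y ?X e" by (simp add: cmor_def ed)
  \<comment> \<open>Applying the counit to the retained component of
    \<open>?F \<cdot> e = ?G \<cdot> e\<close> leaves the equation for \<open>f\<close>
    alone.\<close>
  have fe: "f \<cdot> e = un Y B"
  proof -
    have "f \<cdot> e = \<lambda>\<^sub>l (hob B) \<cdot> ((counit A \<otimes> \<iota> (hob B)) \<cdot> (?F \<cdot> e))"
      using lunit_pr[of Y "f \<cdot> e" "hob B"] by (simp add: pr_cmor[OF ce] tensor_pr)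
    also have "\<dots> = un Y B"
      using lunit_pr[of Y "un Y B" "hob B"] unfolding Fe by (simp add: pr_cmor[OF ce] un_cmor[OF B ce] tensor_pr)
    finally show ?thesis .
  qed
  have fx: "f \<cdot> (e \<cdot> t) = un T B" if "cmor T Y t" for T t
    using cmp_extend[OF fe, of t] cmorD[OF that] un_cmor[OF B that] by simp
  let ?T = "ctens Y Y"
  have ee: "cmor ?T ?X (e \<cdot> prj1 Y Y)" "cmor ?T ?X (e \<cdot> prj2 Y Y)"
    by (rule cmor_cmp[OF cmor_prj1 ce] cmor_cmp[OF cmor_prj2 ce]; simp)+
  obtain mE where mE [simp]: "arr mE" "src mE = E \<boxtimes> E" "tgt mE = E" and emE: "e \<cdot> mE = mult A \<cdot> (e \<otimes> e)"
  proof -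
    have "f \<cdot> conv ?T A (e \<cdot> prj1 Y Y) (e \<cdot> prj2 Y Y) = un ?T B"
      by (simp add: hmor_conv[OF A B _ f] fx[OF cmor_prj1[OF cY cY]] fx[OF cmor_prj2[OF cY cY]])
    from factor[OF cmor_conv[OF A ee] this] show ?thesis
      using that tensor_eq_pr[of Y Y e e] by (auto simp: conv_def)
  qed
  \<comment> \<open>The domain is the unit object itself, so the defining equation of E is verified
    directly instead of through \<open>factor\<close>.\<close>
  obtain uE where uE [simp]: "arr uE" "src uE = \<one>" "tgt uE = E" and euE: "e \<cdot> uE = unt A"
  proof -
    note ax = hopf_iff[OF hopf_hdata[OF A], THEN iffD1, OF A]
    have "?F \<cdot> unt A = ?G \<cdot> unt A"
      using ax by (simp add: pr_def cmp_assoc interchange_ext hmor_unt[OF _ _ f] un_def)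
    from equalizerD(6)[OF E _ _ this] show ?thesis using that by auto
  qed
  obtain SE where SE [simp]: "arr SE" "src SE = E" "tgt SE = E" and eSE: "e \<cdot> SE = antipode A \<cdot> e"
  proof -
    have "f \<cdot> (antipode A \<cdot> e) = un Y B"
      by (simp add: hmor_antipode_ext[OF A B f] fe antipode_un)
    from factor[OF cmor_antipode_cmp[OF A ce] this] show ?thesis using that by auto
  qed
  define H where "H = \<lparr>hob = E, mult = mE, unt = uE, comult = d, counit = counit A \<cdot> e, antipode = SE\<rparr>"
  have hd: "hdata H" unfolding hdata_def H_def by (simp add: Hom_iff)
  have eH: "hmor H A e" unfolding hmor_def H_def by (simp add: emE euE ed eSE)
  have H: "hopf H" by (rule hopf_ascend[OF hd A eH me])
  have "f \<cdot> e = (unt B \<cdot> counit A) \<cdot> e" unfolding fe by (simp add: un_def cmp_assoc)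
  from univ[OF H eH this] obtain j where j: "hmor H K j" "i \<cdot> j = e" by blast
  have [simp]: "arr j" "src j = E" "tgt j = hob K"
    using hmor_simps[OF hd hopf_hdata[OF K] j(1)] by (simp_all add: H_def)
  let ?S = "ctens ?X (com K)"
  have ci: "cmor ?S ?X (i \<cdot> prj2 ?X (com K))"
    by (rule cmor_cmp[OF cmor_prj2 hmor_cmor[OF K A i]]) simp_all
  have c1: "cmor ?S ?X (prj1 ?X (com K))" by (rule cmor_prj1) simp_all
  have fi2: "f \<cdot> (i \<cdot> prj2 ?X (com K)) = un ?S B"
  proof -
    have "f \<cdot> (i \<cdot> prj2 ?X (com K)) = ?z \<cdot> (i \<cdot> prj2 ?X (com K))"
      using cmp_extend[OF fi[folded z], of "prj2 ?X (com K)"] by (simp add: cmp_assoc)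
    then show ?thesis using un_cmor[OF B ci] by simp
  qed
  have t: "ad M A \<cdot> (\<iota> (hob A) \<otimes> i) = conv ?S A (conv ?S A (prj1 ?X (com K)) (i \<cdot> prj2 ?X (com K))) (antipode A \<cdot> prj1 ?X (com K))"
    by (simp add: tensor_eq_pr[of ?X "com K"] ad_pr c1)
  have "f \<cdot> (ad M A \<cdot> (\<iota> (hob A) \<otimes> i)) = un ?S B"
    unfolding t using conv_antipode_right[OF B cmor_cmp[OF c1 hmor_cmor[OF A B f]]]
    by (simp add: hmor_conv[OF A B _ f] fi2 hmor_antipode_ext[OF A B f])
  moreover have "cmor ?S ?X (ad M A \<cdot> (\<iota> (hob A) \<otimes> i))"
    unfolding t using ci c1 by simp
  ultimately obtain c where c: "arr c" "src c = cob ?S" "tgt c = E" "e \<cdot> c = ad M A \<cdot> (\<iota> (hob A) \<otimes> i)"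
    using factor by blast
  have "i \<cdot> (j \<cdot> c) = ad M A \<cdot> (\<iota> (hob A) \<otimes> i)"
    using cmp_extend[OF j(2), of c] c by simp
  then show ?thesis using c by (intro bexI[of _ "j \<cdot> c"]) (simp_all add: Hom_iff)
qed


section \<open>Quotients by normal monomorphisms\<close>

context
  fixes K A i p Q
  assumes K [simp]: "hopf K" and A [simp]: "hopf A" and i: "hmor K A i" and quot: "is_quotient M K A i Q p"
begin

lemma quotient_coequalizer:
  "is_coequalizer M (hob A \<boxtimes> hob K) (hob A)
     (conv (ctens (com A) (com K)) A (prj1 (com A) (com K)) (i \<cdot> prj2 (com A) (com K))) (prj1 (com A) (com K)) Q p"
  using quot tensor_eq_pr[of "com A" "com K" "\<iota> (hob A)" i] hmor_simps[OF _ _ i]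
  unfolding is_quotient_def by (simp add: conv_def prj1_def[symmetric]) (simp add: prj1_def)

lemmas quotient_arr = coequalizerD(1-3,5)[OF quotient_coequalizer]

text \<open>The form is dictated by its use: \<open>\<chi>\<close> will be a conjugate obtained from
  the normality witness, about which counitality can be checked but comultiplicativity is not at
  hand.\<close>

lemma quotient_conv:
  assumes [simp]: "coc T" "arr \<phi>" "src \<phi> = cob T" "tgt \<phi> = hob A" "arr \<chi>" "src \<chi> = cob T" "tgt \<chi> = hob K"
    and \<chi>: "counit K \<cdot> \<chi> = ce T"
  shows "p \<cdot> conv T A \<phi> (i \<cdot> \<chi>) = p \<cdot> \<phi>"
proof -
  note [simp] = hmor_simps[OF _ _ i] quotient_arr(1-3)
  have q: "p \<cdot> (mult A \<cdot> (\<iota> (hob A) \<otimes> i)) = p \<cdot> (\<rho> (hob A) \<cdot> (\<iota> (hob A) \<otimes> counit K))"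
    using coequalizerD(4)[OF quot[unfolded is_quotient_def]] .
  have "p \<cdot> conv T A \<phi> (i \<cdot> \<chi>) = (p \<cdot> (mult A \<cdot> (\<iota> (hob A) \<otimes> i))) \<cdot> pr T \<phi> \<chi>"
    by (simp add: conv_def cmp_assoc tensor_pr)
  also have "\<dots> = p \<cdot> \<phi>"
    unfolding q by (simp add: cmp_assoc tensor_pr \<chi> runit_pr)
  finally show ?thesis .
qed

lemma quotient_i: "p \<cdot> i = p \<cdot> un (com K) A"
  using quotient_conv[of "com K" "un (com K) A" "\<iota> (hob K)"] hmor_simps[OF _ _ i] by simp

lemma normal_quotient:
  assumes pres: "coequalizers_preserved M"
    and psi: "\<psi> \<in> Hom M (hob A \<boxtimes> hob K) (hob K)" "i \<cdot> \<psi> = ad M A \<cdot> (\<iota> (hob A) \<otimes> i)"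
  shows "\<exists>H. hob H = Q \<and> hopf H \<and> hmor A H p"
proof -
  let ?X = "com A" and ?Y = "com K"
  let ?T = "ctens ?X ?Y"
  let ?a = "prj1 ?X ?Y" and ?k = "prj2 ?X ?Y"
  let ?l = "conv ?T A ?a (i \<cdot> ?k)"
  note [simp] = hmor_simps[OF _ _ i] quotient_arr(1-3)
  have [simp]: "arr \<psi>" "src \<psi> = hob A \<boxtimes> hob K" "tgt \<psi> = hob K" using psi(1) by (simp_all add: Hom_iff)
  have [simp]: "Q \<in> Ob M" using tgt_Ob[OF quotient_arr(1)] by simp
  have ci: "cmor ?Y ?X i" by (rule hmor_cmor[OF K A i])
  have cc [simp]: "cmor ?T ?X ?a" "cmor ?T ?Y ?k" by (simp_all add: cmor_prj1 cmor_prj2)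
  have cik [simp]: "cmor T ?X (i \<cdot> y)" if "cmor T ?Y y" for T y by (rule cmor_cmp[OF that ci])
  have cl [simp]: "cmor ?T ?X ?l" by simp
  note [simp] = cmorD(3-5)[OF cl]
  \<comment> \<open>The witness \<open>\<psi>\<close> places the conjugate in K. Its counit is
    computed in A, through \<open>i\<close>, where the conjugate is a product of comonoid
    morphisms.\<close>
  have conj: "\<exists>\<chi>. arr \<chi> \<and> src \<chi> = cob T \<and> tgt \<chi> = hob K \<and> counit K \<cdot> \<chi> = ce T \<and>
      i \<cdot> \<chi> = conv T A (conv T A x (i \<cdot> y)) (antipode A \<cdot> x)"
    if x: "cmor T ?X x" and y: "cmor T ?Y y" for T x y
  proof (intro exI conjI)
    note [simp] = cmorD(1-5)[OF x] cmorD(3-5)[OF y] x y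
    have "i \<cdot> (\<psi> \<cdot> pr T x y) = ad M A \<cdot> pr T x (i \<cdot> y)"
      using cmp_extend[OF psi(2), of "pr T x y"] by (simp add: cmp_assoc tensor_pr ad_def Let_def)
    then show e: "i \<cdot> (\<psi> \<cdot> pr T x y) = conv T A (conv T A x (i \<cdot> y)) (antipode A \<cdot> x)"
      by (simp add: ad_pr)
    have "counit K \<cdot> (\<psi> \<cdot> pr T x y) = counit A \<cdot> (i \<cdot> (\<psi> \<cdot> pr T x y))"
      by (rule cmp_extend[OF hmor_counit[OF _ _ i], symmetric]) simp_all
    also have "\<dots> = ce T" unfolding e
      using cmorD(7)[of T ?X "conv T A (conv T A x (i \<cdot> y)) (antipode A \<cdot> x)"] by simp
    finally show "counit K \<cdot> (\<psi> \<cdot> pr T x y) = ce T" .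
  qed (simp_all add: cmorD[OF x] cmorD[OF y])
  have conj_quot: "p \<cdot> conv T A \<phi> (conv T A (conv T A x (i \<cdot> y)) (antipode A \<cdot> x)) = p \<cdot> \<phi>"
    if x: "cmor T ?X x" and y: "cmor T ?Y y" and \<phi>: "arr \<phi>" "src \<phi> = cob T" "tgt \<phi> = hob A" for T x y \<phi>
  proof -
    obtain \<chi> where "arr \<chi>" "src \<chi> = cob T" "tgt \<chi> = hob K" "counit K \<cdot> \<chi> = ce T"
      "i \<cdot> \<chi> = conv T A (conv T A x (i \<cdot> y)) (antipode A \<cdot> x)"
      using conj[OF x y] by blast
    then show ?thesis using quotient_conv[of T \<phi> \<chi>] \<phi> cmorD(1)[OF x] by simp
  qed
  have pl: "p \<cdot> ?l = p \<cdot> ?a" by (rule coequalizerD(4)[OF quotient_coequalizer])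
  note univ = coequalizerD(6)[OF quotient_coequalizer]
  \<comment> \<open>Since \<open>?l\<close> is a comonoid morphism, the comultiplication turns it
    into two copies of itself, and \<open>p\<close> identifies each copy with
    \<open>?a\<close>.\<close>
  obtain d where d [simp]: "arr d" "src d = Q" "tgt d = Q \<boxtimes> Q" and dp: "d \<cdot> p = (p \<otimes> p) \<cdot> comult A"
  proof -
    have "((p \<otimes> p) \<cdot> comult A) \<cdot> ?l = ((p \<otimes> p) \<cdot> comult A) \<cdot> ?a"
      using cmorD(6)[OF cl] cmorD(6)[OF cc(1)] by (simp add: cmp_assoc tensor_pr pl)
    from univ[OF _ _ this] show ?thesis using that by auto
  qed
  obtain \<epsilon> where eps [simp]: "arr \<epsilon>" "src \<epsilon> = Q" "tgt \<epsilon> = \<one>" and epsp: "\<epsilon> \<cdot> p = counit A"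
  proof -
    have "counit A \<cdot> ?l = counit A \<cdot> ?a"
      using cmorD(7)[OF cl] cmorD(7)[OF cc(1)] by simp
    from univ[OF _ _ this] show ?thesis using that by auto
  qed
  \<comment> \<open>\<open>(a k)\<inverse> = a\<inverse> (a k\<inverse> a\<inverse>)\<close>\<close>
  obtain S where S [simp]: "arr S" "src S = Q" "tgt S = Q" and Sp: "S \<cdot> p = p \<cdot> antipode A"
  proof -
    let ?h = "antipode K \<cdot> ?k"
    have h [simp]: "cmor ?T ?Y ?h" by simp
    have ih: "antipode A \<cdot> (i \<cdot> ?k) = i \<cdot> ?h"
      by (simp add: hmor_antipode_ext[OF K A i])
    have "antipode A \<cdot> ?l = conv ?T A (i \<cdot> ?h) (antipode A \<cdot> ?a)"
      by (simp add: antipode_conv ih)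
    also have "\<dots> = conv ?T A (conv ?T A (antipode A \<cdot> ?a) ?a) (conv ?T A (i \<cdot> ?h) (antipode A \<cdot> ?a))"
      by (simp add: conv_antipode_left)
    also have "\<dots> = conv ?T A (antipode A \<cdot> ?a) (conv ?T A (conv ?T A ?a (i \<cdot> ?h)) (antipode A \<cdot> ?a))"
      by (simp add: conv_assoc)
    finally have "p \<cdot> (antipode A \<cdot> ?l) = p \<cdot> (antipode A \<cdot> ?a)"
      by (simp only:) (rule conj_quot, simp_all)
    then have "(p \<cdot> antipode A) \<cdot> ?l = (p \<cdot> antipode A) \<cdot> ?a" by (simp add: cmp_assoc)
    from univ[OF _ _ this] show ?thesis using that by auto
  qed
  \<comment> \<open>The multiplication descends in its second argument by associativity: b (a k) =
    (b a) k. The result is an action of A on Q, because the functor A (x) - preserves the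
    coequalizer.\<close>
  obtain act where act [simp]: "arr act" "src act = hob A \<boxtimes> Q" "tgt act = Q" and actp: "act \<cdot> (\<iota> (hob A) \<otimes> p) = p \<cdot> mult A"
  proof -
    have c: "is_coequalizer M (hob A \<boxtimes> hob A \<boxtimes> hob K) (hob A \<boxtimes> hob A) (\<iota> (hob A) \<otimes> ?l) (\<iota> (hob A) \<otimes> ?a)
        (hob A \<boxtimes> Q) (\<iota> (hob A) \<otimes> p)"
      using quotient_coequalizer pres unfolding coequalizers_preserved_def by (metis A hob_Ob hopf_hdata)
    let ?U = "ctens ?X ?T"
    let ?x = "prj1 ?X ?T" and ?v = "prj2 ?X ?T"
    have v: "cmor ?U ?T ?v" by (simp add: cmor_prj2)
    note [simp] = cmorD(3-5,7)[OF v]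
    have "mult A \<cdot> (\<iota> (hob A) \<otimes> ?l) = conv ?U A ?x (?l \<cdot> ?v)"
      using tensor_eq_pr[of ?X ?T "\<iota> (hob A)" ?l] by (simp add: conv_def)
    also have "?l \<cdot> ?v = conv ?U A (?a \<cdot> ?v) (i \<cdot> (?k \<cdot> ?v))"
      using conv_cmor[OF A v, of ?a "i \<cdot> ?k"] by (simp add: cmp_assoc)
    finally have "mult A \<cdot> (\<iota> (hob A) \<otimes> ?l) = conv ?U A (conv ?U A ?x (?a \<cdot> ?v)) (i \<cdot> (?k \<cdot> ?v))"
      by (simp add: conv_assoc)
    moreover have "mult A \<cdot> (\<iota> (hob A) \<otimes> ?a) = conv ?U A ?x (?a \<cdot> ?v)"
      using tensor_eq_pr[of ?X ?T "\<iota> (hob A)" ?a] by (simp add: conv_def)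
    moreover have "counit K \<cdot> (?k \<cdot> ?v) = ce ?U"
      using cmorD(7)[OF cmor_cmp[OF v cc(2)]] by simp
    ultimately have "p \<cdot> (mult A \<cdot> (\<iota> (hob A) \<otimes> ?l)) = p \<cdot> (mult A \<cdot> (\<iota> (hob A) \<otimes> ?a))"
      by (simp add: quotient_conv)
    then have "(p \<cdot> mult A) \<cdot> (\<iota> (hob A) \<otimes> ?l) = (p \<cdot> mult A) \<cdot> (\<iota> (hob A) \<otimes> ?a)"
      by (simp add: cmp_assoc)
    from coequalizerD(6)[OF c _ _ this] show ?thesis using that by auto
  qed
  have rp: "reg_epi p" unfolding reg_epi_def using quotient_coequalizer by blast
  \<comment> \<open>\<open>a k b = (a b) (b\<inverse> k b)\<close>\<close>
  obtain m where m [simp]: "arr m" "src m = Q \<boxtimes> Q" "tgt m = Q" and mp': "m \<cdot> (p \<otimes> \<iota> Q) = act"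
  proof -
    have c: "is_coequalizer M ((hob A \<boxtimes> hob K) \<boxtimes> Q) (hob A \<boxtimes> Q) (?l \<otimes> \<iota> Q) (?a \<otimes> \<iota> Q) (Q \<boxtimes> Q) (p \<otimes> \<iota> Q)"
      using quotient_coequalizer pres \<open>Q \<in> Ob M\<close> unfolding coequalizers_preserved_def by metis
    let ?U = "ctens ?T ?X"
    let ?u = "prj1 ?T ?X" and ?b = "prj2 ?T ?X"
    have u [simp]: "cmor ?U ?T ?u" and b [simp]: "cmor ?U ?X ?b" by (simp_all add: cmor_prj2 cmor_prj1)
    note [simp] = cmorD(3-5,7)[OF u] cmorD(3-5,7)[OF b]
    have ku [simp]: "cmor ?U ?Y (?k \<cdot> ?u)" by (rule cmor_cmp[OF u cc(2)])
    have "mult A \<cdot> (?l \<otimes> \<iota> (hob A)) = conv ?U A (?l \<cdot> ?u) ?b"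
      using tensor_eq_pr[of ?T ?X ?l "\<iota> (hob A)"] by (simp add: conv_def)
    also have "?l \<cdot> ?u = conv ?U A (?a \<cdot> ?u) (i \<cdot> (?k \<cdot> ?u))"
      using conv_cmor[OF A u, of ?a "i \<cdot> ?k"] by (simp add: cmp_assoc)
    also have "conv ?U A (conv ?U A (?a \<cdot> ?u) (i \<cdot> (?k \<cdot> ?u))) ?b
        = conv ?U A (conv ?U A (?a \<cdot> ?u) (conv ?U A ?b (antipode A \<cdot> ?b))) (conv ?U A (i \<cdot> (?k \<cdot> ?u)) ?b)"
      by (simp add: conv_antipode_right conv_assoc)
    \<comment> \<open>\<open>conj_quot\<close> expects the shape x k S(x). With x = S(b) the last
      factor is S(S(b)), which equals b by \<open>antipode_antipode\<close>.\<close>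
    also have "\<dots> = conv ?U A (conv ?U A (?a \<cdot> ?u) ?b)
       (conv ?U A (conv ?U A (antipode A \<cdot> ?b) (i \<cdot> (?k \<cdot> ?u))) (antipode A \<cdot> (antipode A \<cdot> ?b)))"
      by (simp add: conv_assoc antipode_antipode[of A ?U])
    finally have "p \<cdot> (mult A \<cdot> (?l \<otimes> \<iota> (hob A))) = p \<cdot> conv ?U A (?a \<cdot> ?u) ?b"
      by (simp only:) (rule conj_quot, simp_all)
    also have "conv ?U A (?a \<cdot> ?u) ?b = mult A \<cdot> (?a \<otimes> \<iota> (hob A))"
      using tensor_eq_pr[of ?T ?X ?a "\<iota> (hob A)"] by (simp add: conv_def)
    finally have *: "p \<cdot> (mult A \<cdot> (?l \<otimes> \<iota> (hob A))) = p \<cdot> (mult A \<cdot> (?a \<otimes> \<iota> (hob A)))" .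
    \<comment> \<open>The equation on \<open>(A \<boxtimes> K) \<boxtimes> Q\<close> is tested on
      the epimorphism \<open>\<iota> (A \<boxtimes> K) \<otimes> p\<close>, after which the action
      becomes the multiplication of A.\<close>
    have "(act \<cdot> (x \<otimes> \<iota> Q)) \<cdot> (\<iota> (hob A \<boxtimes> hob K) \<otimes> p) = p \<cdot> (mult A \<cdot> (x \<otimes> \<iota> (hob A)))"
      if "arr x" "src x = hob A \<boxtimes> hob K" "tgt x = hob A" for x
      using that cmp_extend[OF actp, of "x \<otimes> \<iota> (hob A)"] by (simp add: tensor_simps)
    then have "(act \<cdot> (?l \<otimes> \<iota> Q)) \<cdot> (\<iota> (hob A \<boxtimes> hob K) \<otimes> p) = (act \<cdot> (?a \<otimes> \<iota> Q)) \<cdot> (\<iota> (hob A \<boxtimes> hob K) \<otimes> p)"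
      using * by simp
    then have "act \<cdot> (?l \<otimes> \<iota> Q) = act \<cdot> (?a \<otimes> \<iota> Q)"
      by (rule epiD[OF reg_epi_epi[OF reg_epi_tensor(1)[OF pres rp]], rotated]) simp_all
    from coequalizerD(6)[OF c _ _ this] show ?thesis using that by auto
  qed
  have mp: "m \<cdot> (p \<otimes> p) = p \<cdot> mult A"
  proof -
    have "m \<cdot> (p \<otimes> p) = (m \<cdot> (p \<otimes> \<iota> Q)) \<cdot> (\<iota> (hob A) \<otimes> p)" by (simp add: tensor_simps)
    then show ?thesis by (simp add: mp' actp)
  qed
  define H where "H = \<lparr>hob = Q, mult = m, unt = p \<cdot> unt A, comult = d, counit = \<epsilon>, antipode = S\<rparr>"
  have hd: "hdata H" unfolding hdata_def H_def by (simp add: Hom_iff)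
  have hp: "hmor A H p" unfolding hmor_def H_def by (simp add: mp dp epsp Sp)
  have "hopf H"
    by (rule hopf_descend[OF A hd hp reg_epi_powers[OF pres rp]])
      (rule reg_epi_epi, rule reg_epi_tensor[OF pres rp], simp)+
  then show ?thesis using hp by (intro exI[of _ H]) (simp add: H_def)
qed

end

text \<open>An equalizer in \<open>Hopf_coc M\<close> is formed from arrows of that category; this
  provides the second arrow of the pair that defines a kernel.\<close>

lemma hmor_zero:
  assumes A [simp]: "hopf A" and H [simp]: "hopf H"
  shows "hmor A H (un (com A) H)"
proof -
  note axA = hopf_iff[OF hopf_hdata[OF A], THEN iffD1, OF A]
  note axH = hopf_iff[OF hopf_hdata[OF H], THEN iffD1, OF H]
  have "mult H \<cdot> (un (com A) H \<otimes> un (com A) H) = mult H \<cdot> ((unt H \<otimes> \<iota> (hob H)) \<cdot> ((\<iota> \<one> \<otimes> unt H) \<cdot> (counit A \<otimes> counit A)))"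
    by (simp add: un_def interchange_ext interchange)
  also have "\<dots> = (mult H \<cdot> (unt H \<otimes> \<iota> (hob H))) \<cdot> ((\<iota> \<one> \<otimes> unt H) \<cdot> (counit A \<otimes> counit A))"
    by (simp add: cmp_assoc)
  also have "\<dots> = \<lambda>\<^sub>l (hob H) \<cdot> ((\<iota> \<one> \<otimes> unt H) \<cdot> (counit A \<otimes> counit A))"
    using axH by simp
  also have "\<dots> = unt H \<cdot> (\<lambda>\<^sub>l \<one> \<cdot> (counit A \<otimes> counit A))"
    by (subst lunit_nat_ext) simp_all
  also have "\<dots> = unt H \<cdot> (counit A \<cdot> mult A)"
    using axA by simp
  finally have 1: "un (com A) H \<cdot> mult A = mult H \<cdot> (un (com A) H \<otimes> un (com A) H)"
    by (simp add: un_def cmp_assoc)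
  have 2: "un (com A) H \<cdot> unt A = unt H"
    using axA by (simp add: un_def cmp_assoc)
  have 3: "un (com A) H \<cdot> antipode A = antipode H \<cdot> un (com A) H"
    using un_cmor[OF H cmor_antipode[OF A]] antipode_un[OF H, of "com A"] by simp
  show ?thesis
    using cmor_un[of "com A" H] 1 2 3 unfolding hmor_def cmor_def by simp
qed

section \<open>From Hopf quotient maps to kernels\<close>

context
  fixes K A i p Q H Z q
  assumes K [simp]: "hopf K" and A [simp]: "hopf A" and i: "hmor K A i" and quot: "is_quotient M K A i Q p"
    and H [simp]: "hopf H" and p: "hmor A H p"
    and Zq: "is_tensor_over M K A i Z q"
begin

lemma tensor_over_arr: "arr q" "src q = hob A \<boxtimes> hob A" "tgt q = Z"
  by (rule coequalizerD(1-3)[OF Zq[unfolded is_tensor_over_def]])+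

lemma tensor_over_balanced:
  assumes [simp]: "coc T" "arr \<phi>" "src \<phi> = cob T" "tgt \<phi> = hob A" "arr \<kappa>" "src \<kappa> = cob T" "tgt \<kappa> = hob K"
     "arr \<chi>" "src \<chi> = cob T" "tgt \<chi> = hob A"
  shows "q \<cdot> pr T (conv T A \<phi> (i \<cdot> \<kappa>)) \<chi> = q \<cdot> pr T \<phi> (conv T A (i \<cdot> \<kappa>) \<chi>)"
proof -
  note [simp] = hmor_simps[OF _ _ i] tensor_over_arr
  note q = coequalizerD(4)[OF Zq[unfolded is_tensor_over_def]]
  have "q \<cdot> pr T (conv T A \<phi> (i \<cdot> \<kappa>)) \<chi> = (q \<cdot> ((mult A \<cdot> (\<iota> (hob A) \<otimes> i)) \<otimes> \<iota> (hob A))) \<cdot> pr T (pr T \<phi> \<kappa>) \<chi>"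
    by (simp add: conv_def cmp_assoc tensor_pr)
  also have "\<dots> = q \<cdot> pr T \<phi> (conv T A (i \<cdot> \<kappa>) \<chi>)"
    unfolding q by (simp add: conv_def cmp_assoc tensor_pr assoc_pr)
  finally show ?thesis .
qed

text \<open>
  The map \<open>a \<otimes> c \<mapsto> a\<^sub>1 \<otimes>\<^sub>K S(a\<^sub>2) c\<close> factors through \<open>Q \<otimes> A\<close>; it is the inverse of the canonical
  map \<open>A \<otimes>\<^sub>K A \<rightarrow> Q \<otimes> A\<close>, \<open>a \<otimes>\<^sub>K b \<mapsto> p(a\<^sub>1) \<otimes> a\<^sub>2 b\<close>.
\<close>

lemma quotient_trivial_equalizes:
  assumes pres: "coequalizers_preserved M" and t: "cmor T (com A) t" and pt: "p \<cdot> t = un T H"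
  shows "q \<cdot> pr T (un T A) t = q \<cdot> pr T t (un T A)"
proof -
  let ?X = "com A" and ?Y = "com K"
  let ?T = "ctens ?X ?Y"
  let ?a = "prj1 ?X ?Y" and ?k = "prj2 ?X ?Y"
  let ?l = "conv ?T A ?a (i \<cdot> ?k)"
  note coeq = quotient_coequalizer[OF K A i quot]
  have QH: "Q = hob H" using coequalizerD(3)[OF coeq] hmor_simps[OF _ _ p] by simp
  note [simp] = hmor_simps[OF _ _ i] hmor_simps[OF _ _ p] tensor_over_arr cmorD(1-5)[OF t] t
  have ci: "cmor ?Y ?X i" by (rule hmor_cmor[OF K A i])
  have cc [simp]: "cmor ?T ?X ?a" "cmor ?T ?Y ?k" by (simp_all add: cmor_prj1 cmor_prj2)
  have cik [simp]: "cmor W ?X (i \<cdot> y)" if "cmor W ?Y y" for W y by (rule cmor_cmp[OF that ci])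
  let ?D = "ctens ?X ?X"
  let ?v = "q \<cdot> pr ?D (prj1 ?X ?X) (conv ?D A (antipode A \<cdot> prj1 ?X ?X) (prj2 ?X ?X))"
  have v: "?v \<cdot> pr W x y = q \<cdot> pr W x (conv W A (antipode A \<cdot> x) y)"
    if x: "cmor W ?X x" and y: "cmor W ?X y" for W x y
  proof -
    note [simp] = cmorD(1-5,7)[OF x] cmorD(3-5,7)[OF y]
    have c: "cmor W ?D (pr W x y)" by (rule cmor_pr[OF x y])
    have p1: "prj1 ?X ?X \<cdot> pr W x y = x" by (rule prj1_pr) (use cmorD(7)[OF y] in simp_all)
    have p2: "prj2 ?X ?X \<cdot> pr W x y = y" by (rule prj2_pr) (use cmorD(7)[OF x] in simp_all)
    show ?thesis
      by (simp add: cmp_assoc pr_cmor[OF c] conv_cmor[OF A c] p1 p2)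
  qed
  have va [simp]: "arr ?v" "src ?v = hob A \<boxtimes> hob A" "tgt ?v = Z" by simp_all
  have c: "is_coequalizer M ((hob A \<boxtimes> hob K) \<boxtimes> hob A) (hob A \<boxtimes> hob A) (?l \<otimes> \<iota> (hob A)) (?a \<otimes> \<iota> (hob A))
      (Q \<boxtimes> hob A) (p \<otimes> \<iota> (hob A))"
    using coeq pres unfolding coequalizers_preserved_def by (metis A hob_Ob hopf_hdata)
  have "?v \<cdot> (?l \<otimes> \<iota> (hob A)) = ?v \<cdot> (?a \<otimes> \<iota> (hob A))"
  proof -
    let ?U = "ctens ?T ?X"
    let ?u = "prj1 ?T ?X" and ?b = "prj2 ?T ?X"
    have u [simp]: "cmor ?U ?T ?u" and b [simp]: "cmor ?U ?X ?b" by (simp_all add: cmor_prj2 cmor_prj1)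
    note [simp] = cmorD(3-5,7)[OF u] cmorD(3-5,7)[OF b]
    let ?a' = "?a \<cdot> ?u" and ?k' = "?k \<cdot> ?u"
    have ku [simp]: "cmor ?U ?Y ?k'" by (rule cmor_cmp[OF u cc(2)])
    have au [simp]: "cmor ?U ?X ?a'" by (rule cmor_cmp[OF u cc(1)])
    have lu: "?l \<cdot> ?u = conv ?U A ?a' (i \<cdot> ?k')"
      using conv_cmor[OF A u, of ?a "i \<cdot> ?k"] by (simp add: cmp_assoc)
    have clu: "cmor ?U ?X (conv ?U A ?a' (i \<cdot> ?k'))" by simp
    have "?v \<cdot> (?l \<otimes> \<iota> (hob A)) = ?v \<cdot> pr ?U (conv ?U A ?a' (i \<cdot> ?k')) ?b"
      using tensor_eq_pr[of ?T ?X ?l "\<iota> (hob A)"] by (simp add: lu)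
    also have "\<dots> = q \<cdot> pr ?U (conv ?U A ?a' (i \<cdot> ?k')) (conv ?U A (antipode A \<cdot> conv ?U A ?a' (i \<cdot> ?k')) ?b)"
      by (rule v[OF clu b])
    \<comment> \<open>The balancing relation moves k to the right factor, where it meets the k^-1 in
      (a k)^-1 = k^-1 a^-1 and cancels.\<close>
    also have "\<dots> = q \<cdot> pr ?U ?a' (conv ?U A (i \<cdot> ?k') (conv ?U A (antipode A \<cdot> conv ?U A ?a' (i \<cdot> ?k')) ?b))"
      by (rule tensor_over_balanced) simp_all
    also have "conv ?U A (i \<cdot> ?k') (conv ?U A (antipode A \<cdot> conv ?U A ?a' (i \<cdot> ?k')) ?b)
      = conv ?U A (conv ?U A (conv ?U A (i \<cdot> ?k') (antipode A \<cdot> (i \<cdot> ?k'))) (antipode A \<cdot> ?a')) ?b"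
      by (simp add: antipode_conv conv_assoc)
    also have "\<dots> = conv ?U A (antipode A \<cdot> ?a') ?b"
      by (simp add: conv_antipode_right)
    also have "q \<cdot> pr ?U ?a' (conv ?U A (antipode A \<cdot> ?a') ?b) = ?v \<cdot> pr ?U ?a' ?b"
      by (rule v[OF au b, symmetric])
    also have "\<dots> = ?v \<cdot> (?a \<otimes> \<iota> (hob A))"
      using tensor_eq_pr[of ?T ?X ?a "\<iota> (hob A)"] by simp
    finally show ?thesis .
  qed
  from coequalizerD(6)[OF c va(1,2) this] obtain g where g: "arr g" "src g = hob H \<boxtimes> hob A" "tgt g = Z"
    and gp: "g \<cdot> (p \<otimes> \<iota> (hob A)) = ?v"
    unfolding QH va by blast
  note [simp] = g
  have pv: "?v \<cdot> pr T x t = g \<cdot> pr T (p \<cdot> x) t" if "arr x" "src x = cob T" "tgt x = hob A" for x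
    using that by (simp add: gp[symmetric] cmp_assoc tensor_pr)
  \<comment> \<open>Evaluate \<open>?v\<close> at (t, t) and at (1, t): the values are t (x)_K 1 and
    1 (x)_K t. They coincide because \<open>?v\<close> sees its first argument only through
    \<open>p\<close>, which is trivial on both.\<close>
  have "q \<cdot> pr T t (un T A) = q \<cdot> pr T t (conv T A (antipode A \<cdot> t) t)"
    by (simp add: conv_antipode_left)
  also have "\<dots> = ?v \<cdot> pr T t t" by (rule v[symmetric]) simp_all
  also have "\<dots> = ?v \<cdot> pr T (un T A) t"
    by (simp only: pv cmorD[OF t] conv_simps[OF cmorD(1)[OF t] A] com_simps pt hmor_un[OF A H _ p])
  also have "\<dots> = q \<cdot> pr T (un T A) (conv T A (antipode A \<cdot> un T A) t)"
    by (rule v) simp_all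
  also have "\<dots> = q \<cdot> pr T (un T A) t" by (simp add: antipode_un)
  finally show ?thesis by simp
qed

text \<open>\<open>i\<close> is the kernel of \<open>p\<close> itself. Being an equalizer in M, it
  has monomorphisms as tensor powers, so the lifts that it provides in M respect the Hopf structure
  by \<open>hmor_lift\<close>.\<close>

lemma quotient_kernel:
  assumes pres: "coequalizers_preserved M" and epres: "equalizers_preserved M"
    and E: "is_equalizer_of_tensor_over M K A i Z q"
  shows "is_kernel M K A i"
proof -
  note [simp] = hmor_simps[OF _ _ i] hmor_simps[OF _ _ p] tensor_over_arr
  have z: "unt H \<cdot> counit A = un (com A) H" by (simp add: un_def)
  note E' = E[unfolded is_equalizer_of_tensor_over_def]
  have re: "reg_mono i" unfolding reg_mono_def using E' by blast
  note mi = reg_mono_powers[OF epres re]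
  have zi: "un (com A) H \<cdot> i = un (com K) H" by (rule un_cmor[OF H hmor_cmor[OF K A i]])
  have pi: "p \<cdot> i = un (com A) H \<cdot> i"
    unfolding zi quotient_i[OF K A i quot] by (rule hmor_un[OF A H _ p]) simp
  have lift: "\<exists>!s. s \<in> Hom (Hopf_coc M) T K \<and> i \<cdot> s = t"
    if t0: "t \<in> Hom (Hopf_coc M) T A" and pt: "p \<cdot> t = un (com A) H \<cdot> t" for T t
  proof -
    have T [simp]: "hopf T" and t: "hmor T A t" using t0 unfolding Hom_Hopf_coc by blast+
    note [simp] = hmor_simps[OF _ _ t]
    have ct: "cmor (com T) (com A) t" by (rule hmor_cmor[OF T A t])
    have "p \<cdot> t = un (com T) H" using pt un_cmor[OF H ct] by simp
    note eq = quotient_trivial_equalizes[OF pres ct this]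
    have r: "\<rho>\<^sup>i (hob A) \<cdot> t = pr (com T) t (counit T)"
      by (rule inverse_mono[OF runit_inverse[of "hob A"]]) (simp_all add: runit_pr[of "com T" t "hob A", simplified])
    have l: "\<lambda>\<^sup>i (hob A) \<cdot> t = pr (com T) (counit T) t"
      by (rule inverse_mono[OF lunit_inverse[of "hob A"]]) (simp_all add: lunit_pr[of "com T" t "hob A", simplified])
    have "(q \<cdot> (unt A \<otimes> \<iota> (hob A)) \<cdot> \<lambda>\<^sup>i (hob A)) \<cdot> t = (q \<cdot> (\<iota> (hob A) \<otimes> unt A) \<cdot> \<rho>\<^sup>i (hob A)) \<cdot> t"
      using eq by (simp add: cmp_assoc r l tensor_pr un_def)
    from equalizerD(6)[OF E' _ _ this] obtain s where s [simp]: "arr s" "src s = hob T" "tgt s = hob K" and st: "i \<cdot> s = t"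
      by auto
    have "hmor T K s"
      by (rule hmor_lift[OF T K A i]) (simp_all add: st t mi)
    then show ?thesis
    proof (intro ex1I[of _ s] conjI)
      fix s' assume "s' \<in> Hom (Hopf_coc M) T K \<and> i \<cdot> s' = t"
      then have s': "hmor T K s'" "i \<cdot> s' = t" unfolding Hom_Hopf_coc by blast+
      show "s' = s"
        by (rule monD[OF mi(1)]) (simp_all add: s'(2) st hmor_simps[OF _ _ s'(1)])
    qed (simp_all add: Hom_Hopf_coc st)
  qed
  show ?thesis unfolding is_kernel_def
  proof (intro exI bexI)
    show "p \<in> Hom (Hopf_coc M) A H" using p by (simp add: Hom_Hopf_coc)
    show "is_equalizer (Hopf_coc M) A H p (unt H \<cdot> counit A) K i"
      unfolding is_equalizer_def Cmp_Hopf_coc z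
        Hom_Hopf_coc[of p] Hom_Hopf_coc[of i] Hom_Hopf_coc[of "un (com A) H"]
      by (intro conjI allI ballI impI K A H p i pi hmor_zero lift)
  qed
qed

end


lemma normal_quotient_kernel:
  assumes he: "has_equalizers M" and pe: "equalizers_preserved M" and pc: "coequalizers_preserved M"
    and mono: "is_mono (Hopf_coc M) K A i" and quot: "is_quotient M K A i Q p"
  shows "(is_kernel M K A i \<longrightarrow> is_normal M K A i) \<and>
         (is_normal M K A i \<longrightarrow> is_Hopf_coc_quotient_map M A Q p) \<and>
         (\<forall>Z q. is_tensor_over M K A i Z q \<and> is_equalizer_of_tensor_over M K A i Z q \<longrightarrow>
            (is_normal M K A i \<longleftrightarrow> is_Hopf_coc_quotient_map M A Q p) \<and>
            (is_Hopf_coc_quotient_map M A Q p \<longleftrightarrow> is_kernel M K A i))"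
proof -
  have "i \<in> Hom (Hopf_coc M) K A" using mono unfolding is_mono_def by blast
  then have K: "hopf K" and A: "hopf A" and i: "hmor K A i" unfolding Hom_Hopf_coc by blast+
  have 31: "is_normal M K A i" if "is_kernel M K A i"
    unfolding is_normal_def using mono kernel_conjugation[OF he pe that] by blast
  have 12: "is_Hopf_coc_quotient_map M A Q p" if n: "is_normal M K A i"
  proof -
    obtain \<psi> where "\<psi> \<in> Hom M (hob A \<boxtimes> hob K) (hob K)" "i \<cdot> \<psi> = ad M A \<cdot> (\<iota> (hob A) \<otimes> i)"
      using n unfolding is_normal_def by blast
    from normal_quotient[OF K A i quot pc this] show ?thesis
      unfolding is_Hopf_coc_quotient_map_def Hom_Hopf_coc using A by blast
  qed
  have 23: "is_kernel M K A i" if m: "is_Hopf_coc_quotient_map M A Q p" and E: "is_tensor_over M K A i Z q"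
    "is_equalizer_of_tensor_over M K A i Z q" for Z q
  proof -
    obtain H where "hopf H" "hmor A H p"
      using m unfolding is_Hopf_coc_quotient_map_def Hom_Hopf_coc by blast
    from quotient_kernel[OF K A i quot this E(1) pc pe E(2)] show ?thesis .
  qed
  show ?thesis using 31 12 23 by blast
qed

end

section \<open>Separation of the hom-sets\<close>

lemma ex1_iff_singleton: "(\<exists>!s. s \<in> S \<and> P s) \<longleftrightarrow> (\<exists>s. {s \<in> S. P s} = {s})"
  unfolding set_eq_iff Ex1_def by (simp, metis)

text \<open>\<open>L\<close> takes both objects because hom-sets of C may overlap. In place of
  surjectivity on objects, every morphism into or out of an image object has its other end in the
  image; this is what quantification over test objects in universal properties requires, and
  ill-tagged Hopf data remain outside.\<close>

locale full_embedding =
  fixes C :: "('o, 'm, 'z) category_scheme" and C' :: "('p, 'n, 'y) category_scheme"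
    and F :: "'o \<Rightarrow> 'p" and L :: "'o \<Rightarrow> 'o \<Rightarrow> 'm \<Rightarrow> 'n"
  assumes Hom_image: "Hom C' (F A) (F B) = L A B ` Hom C A B"
    and source_image: "f' \<in> Hom C' T (F A) \<Longrightarrow> \<exists>T0. T = F T0"
    and target_image: "f' \<in> Hom C' (F A) T \<Longrightarrow> \<exists>T0. T = F T0"
    and L_inj: "L A B f = L A B g \<longleftrightarrow> f = g"
    and L_Cmp: "Cmp C' (L B D g) (L A B f) = L A D (Cmp C g f)"
begin

lemma L_Hom: "L A B f \<in> Hom C' (F A) (F B) \<longleftrightarrow> f \<in> Hom C A B"
  unfolding Hom_image by (auto simp: L_inj)

text \<open>\<open>L A B\<close> restricts to a bijection between the two sets of solutions, and
  having exactly one solution means having cardinality one.\<close>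

lemma ex1_image: "(\<exists>!s. s \<in> Hom C' (F A) (F B) \<and> P s) \<longleftrightarrow> (\<exists>!s. s \<in> Hom C A B \<and> P (L A B s))"
proof -
  have "bij_betw (L A B) {s \<in> Hom C A B. P (L A B s)} {s \<in> Hom C' (F A) (F B). P s}"
    unfolding Hom_image bij_betw_def inj_on_def by (auto simp: L_inj)
  then have "card {s \<in> Hom C A B. P (L A B s)} = card {s \<in> Hom C' (F A) (F B). P s}"
    by (rule bij_betw_same_card)
  then have "(\<exists>s. {s \<in> Hom C A B. P (L A B s)} = {s}) \<longleftrightarrow> (\<exists>s. {s \<in> Hom C' (F A) (F B). P s} = {s})"
    unfolding card_1_singleton_iff[symmetric] One_nat_def[symmetric] by simp
  then show ?thesis unfolding ex1_iff_singleton by simp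
qed

lemma all_sources:
  "(\<forall>T. \<forall>t \<in> Hom C' T (F A). P T t) \<longleftrightarrow> (\<forall>T. \<forall>t \<in> Hom C T A. P (F T) (L T A t))"
  by (metis (no_types, lifting) Hom_image L_Hom image_iff source_image)

lemma all_targets:
  "(\<forall>T. \<forall>t \<in> Hom C' (F A) T. P T t) \<longleftrightarrow> (\<forall>T. \<forall>t \<in> Hom C A T. P (F T) (L A T t))"
  by (metis (no_types, lifting) Hom_image L_Hom image_iff target_image)

lemma ex_targets:
  "(\<exists>T. \<exists>t \<in> Hom C' (F A) T. P T t) \<longleftrightarrow> (\<exists>T. \<exists>t \<in> Hom C A T. P (F T) (L A T t))"
  using all_targets[of A "\<lambda>T t. \<not> P T t"] by blast

lemma mono_iff: "is_mono C' (F A) (F B) (L A B f) \<longleftrightarrow> is_mono C A B f"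
  unfolding is_mono_def all_sources L_Hom unfolding Hom_image ball_simps L_Cmp L_inj ..

lemma equalizer_iff:
  "is_equalizer C' (F A) (F B) (L A B f) (L A B g) (F E) (L E A e) \<longleftrightarrow> is_equalizer C A B f g E e"
  unfolding is_equalizer_def all_sources ex1_image L_Hom L_Cmp L_inj ..

lemma coequalizer_iff:
  "is_coequalizer C' (F A) (F B) (L A B f) (L A B g) (F Q) (L B Q q) \<longleftrightarrow> is_coequalizer C A B f g Q q"
  unfolding is_coequalizer_def all_targets ex1_image L_Hom L_Cmp L_inj ..

end

section \<open>Morphisms tagged with source and target\<close>

text \<open>Tags of composites and tensor products are computed for arbitrary arguments, composable
  or not, as demanded by the unconditional equations of \<open>typed_smc\<close>.\<close>

definition typed :: "('o, 'm, 'z) sym_monoidal_category_scheme \<Rightarrow> ('o, 'o \<times> 'm \<times> 'o) sym_monoidal_category" where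
  "typed M = \<lparr>Ob = Ob M,
     Hom = (\<lambda>A B. (\<lambda>f. (A, f, B)) ` Hom M A B),
     Idt = (\<lambda>A. (A, Idt M A, A)),
     Cmp = (\<lambda>g f. (fst f, Cmp M (fst (snd g)) (fst (snd f)), snd (snd g))),
     tensor_ob = tensor_ob M,
     tensor = (\<lambda>f g. (tensor_ob M (fst f) (fst g), tensor M (fst (snd f)) (fst (snd g)), tensor_ob M (snd (snd f)) (snd (snd g)))),
     unit_ob = unit_ob M,
     assoc = (\<lambda>A B D. (tensor_ob M (tensor_ob M A B) D, assoc M A B D, tensor_ob M A (tensor_ob M B D))),
     lunit = (\<lambda>A. (tensor_ob M (unit_ob M) A, lunit M A, A)),
     runit = (\<lambda>A. (tensor_ob M A (unit_ob M), runit M A, A)),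
     braid = (\<lambda>A B. (tensor_ob M A B, braid M A B, tensor_ob M B A))\<rparr>"

lemma typed_simps [simp]:
  "Ob (typed M) = Ob M"
  "f' \<in> Hom (typed M) A B \<longleftrightarrow> fst f' = A \<and> snd (snd f') = B \<and> fst (snd f') \<in> Hom M A B"
  "Idt (typed M) A = (A, Idt M A, A)"
  "Cmp (typed M) g' f' = (fst f', Cmp M (fst (snd g')) (fst (snd f')), snd (snd g'))"
  "tensor_ob (typed M) = tensor_ob M"
  "tensor (typed M) f' g' = (tensor_ob M (fst f') (fst g'), tensor M (fst (snd f')) (fst (snd g')), tensor_ob M (snd (snd f')) (snd (snd g')))"
  "unit_ob (typed M) = unit_ob M"
  "assoc (typed M) A B D = (tensor_ob M (tensor_ob M A B) D, assoc M A B D, tensor_ob M A (tensor_ob M B D))"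
  "lunit (typed M) A = (tensor_ob M (unit_ob M) A, lunit M A, A)"
  "runit (typed M) A = (tensor_ob M A (unit_ob M), runit M A, A)"
  "braid (typed M) A B = (tensor_ob M A B, braid M A B, tensor_ob M B A)"
  by (auto simp: typed_def image_iff prod_eq_iff)

lemma is_inverse_typed:
  "is_inverse (typed M) A B (A, f, B) (B, g, A) \<longleftrightarrow> is_inverse M A B f g"
  unfolding is_inverse_def by simp

definition typed_hopf :: "('o, 'm, 'z) sym_monoidal_category_scheme \<Rightarrow> ('o, 'm) hopf_data \<Rightarrow> ('o, 'o \<times> 'm \<times> 'o) hopf_data" where
  "typed_hopf M A = \<lparr>hob = hob A,
     mult = (tensor_ob M (hob A) (hob A), mult A, hob A),
     unt = (unit_ob M, unt A, hob A),
     comult = (hob A, comult A, tensor_ob M (hob A) (hob A)),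
     counit = (hob A, counit A, unit_ob M),
     antipode = (hob A, antipode A, hob A)\<rparr>"

lemma typed_hopf_simps [simp]:
  "hob (typed_hopf M A) = hob A"
  "mult (typed_hopf M A) = (tensor_ob M (hob A) (hob A), mult A, hob A)"
  "unt (typed_hopf M A) = (unit_ob M, unt A, hob A)"
  "comult (typed_hopf M A) = (hob A, comult A, tensor_ob M (hob A) (hob A))"
  "counit (typed_hopf M A) = (hob A, counit A, unit_ob M)"
  "antipode (typed_hopf M A) = (hob A, antipode A, hob A)"
  by (simp_all add: typed_hopf_def)

context sym_monoidal_category begin

lemma is_inverse_unique:
  assumes "is_inverse M A B f g" "is_inverse M A B f h"
  shows "g = h"
proof -
  have "h = h \<cdot> (f \<cdot> g)" using assms Cmp_Idt unfolding is_inverse_def by metis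
  also have "\<dots> = (h \<cdot> f) \<cdot> g" using assms Cmp_assoc unfolding is_inverse_def by metis
  also have "\<dots> = g" using assms Idt_Cmp unfolding is_inverse_def by metis
  finally show ?thesis by simp
qed

lemma inv_of_eq: "is_inverse M A B f g \<Longrightarrow> inv_of M A B f = g"
  unfolding inv_of_def using is_inverse_unique by blast

lemma typed_iso: "is_iso M A B f \<Longrightarrow> is_iso (typed M) A B (A, f, B)"
  unfolding is_iso_def by (metis is_inverse_typed)

lemma typed_sym_monoidal: "sym_monoidal_category (typed M)"
  by unfold_locales
    (auto dest: Hom_Ob intro: Idt_Hom Cmp_Hom Cmp_Idt Idt_Cmp unit_Ob tensor_Ob tensor_Hom tensor_Idt
      lunit_natural runit_natural pentagon triangle braid_Hom braid_symmetric hexagon typed_iso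
      assoc_iso lunit_iso runit_iso Cmp_assoc tensor_Cmp assoc_natural braid_natural)

lemma typed_typed_smc: "typed_smc (typed M) fst (\<lambda>f. snd (snd f))"
  by (intro typed_smc.intro typed_sym_monoidal, unfold_locales) auto

lemma typed_embedding: "full_embedding M (typed M) (\<lambda>A. A) (\<lambda>A B f. (A, f, B))"
  by unfold_locales (auto simp: image_iff prod_eq_iff)

lemma typed_inv_of:
  assumes "is_iso M A B f"
  shows "inv_of (typed M) A B (A, f, B) = (B, inv_of M A B f, A)"
proof -
  obtain g where g: "is_inverse M A B f g" using assms unfolding is_iso_def ..
  show ?thesis
    unfolding inv_of_eq[OF g]
    by (rule sym_monoidal_category.inv_of_eq[OF typed_sym_monoidal]) (simp add: is_inverse_typed g)
qed

lemma typed_assoc_inv [simp]: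
  "\<lbrakk>A \<in> Ob M; B \<in> Ob M; D \<in> Ob M\<rbrakk>
    \<Longrightarrow> assoc_inv (typed M) A B D = (A \<boxtimes> (B \<boxtimes> D), assoc_inv M A B D, (A \<boxtimes> B) \<boxtimes> D)"
  by (simp add: assoc_inv_def typed_inv_of assoc_iso)

lemma typed_lunit_inv [simp]: "A \<in> Ob M \<Longrightarrow> lunit_inv (typed M) A = (A, lunit_inv M A, \<one> \<boxtimes> A)"
  by (simp add: lunit_inv_def typed_inv_of lunit_iso)

lemma typed_runit_inv [simp]: "A \<in> Ob M \<Longrightarrow> runit_inv (typed M) A = (A, runit_inv M A, A \<boxtimes> \<one>)"
  by (simp add: runit_inv_def typed_inv_of runit_iso)

lemma typed_mid_swap [simp]:
  "\<lbrakk>A \<in> Ob M; B \<in> Ob M; D \<in> Ob M; E \<in> Ob M\<rbrakk>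
    \<Longrightarrow> mid_swap (typed M) A B D E = ((A \<boxtimes> B) \<boxtimes> (D \<boxtimes> E), mid_swap M A B D E, (A \<boxtimes> D) \<boxtimes> (B \<boxtimes> E))"
  by (simp add: mid_swap_def tensor_Ob)

lemma typed_is_hopf_monoid [simp]:
  "is_hopf_monoid (typed M) (typed_hopf M A) \<longleftrightarrow> is_hopf_monoid M A"
  unfolding is_hopf_monoid_def is_bimonoid_def is_monoid_def is_comonoid_def
  \<comment> \<open>If the carrier is not an object, both sides are false; if it is, the inverse
    constraints inside \<open>mid_swap\<close> are tagged correctly.\<close>
  by (cases "hob A \<in> Ob M") (simp_all add: unit_Ob)

lemma typed_is_cocommutative [simp]:
  "is_cocommutative (typed M) (typed_hopf M A) \<longleftrightarrow> is_cocommutative M A"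
  unfolding is_cocommutative_def by simp

lemma typed_is_hopf_morphism [simp]:
  "is_hopf_morphism (typed M) (typed_hopf M A) (typed_hopf M B) f' \<longleftrightarrow>
    (\<exists>f. f' = (hob A, f, hob B) \<and> is_hopf_morphism M A B f)"
  unfolding is_hopf_morphism_def by (cases f') auto

text \<open>The typing clauses in the axioms determine the tags of all structure maps, so stripping
  and restoring them changes nothing.\<close>

lemma typed_hopf_surj:
  assumes "is_hopf_monoid (typed M) H"
  shows "\<exists>A. H = typed_hopf M A"
proof
  show "H = typed_hopf M \<lparr>hob = hob H, mult = fst (snd (mult H)), unt = fst (snd (unt H)),
     comult = fst (snd (comult H)), counit = fst (snd (counit H)), antipode = fst (snd (antipode H))\<rparr>"
    using assms unfolding is_hopf_monoid_def is_bimonoid_def is_monoid_def is_comonoid_def typed_hopf_def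
    by (intro hopf_data.equality) (simp_all add: prod_eq_iff)
qed

lemma typed_Hopf_embedding:
  "full_embedding (Hopf_coc M) (Hopf_coc (typed M)) (typed_hopf M) (\<lambda>A B f. (hob A, f, hob B))"
proof unfold_locales
  show "Hom (Hopf_coc (typed M)) (typed_hopf M A) (typed_hopf M B) = (\<lambda>f. (hob A, f, hob B)) ` Hom (Hopf_coc M) A B" for A B
    by (auto simp: Hopf_coc_def)
qed (auto simp: Hopf_coc_def dest: typed_hopf_surj)

lemma typed_is_kernel:
  "is_kernel (typed M) (typed_hopf M K) (typed_hopf M A) (hob K, i, hob A) \<longleftrightarrow> is_kernel M K A i"
proof -
  have *: "Cmp (typed M) (unt (typed_hopf M B)) (counit (typed_hopf M A)) = (hob A, unt B \<cdot> counit A, hob B)" for B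
    by simp
  show ?thesis
    unfolding is_kernel_def full_embedding.ex_targets[OF typed_Hopf_embedding] *
      full_embedding.equalizer_iff[OF typed_Hopf_embedding] ..
qed

lemma typed_is_normal:
  assumes "hob A \<in> Ob M"
  shows "is_normal (typed M) (typed_hopf M K) (typed_hopf M A) (hob K, i, hob A) \<longleftrightarrow> is_normal M K A i"
proof -
  have "ad (typed M) (typed_hopf M A) = (hob A \<boxtimes> hob A, ad M A, hob A)"
    using assms by (simp add: ad_def Let_def)
  then show ?thesis
    unfolding is_normal_def full_embedding.mono_iff[OF typed_Hopf_embedding]
    by (auto simp: Bex_def)
qed

lemma typed_is_quotient:
  "is_quotient (typed M) (typed_hopf M K) (typed_hopf M A) (hob K, i, hob A) Q (hob A, p, Q) \<longleftrightarrow> is_quotient M K A i Q p"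
  unfolding is_quotient_def full_embedding.coequalizer_iff[OF typed_embedding, symmetric] by simp

lemma typed_is_tensor_over:
  "is_tensor_over (typed M) (typed_hopf M K) (typed_hopf M A) (hob K, i, hob A) Z (hob A \<boxtimes> hob A, q, Z)
    \<longleftrightarrow> is_tensor_over M K A i Z q"
  unfolding is_tensor_over_def full_embedding.coequalizer_iff[OF typed_embedding, symmetric] by simp

lemma typed_is_equalizer_of_tensor_over:
  assumes "hob A \<in> Ob M"
  shows "is_equalizer_of_tensor_over (typed M) (typed_hopf M K) (typed_hopf M A) (hob K, i, hob A) Z (hob A \<boxtimes> hob A, q, Z)
    \<longleftrightarrow> is_equalizer_of_tensor_over M K A i Z q"
  unfolding is_equalizer_of_tensor_over_def full_embedding.equalizer_iff[OF typed_embedding, symmetric]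
  using assms by simp

text \<open>A Hopf structure on Q found over \<open>typed M\<close> is the target of a morphism from
  a tagged Hopf monoid, hence is itself tagged from one over M.\<close>

lemma typed_is_Hopf_coc_quotient_map:
  "is_Hopf_coc_quotient_map (typed M) (typed_hopf M A) Q (hob A, p, Q) \<longleftrightarrow> is_Hopf_coc_quotient_map M A Q p"
proof
  assume "is_Hopf_coc_quotient_map (typed M) (typed_hopf M A) Q (hob A, p, Q)"
  then obtain H' where H': "hob H' = Q" "(hob A, p, Q) \<in> Hom (Hopf_coc (typed M)) (typed_hopf M A) H'"
    unfolding is_Hopf_coc_quotient_map_def by blast
  then obtain H where "H' = typed_hopf M H"
    using full_embedding.target_image[OF typed_Hopf_embedding] by blast
  with H' show "is_Hopf_coc_quotient_map M A Q p"
    unfolding is_Hopf_coc_quotient_map_def using full_embedding.L_Hom[OF typed_Hopf_embedding] by auto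
next
  assume "is_Hopf_coc_quotient_map M A Q p"
  then obtain H where "hob H = Q" "p \<in> Hom (Hopf_coc M) A H"
    unfolding is_Hopf_coc_quotient_map_def by blast
  then show "is_Hopf_coc_quotient_map (typed M) (typed_hopf M A) Q (hob A, p, Q)"
    unfolding is_Hopf_coc_quotient_map_def
    using full_embedding.L_Hom[OF typed_Hopf_embedding, of A p H] by (intro exI[of _ "typed_hopf M H"]) simp
qed

lemma typed_equalizerE:
  assumes "is_equalizer (typed M) A B f' g' E e'"
  obtains f g e where "f' = (A, f, B)" "g' = (A, g, B)" "e' = (E, e, A)" "is_equalizer M A B f g E e"
proof -
  have "f' = (A, fst (snd f'), B)" "g' = (A, fst (snd g'), B)" "e' = (E, fst (snd e'), A)"
    using assms unfolding is_equalizer_def by (auto simp: prod_eq_iff)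
  with that assms show ?thesis using full_embedding.equalizer_iff[OF typed_embedding] by metis
qed

lemma typed_coequalizerE:
  assumes "is_coequalizer (typed M) A B f' g' Q q'"
  obtains f g q where "f' = (A, f, B)" "g' = (A, g, B)" "q' = (B, q, Q)" "is_coequalizer M A B f g Q q"
proof -
  have "f' = (A, fst (snd f'), B)" "g' = (A, fst (snd g'), B)" "q' = (B, fst (snd q'), Q)"
    using assms unfolding is_coequalizer_def by (auto simp: prod_eq_iff)
  with that assms show ?thesis using full_embedding.coequalizer_iff[OF typed_embedding] by metis
qed

lemma typed_has_equalizers:
  assumes "has_equalizers M"
  shows "has_equalizers (typed M)"
  unfolding has_equalizers_def
proof (intro allI ballI)
  fix A B f' g' assume "f' \<in> Hom (typed M) A B" "g' \<in> Hom (typed M) A B"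
  then obtain f g where fg: "f' = (A, f, B)" "g' = (A, g, B)" "f \<in> Hom M A B" "g \<in> Hom M A B"
    by (metis prod.collapse typed_simps(2))
  then obtain E e where "is_equalizer M A B f g E e"
    using assms unfolding has_equalizers_def by blast
  then have "is_equalizer (typed M) A B f' g' E (E, e, A)"
    unfolding fg full_embedding.equalizer_iff[OF typed_embedding] .
  then show "\<exists>E e. is_equalizer (typed M) A B f' g' E e" by blast
qed

lemma typed_equalizers_preserved:
  assumes "equalizers_preserved M"
  shows "equalizers_preserved (typed M)"
  unfolding equalizers_preserved_def
proof (intro allI impI ballI)
  fix A B f' g' E e' X
  assume "is_equalizer (typed M) A B f' g' E e'" and X: "X \<in> Ob (typed M)"
  then obtain f g e where *: "f' = (A, f, B)" "g' = (A, g, B)" "e' = (E, e, A)" "is_equalizer M A B f g E e"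
    by (elim typed_equalizerE)
  note iff = full_embedding.equalizer_iff[OF typed_embedding]
  show "is_equalizer (typed M) (tensor_ob (typed M) X A) (tensor_ob (typed M) X B)
      (tensor (typed M) (Idt (typed M) X) f') (tensor (typed M) (Idt (typed M) X) g')
      (tensor_ob (typed M) X E) (tensor (typed M) (Idt (typed M) X) e') \<and>
    is_equalizer (typed M) (tensor_ob (typed M) A X) (tensor_ob (typed M) B X)
      (tensor (typed M) f' (Idt (typed M) X)) (tensor (typed M) g' (Idt (typed M) X))
      (tensor_ob (typed M) E X) (tensor (typed M) e' (Idt (typed M) X))"
    using assms *(4) X unfolding equalizers_preserved_def *(1-3) by (simp add: iff)
qed

lemma typed_coequalizers_preserved:
  assumes "coequalizers_preserved M"
  shows "coequalizers_preserved (typed M)"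
  unfolding coequalizers_preserved_def
proof (intro allI impI ballI)
  fix A B f' g' E e' X
  assume "is_coequalizer (typed M) A B f' g' E e'" and X: "X \<in> Ob (typed M)"
  then obtain f g e where *: "f' = (A, f, B)" "g' = (A, g, B)" "e' = (B, e, E)" "is_coequalizer M A B f g E e"
    by (elim typed_coequalizerE)
  note iff = full_embedding.coequalizer_iff[OF typed_embedding]
  show "is_coequalizer (typed M) (tensor_ob (typed M) X A) (tensor_ob (typed M) X B)
      (tensor (typed M) (Idt (typed M) X) f') (tensor (typed M) (Idt (typed M) X) g')
      (tensor_ob (typed M) X E) (tensor (typed M) (Idt (typed M) X) e') \<and>
    is_coequalizer (typed M) (tensor_ob (typed M) A X) (tensor_ob (typed M) B X)
      (tensor (typed M) f' (Idt (typed M) X)) (tensor (typed M) g' (Idt (typed M) X))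
      (tensor_ob (typed M) E X) (tensor (typed M) e' (Idt (typed M) X))"
    using assms *(4) X unfolding coequalizers_preserved_def *(1-3) by (simp add: iff)
qed

end

theorem theorem6p8:
  fixes M :: "('o, 'm, 'z) sym_monoidal_category_scheme"
    and K A :: "('o, 'm) hopf_data"
    and i p :: 'm
    and Q :: 'o
  assumes "sym_monoidal_category M"
    and "has_equalizers M" and "equalizers_preserved M"
    and "has_coequalizers M" and "coequalizers_preserved M"
    and "is_mono (Hopf_coc M) K A i"
    and "is_quotient M K A i Q p"
  shows "(is_kernel M K A i \<longrightarrow> is_normal M K A i) \<and>
         (is_normal M K A i \<longrightarrow> is_Hopf_coc_quotient_map M A Q p) \<and>
         (\<forall>Z q. is_tensor_over M K A i Z q \<and> is_equalizer_of_tensor_over M K A i Z q \<longrightarrow>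
            (is_normal M K A i \<longleftrightarrow> is_Hopf_coc_quotient_map M A Q p) \<and>
            (is_Hopf_coc_quotient_map M A Q p \<longleftrightarrow> is_kernel M K A i))"
proof -
  interpret sym_monoidal_category M by fact
  have "i \<in> Hom (Hopf_coc M) K A" using assms(6) unfolding is_mono_def by blast
  then have A: "hob A \<in> Ob M"
    unfolding Hopf_coc_def is_hopf_monoid_def is_bimonoid_def is_monoid_def by simp
  have "is_mono (Hopf_coc (typed M)) (typed_hopf M K) (typed_hopf M A) (hob K, i, hob A)"
    unfolding full_embedding.mono_iff[OF typed_Hopf_embedding] by fact
  moreover have "is_quotient (typed M) (typed_hopf M K) (typed_hopf M A) (hob K, i, hob A) Q (hob A, p, Q)"
    unfolding typed_is_quotient by fact
  \<comment> \<open>Here \<open>q'\<close> still ranges over tagged triples; the claim for a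
    morphism \<open>q\<close> of M is the instance with source
    \<open>hob A \<boxtimes> hob A\<close> and target Z.\<close>
  ultimately have typed: "(is_kernel M K A i \<longrightarrow> is_normal M K A i) \<and>
      (is_normal M K A i \<longrightarrow> is_Hopf_coc_quotient_map M A Q p) \<and>
      (\<forall>Z q'. is_tensor_over (typed M) (typed_hopf M K) (typed_hopf M A) (hob K, i, hob A) Z q' \<and>
          is_equalizer_of_tensor_over (typed M) (typed_hopf M K) (typed_hopf M A) (hob K, i, hob A) Z q' \<longrightarrow>
        (is_normal M K A i \<longleftrightarrow> is_Hopf_coc_quotient_map M A Q p) \<and>
        (is_Hopf_coc_quotient_map M A Q p \<longleftrightarrow> is_kernel M K A i))"
    using typed_smc.normal_quotient_kernel[OF typed_typed_smc typed_has_equalizers typed_equalizers_preserved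
        typed_coequalizers_preserved] assms(2,3,5)
    unfolding typed_is_kernel[symmetric] typed_is_normal[OF A, symmetric] typed_is_Hopf_coc_quotient_map[symmetric]
    by blast
  show ?thesis
    using typed unfolding typed_is_tensor_over[symmetric] typed_is_equalizer_of_tensor_over[OF A, symmetric] by blast
qed

end
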